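(* Let $k\geq 1$ be an integer and let $G$ be a finite simple forest on vertex set $\{x_1,\dots,x_n\}$ with $\operatorname{mat}(G)\geq k$; let $\Bbbk$ be a field and $S=\Bbbk[x_1,\dots,x_n]$. Then $\operatorname{reg}(I(G)^{[k]})=2k$ if and only if $\operatorname{aim}(G,k)=k$.
   Context: $I(G)\subseteq S$ is the edge ideal, generated by $x_ix_j$ for edges $\{x_i,x_j\}$ of $G$. $\operatorname{mat}(G)$ is the matching number. $I(G)^{[k]}$ is the ideal generated by the products $e_1\cdots e_k$ over all matchings $\{e_1,\dots,e_k\}$ of size $k$ (edge $\{x_i,x_j\}$ identified with $x_ix_j$). $\operatorname{reg}$ is Castelnuovo–Mumford regularity. Two edges form a gap if they are disjoint and no edge of $G$ joins a vertex of one to a vertex of the other. A sequence $(a_1,\dots,a_n)$ of integers is $k$-admissable if $a_i\ge1$ for all $i$ and $\sum a_i\le n+k-1$. For $1\le k\le\operatorname{mat}(G)$, a matching $M$ is $k$-admissable if there are nonempty pairwise disjoint $M_1,\dots,M_r\subseteq M$ with union $M$ such that edges from different $M_i$'s always form a gap in $G$, $(|M_1|,\dots,|M_r|)$ is $k$-admissable, and the induced subgraph of $G$ on $\bigcup_{e\in M_i}e$ is a forest for each $i$. $\operatorname{aim}(G,k)$ is the maximum size of a $k$-admissable matching ($0$ if none). *)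

theory Defs
  imports Main "HOL-Library.Poly_Mapping"
begin

type_synonym 'k mpoly = "(nat \<Rightarrow>\<^sub>0 nat) \<Rightarrow>\<^sub>0 'k"

definition var :: "nat \<Rightarrow> 'k::field mpoly" where
  "var i = Poly_Mapping.single (Poly_Mapping.single i 1) 1"

definition mdeg :: "(nat \<Rightarrow>\<^sub>0 nat) \<Rightarrow> nat" where
  "mdeg m = (\<Sum>i\<in>Poly_Mapping.keys m. Poly_Mapping.lookup m i)"

(* p is homogeneous of (integer) degree t; the zero polynomial is homogeneous of every degree *)
definition hom_deg :: "'k::field mpoly \<Rightarrow> int \<Rightarrow> bool" where
  "hom_deg p t \<longleftrightarrow> (\<forall>m\<in>Poly_Mapping.keys p. int (mdeg m) = t)"

(* p only involves the variables x_i, i in V, i.e. p is an element of S = k[x_i : i in V] *)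
definition in_vars :: "nat set \<Rightarrow> 'k::field mpoly \<Rightarrow> bool" where
  "in_vars V p \<longleftrightarrow> (\<forall>m\<in>Poly_Mapping.keys p. Poly_Mapping.keys m \<subseteq> V)"

definition ideal_gen :: "nat set \<Rightarrow> 'k::field mpoly set \<Rightarrow> 'k mpoly set" where
  "ideal_gen V G = {\<Sum>g\<in>Gs. c g * g | c Gs. finite Gs \<and> Gs \<subseteq> G \<and> (\<forall>g\<in>Gs. in_vars V (c g))}"

definition free_mod :: "nat set \<Rightarrow> nat \<Rightarrow> (nat \<Rightarrow> 'k::field mpoly) set" where
  "free_mod V r = {v. (\<forall>l. in_vars V (v l)) \<and> (\<forall>l\<ge>r. v l = 0)}"

definition mat_app :: "nat \<Rightarrow> (nat \<Rightarrow> nat \<Rightarrow> 'k::field mpoly) \<Rightarrow> (nat \<Rightarrow> 'k mpoly) \<Rightarrow> (nat \<Rightarrow> 'k mpoly)" where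
  "mat_app r A v = (\<lambda>m. \<Sum>l<r. A m l * v l)"

(* A resolution  0 -> F_L -> ... -> F_1 -> F_0 -> I -> 0  with
   F_i = (+)_l S(- ds i ! l); A i : F_i -> F_(i-1) for i >= 1 and A 0 : F_0 -> S (one row) with image I.
   The target of A i has rank tgt_rank ds i and generator degrees tgt_deg ds i m. *)
definition tgt_rank :: "(nat \<Rightarrow> int list) \<Rightarrow> nat \<Rightarrow> nat" where
  "tgt_rank ds i = (if i = 0 then 1 else length (ds (i - 1)))"

definition tgt_deg :: "(nat \<Rightarrow> int list) \<Rightarrow> nat \<Rightarrow> nat \<Rightarrow> int" where
  "tgt_deg ds i m = (if i = 0 then 0 else ds (i - 1) ! m)"

definition graded_free_res ::
  "nat set \<Rightarrow> 'k::field mpoly set \<Rightarrow> (nat \<Rightarrow> int list) \<Rightarrow> (nat \<Rightarrow> nat \<Rightarrow> nat \<Rightarrow> 'k mpoly) \<Rightarrow> nat \<Rightarrow> bool" where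
  "graded_free_res V I ds A L \<longleftrightarrow>
     (\<forall>i>L. ds i = []) \<and>
     (\<forall>i m l. m < tgt_rank ds i \<and> l < length (ds i) \<longrightarrow>
         in_vars V (A i m l) \<and> hom_deg (A i m l) (ds i ! l - tgt_deg ds i m)) \<and>
     (\<forall>i m l. \<not> (m < tgt_rank ds i \<and> l < length (ds i)) \<longrightarrow> A i m l = 0) \<and>
     (\<lambda>v. mat_app (length (ds 0)) (A 0) v 0) ` free_mod V (length (ds 0)) = I \<and>
     (\<forall>i. {v \<in> free_mod V (length (ds i)). mat_app (length (ds i)) (A i) v = (\<lambda>_. 0)}
          = mat_app (length (ds (Suc i))) (A (Suc i)) ` free_mod V (length (ds (Suc i))))"

(* minimal: all differentials d_i (i >= 1) have entries in the homogeneous maximal ideal *)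
definition minimal_graded_free_res ::
  "nat set \<Rightarrow> 'k::field mpoly set \<Rightarrow> (nat \<Rightarrow> int list) \<Rightarrow> (nat \<Rightarrow> nat \<Rightarrow> nat \<Rightarrow> 'k mpoly) \<Rightarrow> nat \<Rightarrow> bool" where
  "minimal_graded_free_res V I ds A L \<longleftrightarrow>
     graded_free_res V I ds A L \<and> (\<forall>i\<ge>1. \<forall>m l. Poly_Mapping.lookup (A i m l) 0 = 0)"

(* reg I = max { j - i : beta_{i,j}(I) <> 0 }, read off the minimal graded free resolution *)
definition reg :: "nat set \<Rightarrow> 'k::field mpoly set \<Rightarrow> int" where
  "reg V I = (SOME r. \<exists>ds A L. minimal_graded_free_res V I ds A L \<and>
                 r = Max {ds i ! l - int i | i l. l < length (ds i)})"

definition simple_graph :: "nat \<Rightarrow> nat set set \<Rightarrow> bool" where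
  "simple_graph n E \<longleftrightarrow> (\<forall>e\<in>E. e \<subseteq> {1..n} \<and> card e = 2)"

definition is_cycle :: "nat set set \<Rightarrow> nat list \<Rightarrow> bool" where
  "is_cycle E vs \<longleftrightarrow> length vs \<ge> 3 \<and> distinct vs \<and>
     (\<forall>i<length vs. {vs ! i, vs ! ((i + 1) mod length vs)} \<in> E)"

definition forest :: "nat set set \<Rightarrow> bool" where
  "forest E \<longleftrightarrow> \<not> (\<exists>vs. is_cycle E vs)"

definition induced :: "nat set set \<Rightarrow> nat set \<Rightarrow> nat set set" where
  "induced E U = {e \<in> E. e \<subseteq> U}"

definition matching :: "nat set set \<Rightarrow> nat set set \<Rightarrow> bool" where
  "matching E M \<longleftrightarrow> M \<subseteq> E \<and> (\<forall>e\<in>M. \<forall>f\<in>M. e \<noteq> f \<longrightarrow> e \<inter> f = {})"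

definition mat :: "nat set set \<Rightarrow> nat" where
  "mat E = Max {card M | M. matching E M}"

definition gap :: "nat set set \<Rightarrow> nat set \<Rightarrow> nat set \<Rightarrow> bool" where
  "gap E e f \<longleftrightarrow> e \<inter> f = {} \<and> \<not> (\<exists>a\<in>e. \<exists>b\<in>f. {a, b} \<in> E)"

definition admissible_seq :: "nat \<Rightarrow> nat list \<Rightarrow> bool" where
  "admissible_seq k as \<longleftrightarrow> (\<forall>a\<in>set as. a \<ge> 1) \<and> sum_list as \<le> length as + k - 1"

definition admissible_matching :: "nat set set \<Rightarrow> nat \<Rightarrow> nat set set \<Rightarrow> bool" where
  "admissible_matching E k M \<longleftrightarrow> matching E M \<and>
     (\<exists>Ms :: nat set set list.
        (\<forall>i<length Ms. Ms ! i \<noteq> {} \<and> Ms ! i \<subseteq> M) \<and>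
        (\<forall>i<length Ms. \<forall>j<length Ms. i \<noteq> j \<longrightarrow> Ms ! i \<inter> Ms ! j = {}) \<and>
        \<Union> (set Ms) = M \<and>
        (\<forall>i<length Ms. \<forall>j<length Ms. i \<noteq> j \<longrightarrow> (\<forall>e\<in>Ms ! i. \<forall>f\<in>Ms ! j. gap E e f)) \<and>
        admissible_seq k (map card Ms) \<and>
        (\<forall>i<length Ms. forest (induced E (\<Union> (Ms ! i)))))"

definition aim :: "nat set set \<Rightarrow> nat \<Rightarrow> nat" where
  "aim E k = (if \<exists>M. admissible_matching E k M
              then Max {card M | M. admissible_matching E k M} else 0)"

definition edge_mono :: "nat set \<Rightarrow> 'k::field mpoly" where
  "edge_mono e = (\<Prod>i\<in>e. var i)"

definition sq_power_ideal :: "nat \<Rightarrow> nat set set \<Rightarrow> nat \<Rightarrow> 'k::field mpoly set" where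
  "sq_power_ideal n E k =
     ideal_gen {1..n} {\<Prod>e\<in>M. edge_mono e | M. matching E M \<and> card M = k}"

end

theory Submission
  imports Defs
begin

text \<open>
  Say that \<open>G\<close> splits if some \<open>(k+1)\<close>-matching is the union of two nonempty parts with a gap between
  any edge of the one and any edge of the other; this is equivalent to \<open>aim(G,k) > k\<close>, since admissible
  matchings may be shrunk and their parts merged.

  If \<open>G\<close> splits, let \<open>W\<close> be the vertex set of such a matching. A generator of \<open>I(G)\<^sup>[\<^sup>k\<^sup>]\<close> dividing
  \<open>x\<^sub>W\<close> omits two vertices of \<open>W\<close>, and by parity both lie in the same part. Hence a generator of the one
  kind and one of the other are never linked by a chain of linear syzygies below \<open>x\<^sub>W\<close>, so there is a
  minimal first syzygy of degree \<open>2k+2\<close> and the regularity exceeds \<open>2k\<close>.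

  If \<open>G\<close> does not split, a mapping cone along the decomposition of \<open>I(G)\<^sup>[\<^sup>k\<^sup>]\<close> at a leaf \<open>x\<close> whose neighbour
  has at most one neighbour that is not a leaf yields, by induction, a linear (possibly non-minimal)
  resolution. Comparing it with a minimal one bounds the degrees of the latter.
\<close>

text \<open>\<open>reg\<close> reads the degrees off some minimal resolution picked by
  \<open>SOME\<close>. So one has to be constructed, and afterwards only facts valid for all minimal
  resolutions may be used. Existence comes from iterated mapping cones over the generators, followed
  by cancellation of unit entries. That the value is at least 2k is forced by the generators, whose
  monomials contain the vertices of a k-matching.

  Why the leaf: the intersection of the two summands is xy times a sum over the further neighbours w
  of y. If w is a leaf, H - w has the same edges as H, and the w-summand is just w times the ideal
  of H; only the one exceptional neighbour needs a further appeal to the induction hypothesis. Why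
  the bounds fit: in the cone the intersection moves up by one homological degree, so it may have
  bound 2k + 1. The factor xy contributes 2, the neighbour w contributes 1 and a (k-1)-matching 2k -
  2, which adds up to exactly this.

  All ideals involved are determined by the supports of their monomials, so their sums and
  intersections are computed with families of sets.\<close>

abbreviation coeff :: "('a \<Rightarrow>\<^sub>0 'b::zero) \<Rightarrow> 'a \<Rightarrow> 'b" where
  "coeff \<equiv> Poly_Mapping.lookup"

abbreviation supp :: "('a \<Rightarrow>\<^sub>0 'b::zero) \<Rightarrow> 'a set" where
  "supp \<equiv> Poly_Mapping.keys"

abbreviation term_of :: "(nat \<Rightarrow>\<^sub>0 nat) \<Rightarrow> 'k::field \<Rightarrow> 'k mpoly" where
  "term_of \<equiv> Poly_Mapping.single"

section \<open>Polynomials\<close>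

text \<open>Serves three purposes: homogeneous components, splitting a polynomial along a union of
  two support families, and the projection onto one type of monomials in the obstruction.\<close>

definition restr :: "'a set \<Rightarrow> ('a \<Rightarrow>\<^sub>0 'b::zero) \<Rightarrow> ('a \<Rightarrow>\<^sub>0 'b)" where
  "restr X p = Poly_Mapping.mapp (\<lambda>k c. c when k \<in> X) p"

lemma coeff_restr: "coeff (restr X p) m = (if m \<in> X then coeff p m else 0)"
  by (auto simp: restr_def lookup_mapp when_def in_keys_iff)

lemma supp_restr [simp]: "supp (restr X p) = supp p \<inter> X"
  by (auto simp: in_keys_iff coeff_restr split: if_splits)

lemma restr_0 [simp]: "restr X 0 = 0"
  by (intro poly_mapping_eqI) (simp add: coeff_restr)

lemma restr_add: "restr X (p + q) = restr X p + restr X (q :: 'a \<Rightarrow>\<^sub>0 'b::comm_monoid_add)"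
  by (intro poly_mapping_eqI) (simp add: coeff_restr lookup_add)

lemma restr_sum: "restr X (sum f A) = (\<Sum>a\<in>A. restr X (f a :: 'a \<Rightarrow>\<^sub>0 'b::comm_monoid_add))"
  by (induction A rule: infinite_finite_induct) (auto simp: restr_add)

lemma restr_id: "supp p \<subseteq> X \<Longrightarrow> restr X p = p"
  by (intro poly_mapping_eqI) (auto simp: coeff_restr in_keys_iff subset_iff)

lemma restr_eq_0: "supp p \<inter> X = {} \<Longrightarrow> restr X p = 0"
  by (intro poly_mapping_eqI) (auto simp: coeff_restr in_keys_iff)

lemma restr_compl: "restr X p + restr (- X) p = (p :: 'a \<Rightarrow>\<^sub>0 'b::comm_monoid_add)"
  by (intro poly_mapping_eqI) (simp add: coeff_restr lookup_add)

lemma sum_terms: "(\<Sum>m\<in>supp p. Poly_Mapping.single m (coeff p m)) = (p :: 'a \<Rightarrow>\<^sub>0 'b::comm_monoid_add)"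
  by (intro poly_mapping_eqI)
    (auto simp: lookup_sum lookup_single when_def in_keys_iff sum.delta)

lemma coeff_times:
  fixes p q :: "'k::field mpoly"
  shows "coeff (p * q) m = (\<Sum>a\<in>supp p. \<Sum>b\<in>supp q. if a + b = m then coeff p a * coeff q b else 0)"
proof -
  have "p * q = (\<Sum>a\<in>supp p. term_of a (coeff p a)) * (\<Sum>b\<in>supp q. term_of b (coeff q b))"
    by (simp only: sum_terms)
  also have "\<dots> = (\<Sum>a\<in>supp p. \<Sum>b\<in>supp q. term_of (a + b) (coeff p a * coeff q b))"
    by (simp add: sum_product mult_single)
  finally show ?thesis
    by (simp add: lookup_sum lookup_single when_def)
qed

lemma coeff_times_term: "coeff (term_of u c * p) (u + m) = c * coeff p m"
proof (cases "c = 0")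
  case False
  have "coeff (term_of u c * p) (u + m) = (\<Sum>b\<in>supp p. if b = m then c * coeff p b else 0)"
    using False by (simp add: coeff_times)
  also have "\<dots> = c * coeff p m"
    by (auto simp: in_keys_iff)
  finally show ?thesis .
qed simp

lemma coeff_times_0 [simp]: "coeff (p * q) 0 = coeff p 0 * coeff (q :: 'k::field mpoly) 0"
proof -
  have z: "a + b = 0 \<longleftrightarrow> a = 0 \<and> b = 0" for a b :: "nat \<Rightarrow>\<^sub>0 nat"
    by (auto simp: poly_mapping_eq_iff fun_eq_iff lookup_add)
  have "coeff (p * q) 0 = (\<Sum>a\<in>supp p. if a = 0 then \<Sum>b\<in>supp q. if b = 0 then coeff p a * coeff q b else 0 else 0)"
    unfolding coeff_times by (intro sum.cong) (auto simp: z)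
  also have "\<dots> = coeff p 0 * coeff q 0"
    by (auto simp: in_keys_iff)
  finally show ?thesis .
qed

lemma coeff_sum_0: "coeff (sum f A) 0 = (\<Sum>a\<in>A. coeff (f a) 0)"
  by (rule lookup_sum)

lemma supp_plus_nat [simp]: "supp (a + b) = supp a \<union> supp (b :: nat \<Rightarrow>\<^sub>0 nat)"
  by (auto simp: in_keys_iff lookup_add)

lemma supp_timesE:
  assumes "m \<in> supp (p * (q :: 'k::field mpoly))"
  obtains a b where "a \<in> supp p" "b \<in> supp q" "m = a + b"
  using assms keys_mult[of p q] by blast

lemma in_vars_0 [simp]: "in_vars V 0"
  and in_vars_1 [simp]: "in_vars V 1"
  by (auto simp: in_vars_def)

lemma in_vars_add: "in_vars V p \<Longrightarrow> in_vars V q \<Longrightarrow> in_vars V (p + q)"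
  using keys_add[of p q] by (auto simp: in_vars_def)

lemma in_vars_uminus: "in_vars V p \<Longrightarrow> in_vars V (- p)"
  by (auto simp: in_vars_def in_keys_iff)

lemma in_vars_diff: "in_vars V p \<Longrightarrow> in_vars V q \<Longrightarrow> in_vars V (p - q)"
  using in_vars_add[of V p "- q"] in_vars_uminus[of V q] by simp

lemma in_vars_mult: "in_vars V p \<Longrightarrow> in_vars V q \<Longrightarrow> in_vars V (p * q)"
  by (fastforce simp: in_vars_def elim!: supp_timesE)

lemma in_vars_sum: "(\<And>a. a \<in> A \<Longrightarrow> in_vars V (f a)) \<Longrightarrow> in_vars V (sum f A)"
  by (induction A rule: infinite_finite_induct) (auto intro: in_vars_add)

lemma in_vars_restr: "in_vars V p \<Longrightarrow> in_vars V (restr X p)"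
  by (auto simp: in_vars_def)

lemma in_vars_termI: "supp m \<subseteq> V \<Longrightarrow> in_vars V (term_of m c)"
  by (simp add: in_vars_def)

lemmas in_vars_intros = in_vars_add in_vars_uminus in_vars_diff in_vars_mult in_vars_sum
  in_vars_restr

lemma mdeg_alt: "finite A \<Longrightarrow> supp m \<subseteq> A \<Longrightarrow> mdeg m = (\<Sum>i\<in>A. coeff m i)"
  unfolding mdeg_def by (rule sum.mono_neutral_left) (auto simp: in_keys_iff)

lemma mdeg_add [simp]: "mdeg (a + b) = mdeg a + mdeg b"
proof -
  have "mdeg (a + b) = (\<Sum>i\<in>supp a \<union> supp b. coeff (a + b) i)"
    by (rule mdeg_alt) auto
  also have "\<dots> = (\<Sum>i\<in>supp a \<union> supp b. coeff a i) + (\<Sum>i\<in>supp a \<union> supp b. coeff b i)"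
    by (simp add: lookup_add sum.distrib)
  finally show ?thesis
    by (simp add: mdeg_alt[of "supp a \<union> supp b" a] mdeg_alt[of "supp a \<union> supp b" b])
qed

lemma mdeg_0 [simp]: "mdeg 0 = 0"
  by (simp add: mdeg_def)

lemma mdeg_eq_0_iff: "mdeg m = 0 \<longleftrightarrow> m = 0"
proof
  assume "mdeg m = 0"
  then have "coeff m i = 0" for i by (auto simp: mdeg_def in_keys_iff)
  then show "m = 0" by (intro poly_mapping_eqI) simp
qed simp

lemma hom_deg_0 [simp]: "hom_deg 0 t"
  by (simp add: hom_deg_def)

lemma hom_deg_1 [simp]: "hom_deg 1 0"
  by (simp add: hom_deg_def)

lemma hom_deg_add: "hom_deg p t \<Longrightarrow> hom_deg q t \<Longrightarrow> hom_deg (p + q) t"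
  using keys_add[of p q] by (auto simp: hom_deg_def)

lemma hom_deg_uminus: "hom_deg p t \<Longrightarrow> hom_deg (- p) t"
  by (auto simp: hom_deg_def in_keys_iff)

lemma hom_deg_diff: "hom_deg p t \<Longrightarrow> hom_deg q t \<Longrightarrow> hom_deg (p - q) t"
  using hom_deg_add[of p t "- q"] hom_deg_uminus[of q t] by simp

lemma hom_deg_mult: "hom_deg p s \<Longrightarrow> hom_deg q t \<Longrightarrow> hom_deg (p * q) (s + t)"
  by (fastforce simp: hom_deg_def elim!: supp_timesE)

lemma hom_deg_sum: "(\<And>a. a \<in> A \<Longrightarrow> hom_deg (f a) t) \<Longrightarrow> hom_deg (sum f A) t"
  by (induction A rule: infinite_finite_induct) (auto intro: hom_deg_add)

lemma hom_deg_restr: "hom_deg p t \<Longrightarrow> hom_deg (restr X p) t"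
  by (auto simp: hom_deg_def)

lemma hom_deg_unit: "hom_deg p t \<Longrightarrow> coeff p 0 \<noteq> 0 \<Longrightarrow> t = 0"
  by (force simp: hom_deg_def in_keys_iff)

lemma hom_deg_0_const: 
  assumes "hom_deg p 0" 
  shows "p = term_of 0 (coeff p 0)"
  using assms by (intro poly_mapping_eqI)
    (auto simp: hom_deg_def in_keys_iff lookup_single when_def mdeg_eq_0_iff)

definition hcomp :: "int \<Rightarrow> 'k::field mpoly \<Rightarrow> 'k mpoly" where
  "hcomp t = restr {m. int (mdeg m) = t}"

lemma hom_deg_hcomp: "hom_deg (hcomp t p) t"
  by (auto simp: hcomp_def hom_deg_def)

lemma hcomp_hom: "hom_deg p s \<Longrightarrow> hcomp t p = (if s = t then p else 0)"
  by (auto simp: hcomp_def hom_deg_def intro!: restr_id restr_eq_0)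

lemma hcomp_0 [simp]: "hcomp t 0 = 0"
  by (simp add: hcomp_def)

lemma hcomp_sum: "hcomp t (sum f A) = (\<Sum>a\<in>A. hcomp t (f a))"
  unfolding hcomp_def by (rule restr_sum)

text \<open>The part of \<open>p\<close> outside degree \<open>t\<close> lands outside degree
  \<open>u\<close> after multiplication by \<open>q\<close>. This is what allows a chain map to be
  made homogeneous entry by entry.\<close>

lemma hcomp_mult:
  assumes "hom_deg q d" "u = t + d"
  shows "hcomp u (q * p) = q * hcomp t p"
proof -
  let ?X = "{m. int (mdeg m) = t}"
  have "q * p = q * hcomp t p + q * restr (- ?X) p"
    by (simp add: hcomp_def restr_compl flip: distrib_left)
  moreover have "hcomp u (q * hcomp t p) = q * hcomp t p"
    using hom_deg_mult[OF assms(1) hom_deg_hcomp[of t p]] assms(2)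
    by (simp add: hcomp_hom add.commute)
  moreover have "hcomp u (q * restr (- ?X) p) = 0"
    unfolding hcomp_def using assms
    by (intro restr_eq_0) (fastforce simp: hom_deg_def elim!: supp_timesE)
  ultimately show ?thesis
    by (simp add: hcomp_def restr_add assms(2))
qed

lemma in_vars_hcomp: "in_vars V p \<Longrightarrow> in_vars V (hcomp t p)"
  by (simp add: hcomp_def in_vars_restr)

section \<open>Squarefree monomials and their factorizations\<close>

definition ind :: "nat set \<Rightarrow> (nat \<Rightarrow>\<^sub>0 nat)" where
  "ind W = (\<Sum>i\<in>W. Poly_Mapping.single i 1)"

lemma coeff_ind: "finite W \<Longrightarrow> coeff (ind W) i = (if i \<in> W then 1 else 0)"
  by (simp add: ind_def lookup_sum lookup_single when_def)

lemma supp_ind [simp]: "finite W \<Longrightarrow> supp (ind W) = W"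
  by (auto simp: in_keys_iff coeff_ind split: if_splits)

lemma mdeg_ind: "finite W \<Longrightarrow> mdeg (ind W) = card W"
  by (simp add: mdeg_def coeff_ind)

lemma ind_inj: "finite A \<Longrightarrow> finite B \<Longrightarrow> ind A = ind B \<longleftrightarrow> A = B"
  by (metis supp_ind)

lemma ind_diff: "finite W \<Longrightarrow> A \<subseteq> W \<Longrightarrow> ind A + ind (W - A) = ind W"
  unfolding ind_def by (subst sum.subset_diff) (auto simp: add.commute)

text \<open>All exponents of \<open>ind W\<close> are at most one, so its two factors cannot share a
  variable: they are squarefree with complementary supports.\<close>

lemma ind_summand:
  assumes "finite W" "a + b = ind W"
  shows "a = ind (supp a)" "supp a \<subseteq> W" "b = ind (W - supp a)"
proof -
  have c: "coeff a i + coeff b i = (if i \<in> W then 1 else 0)" for i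
    using assms by (metis coeff_ind lookup_add)
  show s: "supp a \<subseteq> W"
    using c by (force simp: in_keys_iff split: if_splits)
  have "coeff a i = coeff (ind (supp a)) i" for i
  proof (cases "i \<in> supp a")
    case True
    then show ?thesis using c[of i] by (auto simp: coeff_ind in_keys_iff split: if_splits)
  qed (simp add: coeff_ind in_keys_iff)
  then show a: "a = ind (supp a)" by (rule poly_mapping_eqI)
  have "a + b = a + ind (W - supp a)"
    using assms ind_diff[OF assms(1) s] a by simp
  then show "b = ind (W - supp a)" by simp
qed

text \<open>The factorizations of a squarefree monomial correspond to the subsets of its support, so
  the convolution becomes a sum over \<open>Pow W\<close>.\<close>

lemma coeff_times_ind:
  fixes p q :: "'k::field mpoly"
  assumes "finite W"
  shows "coeff (p * q) (ind W) = (\<Sum>A\<in>Pow W. coeff p (ind A) * coeff q (ind (W - A)))"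
proof -
  have fin: "finite A" if "A \<in> Pow W" for A using assms that by (auto intro: finite_subset)
  have "coeff (p * q) (ind W) = (\<Sum>(a, b)\<in>supp p \<times> supp q. if a + b = ind W then coeff p a * coeff q b else 0)"
    by (simp add: coeff_times sum.cartesian_product)
  also have "\<dots> = (\<Sum>(a, b)\<in>{(a, b) \<in> supp p \<times> supp q. a + b = ind W}. coeff p a * coeff q b)"
    by (rule sum.mono_neutral_cong_right) (auto split: if_splits)
  also have "\<dots> = (\<Sum>(a, b)\<in>(\<lambda>A. (ind A, ind (W - A))) ` Pow W. coeff p a * coeff q b)"
  proof (rule sum.mono_neutral_left)
    show "finite ((\<lambda>A. (ind A, ind (W - A))) ` Pow W)" using assms by simp
    show "{(a, b) \<in> supp p \<times> supp q. a + b = ind W} \<subseteq> (\<lambda>A. (ind A, ind (W - A))) ` Pow W"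
    proof safe
      fix a b assume "a + b = ind W"
      from ind_summand[OF assms this]
      show "(a, b) \<in> (\<lambda>A. (ind A, ind (W - A))) ` Pow W"
        by (intro image_eqI[of _ _ "supp a"]) auto
    qed
    show "\<forall>i\<in>(\<lambda>A. (ind A, ind (W - A))) ` Pow W - {(a, b) \<in> supp p \<times> supp q. a + b = ind W}.
       (case i of (a, b) \<Rightarrow> coeff p a * coeff q b) = 0"
      using assms by (auto simp: ind_diff in_keys_iff)
  qed
  also have "\<dots> = (\<Sum>A\<in>Pow W. coeff p (ind A) * coeff q (ind (W - A)))"
    using fin by (subst sum.reindex) (auto intro!: inj_onI simp: ind_inj)
  finally show ?thesis .
qed

section \<open>Graded free resolutions as one differential module\<close>

definition fmod :: "nat set \<Rightarrow> 'b set \<Rightarrow> ('b \<Rightarrow> 'k::field mpoly) set" where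
  "fmod V B = {v. (\<forall>b. in_vars V (v b)) \<and> (\<forall>b. b \<notin> B \<longrightarrow> v b = 0)}"

definition rowapp :: "'b set \<Rightarrow> ('b \<Rightarrow> 'k::field mpoly) \<Rightarrow> ('b \<Rightarrow> 'k mpoly) \<Rightarrow> 'k mpoly" where
  "rowapp B e v = (\<Sum>l\<in>B. e l * v l)"

definition matapp :: "'b set \<Rightarrow> ('a \<Rightarrow> 'b \<Rightarrow> 'k::field mpoly) \<Rightarrow> ('b \<Rightarrow> 'k mpoly) \<Rightarrow> ('a \<Rightarrow> 'k mpoly)" where
  "matapp B D v = (\<lambda>m. rowapp B (D m) v)"

definition uvec :: "'b \<Rightarrow> 'b \<Rightarrow> 'k::field mpoly" where
  "uvec b = (\<lambda>x. if x = b then 1 else 0)"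

lemma fmodD: "v \<in> fmod V B \<Longrightarrow> in_vars V (v b)" "v \<in> fmod V B \<Longrightarrow> b \<notin> B \<Longrightarrow> v b = 0"
  by (auto simp: fmod_def)

lemma fmodI: "(\<And>b. in_vars V (v b)) \<Longrightarrow> (\<And>b. b \<notin> B \<Longrightarrow> v b = 0) \<Longrightarrow> v \<in> fmod V B"
  by (auto simp: fmod_def)

lemma fmod_0 [simp]: "(\<lambda>_. 0) \<in> fmod V B"
  by (simp add: fmod_def)

lemma fmod_add: "v \<in> fmod V B \<Longrightarrow> w \<in> fmod V B \<Longrightarrow> (\<lambda>b. v b + w b) \<in> fmod V B"
  and fmod_diff: "v \<in> fmod V B \<Longrightarrow> w \<in> fmod V B \<Longrightarrow> (\<lambda>b. v b - w b) \<in> fmod V B"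
  and fmod_uminus: "v \<in> fmod V B \<Longrightarrow> (\<lambda>b. - v b) \<in> fmod V B"
  and fmod_scale: "v \<in> fmod V B \<Longrightarrow> in_vars V c \<Longrightarrow> (\<lambda>b. c * v b) \<in> fmod V B"
  and fmod_filter: "v \<in> fmod V B \<Longrightarrow> (\<lambda>b. if P b then v b else 0) \<in> fmod V B"
  by (auto simp: fmod_def intro: in_vars_intros)

lemma fmod_uvec: "b \<in> B \<Longrightarrow> uvec b \<in> fmod V B"
  by (auto simp: fmod_def uvec_def)

lemma rowapp_0 [simp]: "rowapp B e (\<lambda>_. 0) = 0"
  and rowapp_add: "rowapp B e (\<lambda>b. v b + w b) = rowapp B e v + rowapp B e w"
  and rowapp_diff: "rowapp B e (\<lambda>b. v b - w b) = rowapp B e v - rowapp B e w"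
  and rowapp_uminus: "rowapp B e (\<lambda>b. - v b) = - rowapp B e v"
  and rowapp_scale: "rowapp B e (\<lambda>b. c * v b) = c * rowapp B e v"
  by (simp_all add: rowapp_def algebra_simps sum.distrib sum_subtractf sum_negf sum_distrib_left)

lemma rowapp_cong: "(\<And>b. b \<in> B \<Longrightarrow> e b * v b = e' b * v' b) \<Longrightarrow> rowapp B e v = rowapp B e' v'"
  by (auto simp: rowapp_def)

lemma rowapp_uvec: "finite B \<Longrightarrow> b \<in> B \<Longrightarrow> rowapp B e (uvec b) = e b"
  by (simp add: rowapp_def uvec_def if_distrib cong: if_cong)

lemma matapp_0 [simp]: "matapp B D (\<lambda>_. 0) = (\<lambda>_. 0)"
  and matapp_add: "matapp B D (\<lambda>b. v b + w b) = (\<lambda>m. matapp B D v m + matapp B D w m)"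
  and matapp_diff: "matapp B D (\<lambda>b. v b - w b) = (\<lambda>m. matapp B D v m - matapp B D w m)"
  and matapp_uminus: "matapp B D (\<lambda>b. - v b) = (\<lambda>m. - matapp B D v m)"
  and matapp_scale: "matapp B D (\<lambda>b. c * v b) = (\<lambda>m. c * matapp B D v m)"
  by (simp_all add: matapp_def rowapp_add rowapp_diff rowapp_uminus rowapp_scale)

lemma matapp_uvec: "finite B \<Longrightarrow> b \<in> B \<Longrightarrow> matapp B D (uvec b) = (\<lambda>m. D m b)"
  by (simp add: matapp_def rowapp_uvec)

lemma rowapp_matapp:
  "rowapp A e (matapp B D v) = rowapp B (\<lambda>l. rowapp A e (\<lambda>k. D k l)) v"
  unfolding rowapp_def matapp_def
  by (simp add: sum_distrib_left sum_distrib_right mult.assoc) (rule sum.swap)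

lemma matapp_matapp:
  "matapp A E (matapp B D v) = matapp B (\<lambda>m l. matapp A E (\<lambda>k. D k l) m) v"
  by (rule ext) (simp add: matapp_def rowapp_matapp[unfolded matapp_def])

lemma matapp_fmod:
  assumes "\<And>b. b \<in> B \<Longrightarrow> (\<lambda>m. D m b) \<in> fmod V A" "v \<in> fmod V B"
  shows "matapp B D v \<in> fmod V A"
  using assms by (auto simp: fmod_def matapp_def rowapp_def intro!: in_vars_intros)

text \<open>All free modules of the resolution are collected in one module with basis \<open>B\<close>, where
  \<open>lev b\<close> is the homological degree of \<open>b\<close>; \<open>e\<close> is the row of the augmentation onto \<open>I\<close> and \<open>D\<close> the
  sum of all differentials. Exactness becomes \<open>ker e \<inter> ker D = im D\<close>.\<close>

locale gres =
  fixes V :: "nat set" and I :: "'k::field mpoly set" and B :: "'b set"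
    and lev :: "'b \<Rightarrow> nat" and deg :: "'b \<Rightarrow> int"
    and e :: "'b \<Rightarrow> 'k mpoly" and D :: "'b \<Rightarrow> 'b \<Rightarrow> 'k mpoly"
  assumes fin: "finite B"
    and e_in: "\<And>l. in_vars V (e l)"
    and e_hom: "\<And>l. hom_deg (e l) (deg l)"
    and e_lev: "\<And>l. e l \<noteq> 0 \<Longrightarrow> l \<in> B \<and> lev l = 0"
    and D_in: "\<And>m l. in_vars V (D m l)"
    and D_hom: "\<And>m l. hom_deg (D m l) (deg l - deg m)"
    and D_lev: "\<And>m l. D m l \<noteq> 0 \<Longrightarrow> m \<in> B \<and> l \<in> B \<and> lev l = Suc (lev m)"
    and img: "rowapp B e ` fmod V B = I"
    and exact: "\<And>v. v \<in> fmod V B \<Longrightarrow>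
      rowapp B e v = 0 \<and> matapp B D v = (\<lambda>_. 0) \<longleftrightarrow> (\<exists>w\<in>fmod V B. v = matapp B D w)"
begin

lemma col_fmod: "(\<lambda>m. D m b) \<in> fmod V B"
  using D_in D_lev by (auto simp: fmod_def)

lemma D_fmod: "v \<in> fmod V B \<Longrightarrow> matapp B D v \<in> fmod V B"
  by (intro matapp_fmod col_fmod)

lemma aug_D: "v \<in> fmod V B \<Longrightarrow> rowapp B e (matapp B D v) = 0"
  and D_D: "v \<in> fmod V B \<Longrightarrow> matapp B D (matapp B D v) = (\<lambda>_. 0)"
  using exact[OF D_fmod] by blast+

lemma D_col: "matapp B D (\<lambda>k. D k b) = (\<lambda>_. 0)"
proof (cases "b \<in> B")
  case True
  then show ?thesis using D_D[OF fmod_uvec[OF True]] by (simp add: matapp_uvec fin)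
next
  case False
  then have "D k b = 0" for k using D_lev by blast
  then show ?thesis by simp
qed

lemma aug_col: "rowapp B e (\<lambda>k. D k b) = 0"
proof (cases "b \<in> B")
  case True
  then show ?thesis using aug_D[OF fmod_uvec[OF True]] by (simp add: matapp_uvec fin)
next
  case False
  then have "D k b = 0" for k using D_lev by blast
  then show ?thesis by simp
qed

lemma exactE:
  assumes "v \<in> fmod V B" "rowapp B e v = 0" "matapp B D v = (\<lambda>_. 0)"
  obtains w where "w \<in> fmod V B" "v = matapp B D w"
  using assms exact by blast

lemma aug_in: "v \<in> fmod V B \<Longrightarrow> rowapp B e v \<in> I"
  using img by blast

lemma I_diff: "x \<in> I \<Longrightarrow> y \<in> I \<Longrightarrow> x - y \<in> I"
  unfolding img[symmetric] by (auto simp: rowapp_diff[symmetric] intro!: imageI fmod_diff)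

lemma e_in_I: "b \<in> B \<Longrightarrow> e b \<in> I"
  using aug_in[OF fmod_uvec] by (simp add: rowapp_uvec fin)

text \<open>\<open>e\<close> sees only level 0, where \<open>D\<close> vanishes. Hence the part of a
  preimage in level 0 is still a preimage, and it is a cycle.\<close>

lemma img_cycleE:
  assumes "x \<in> I"
  obtains v where "v \<in> fmod V B" "matapp B D v = (\<lambda>_. 0)" "rowapp B e v = x"
proof -
  obtain v where v: "v \<in> fmod V B" "rowapp B e v = x" using assms img by blast
  let ?v = "\<lambda>b. if lev b = 0 then v b else 0"
  have "rowapp B e ?v = x"
    unfolding v(2)[symmetric]
  proof (rule rowapp_cong)
    show "e b * ?v b = e b * v b" for b
      using e_lev[of b] by (cases "e b = 0") auto
  qed
  moreover have "matapp B D ?v = (\<lambda>_. 0)"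
    unfolding matapp_def rowapp_def using D_lev by (intro ext sum.neutral) fastforce
  moreover have "?v \<in> fmod V B" using v(1) by (rule fmod_filter)
  ultimately show ?thesis using that by blast
qed

text \<open>Exactness prescribes \<open>D w\<close> but leaves the augmentation uncontrolled; adding
  a cycle with the missing augmentation repairs it without changing \<open>D w\<close>.\<close>

lemma solve:
  assumes "v \<in> fmod V B" "rowapp B e v = 0" "matapp B D v = (\<lambda>_. 0)" "x \<in> I"
  obtains w where "w \<in> fmod V B" "matapp B D w = v" "rowapp B e w = x"
proof -
  obtain w where w: "w \<in> fmod V B" "v = matapp B D w" using assms exactE by blast
  have "x - rowapp B e w \<in> I" using assms(4) aug_in[OF w(1)] by (rule I_diff)
  then obtain u where u: "u \<in> fmod V B" "matapp B D u = (\<lambda>_. 0)" "rowapp B e u = x - rowapp B e w"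
    by (rule img_cycleE)
  show ?thesis
  proof (rule that)
    show "(\<lambda>b. w b + u b) \<in> fmod V B" by (intro fmod_add w u)
    show "matapp B D (\<lambda>b. w b + u b) = v" by (simp add: matapp_add u w)
    show "rowapp B e (\<lambda>b. w b + u b) = x" by (simp add: rowapp_add u w)
  qed
qed

text \<open>With \<open>T = 0\<close> and \<open>s = 1\<close> this lifts \<open>\<tau>\<close> to a chain map, with \<open>\<tau> = 0\<close> and \<open>s = -1\<close> it contracts the
  chain map \<open>T\<close> by a homotopy.\<close>

lemma lift:
  fixes B' :: "'c set" and T :: "'b \<Rightarrow> 'c \<Rightarrow> 'k mpoly"
  assumes fin': "finite B'"
    and D'_in: "\<And>m l. in_vars V (D' m l)"
    and D'_lev: "\<And>m l. D' m l \<noteq> 0 \<Longrightarrow> m \<in> B' \<and> l \<in> B' \<and> lev' l = Suc (lev' m)"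
    and D'_D': "\<And>b. matapp B' D' (\<lambda>k. D' k b) = (\<lambda>_. 0)"
    and T: "\<And>b. (\<lambda>m. T m b) \<in> fmod V B"
    and \<tau>: "\<And>b. b \<in> B' \<Longrightarrow> \<tau> b \<in> I"
    and s: "in_vars V s"
    and DT: "\<And>b. b \<in> B' \<Longrightarrow> matapp B D (\<lambda>m. T m b) = (\<lambda>m. - s * matapp B' T (\<lambda>k. D' k b) m)"
    and eT: "\<And>b. b \<in> B' \<Longrightarrow> rowapp B e (\<lambda>m. T m b) + s * rowapp B' \<tau> (\<lambda>k. D' k b) = 0"
  obtains \<Phi> where "\<And>b. (\<lambda>m. \<Phi> m b) \<in> fmod V B"
    and "\<And>b. b \<in> B' \<Longrightarrow> rowapp B e (\<lambda>m. \<Phi> m b) = \<tau> b"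
    and "\<And>b. b \<in> B' \<Longrightarrow> matapp B D (\<lambda>m. \<Phi> m b) = (\<lambda>m. T m b + s * matapp B' \<Phi> (\<lambda>k. D' k b) m)"
proof -
  let ?good = "\<lambda>\<Phi> b. rowapp B e (\<lambda>m. \<Phi> m b) = \<tau> b \<and>
    matapp B D (\<lambda>m. \<Phi> m b) = (\<lambda>m. T m b + s * matapp B' \<Phi> (\<lambda>k. D' k b) m)"
  have colD': "(\<lambda>k. D' k b) \<in> fmod V B'" for b
    using D'_in D'_lev by (auto simp: fmod_def)
  \<comment> \<open>Induction on the level: the equation for \<open>b\<close> refers only to columns
    \<open>k\<close> with \<open>D' k b\<close> nonzero, and these are one level below
    \<open>b\<close>.\<close>
  have ex: "\<exists>\<Phi>. (\<forall>b. (\<lambda>m. \<Phi> m b) \<in> fmod V B) \<and> (\<forall>b\<in>B'. lev' b < N \<longrightarrow> ?good \<Phi> b)" for N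
  proof (induction N)
    case 0
    have "(\<forall>b. (\<lambda>m. 0) \<in> fmod V B) \<and> (\<forall>b\<in>B'. lev' b < 0 \<longrightarrow> ?good (\<lambda>_ _. 0) b)" by simp
    then show ?case by (rule exI[of _ "\<lambda>_ _. 0"])
  next
    case (Suc N)
    then obtain \<Phi> where \<Phi>: "\<And>b. (\<lambda>m. \<Phi> m b) \<in> fmod V B"
      and good: "\<And>b. b \<in> B' \<Longrightarrow> lev' b < N \<Longrightarrow> ?good \<Phi> b" by blast
    have "\<exists>x. x \<in> fmod V B \<and> rowapp B e x = \<tau> b \<and>
        matapp B D x = (\<lambda>m. T m b + s * matapp B' \<Phi> (\<lambda>k. D' k b) m)"
      if b: "b \<in> B'" "lev' b = N" for b
    proof -
      let ?r = "\<lambda>m. T m b + s * matapp B' \<Phi> (\<lambda>k. D' k b) m"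
      have r: "?r \<in> fmod V B"
        by (intro fmod_add T fmod_scale matapp_fmod \<Phi> colD' s)
      have goodk: "?good \<Phi> k" if "D' k b \<noteq> 0" for k
        using D'_lev[OF that] b by (intro good) auto
      have "rowapp B e (matapp B' \<Phi> (\<lambda>k. D' k b)) = rowapp B' \<tau> (\<lambda>k. D' k b)"
        unfolding rowapp_matapp using goodk by (intro rowapp_cong) (metis mult_zero_right)
      then have "rowapp B e ?r = 0"
        using eT[OF b(1)] by (simp add: rowapp_add rowapp_scale)
      \<comment> \<open>By the equation one level below, \<open>D\<close> turns the second summand
        of \<open>?r\<close> into \<open>s\<close> times \<open>T\<close> applied to the column of
        \<open>D'\<close>, since \<open>D'\<close> squares to zero. Assumption \<open>DT\<close>
        makes this cancel against \<open>D\<close> of the first summand.\<close>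
      moreover have "matapp B D ?r = (\<lambda>_. 0)"
      proof
        fix m
        have "matapp B D (matapp B' \<Phi> (\<lambda>k. D' k b)) m
            = rowapp B' (\<lambda>l. T m l + s * matapp B' \<Phi> (\<lambda>k. D' k l) m) (\<lambda>k. D' k b)"
          unfolding matapp_matapp unfolding matapp_def[of B' "\<lambda>m l. matapp B D (\<lambda>k. \<Phi> k l) m"]
          using goodk by (intro rowapp_cong) (metis (no_types, lifting) mult_zero_right)
        also have "\<dots> = matapp B' T (\<lambda>k. D' k b) m
            + s * matapp B' \<Phi> (matapp B' D' (\<lambda>k. D' k b)) m"
          unfolding matapp_matapp 
          by (simp add: matapp_def rowapp_def distrib_right sum.distrib
              sum_distrib_left sum_distrib_right mult.assoc)
        finally show "matapp B D ?r m = 0"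
          by (simp add: matapp_add matapp_scale DT[OF b(1)] D'_D')
      qed
      ultimately show ?thesis using solve[OF r] \<tau>[OF b(1)] by metis
    qed
    then obtain x where x: "\<And>b. b \<in> B' \<Longrightarrow> lev' b = N \<Longrightarrow> x b \<in> fmod V B \<and> rowapp B e (x b) = \<tau> b \<and>
        matapp B D (x b) = (\<lambda>m. T m b + s * matapp B' \<Phi> (\<lambda>k. D' k b) m)" by metis
    define \<Psi> where "\<Psi> m b = (if b \<in> B' \<and> lev' b = N then x b m else \<Phi> m b)" for m b
    have "(\<lambda>m. \<Psi> m b) = (if b \<in> B' \<and> lev' b = N then x b else (\<lambda>m. \<Phi> m b))" for b
      by (auto simp: \<Psi>_def)
    then have "(\<lambda>m. \<Psi> m b) \<in> fmod V B" for b
      using x[of b] \<Phi>[of b] by simp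
    moreover have "?good \<Psi> b" if b: "b \<in> B'" "lev' b < Suc N" for b
    proof -
      have "matapp B' \<Psi> (\<lambda>k. D' k b) m = matapp B' \<Phi> (\<lambda>k. D' k b) m" for m
        unfolding matapp_def
      proof (rule rowapp_cong)
        fix k
        show "\<Psi> m k * D' k b = \<Phi> m k * D' k b"
          using D'_lev[of k b] b by (cases "D' k b = 0") (auto simp: \<Psi>_def)
      qed
      then show ?thesis
        using x[of b] good[of b] b by (cases "lev' b = N") (auto simp: \<Psi>_def)
    qed
    ultimately show ?case by blast
  qed
  obtain N where N: "\<And>b. b \<in> B' \<Longrightarrow> lev' b < N"
  proof
    show "b \<in> B' \<Longrightarrow> lev' b < Suc (Max (lev' ` B'))" for b
      using fin' by (auto simp: less_Suc_eq_le)
  qed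
  show ?thesis using ex[of N] N that by blast
qed

end

section \<open>Chain maps lifting an inclusion of ideals\<close>

definition chain_map where
  "chain_map V B e D B' e' D' \<Phi> \<longleftrightarrow>
     (\<forall>b. (\<lambda>m. \<Phi> m b) \<in> fmod V B) \<and>
     (\<forall>b\<in>B'. rowapp B e (\<lambda>m. \<Phi> m b) = e' b) \<and>
     (\<forall>b\<in>B'. matapp B D (\<lambda>m. \<Phi> m b) = matapp B' \<Phi> (\<lambda>k. D' k b))"

lemma chain_map_fmod:
  "chain_map V B e D B' e' D' \<Phi> \<Longrightarrow> v \<in> fmod V B' \<Longrightarrow> matapp B' \<Phi> v \<in> fmod V B"
  by (auto simp: chain_map_def intro: matapp_fmod)

lemma chain_map_aug:
  "chain_map V B e D B' e' D' \<Phi> \<Longrightarrow> rowapp B e (matapp B' \<Phi> v) = rowapp B' e' v"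
  by (auto simp: rowapp_matapp chain_map_def intro: rowapp_cong)

lemma chain_map_D:
  "chain_map V B e D B' e' D' \<Phi> \<Longrightarrow> matapp B D (matapp B' \<Phi> v) = matapp B' \<Phi> (matapp B' D' v)"
  unfolding matapp_matapp unfolding matapp_def[of B' _ v]
  by (intro ext rowapp_cong) (simp add: chain_map_def)

lemma chain_map_exists:
  assumes "gres V I B lev deg e D" "gres V I' B' lev' deg' e' D'" "I' \<subseteq> I"
  obtains \<Phi> where "chain_map V B e D B' e' D' \<Phi>"
proof -
  interpret G: gres V I B lev deg e D by fact
  interpret F: gres V I' B' lev' deg' e' D' by fact
  show ?thesis
  proof (rule G.lift[of B' D' lev' "\<lambda>_ _. 0" e' 1])
    fix \<Phi>
    assume "\<And>b. (\<lambda>m. \<Phi> m b) \<in> fmod V B" "\<And>b. b \<in> B' \<Longrightarrow> rowapp B e (\<lambda>m. \<Phi> m b) = e' b"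
      "\<And>b. b \<in> B' \<Longrightarrow> matapp B D (\<lambda>m. \<Phi> m b) = (\<lambda>m. 0 + 1 * matapp B' \<Phi> (\<lambda>k. D' k b) m)"
    then show thesis by (intro that[of \<Phi>]) (simp add: chain_map_def)
  next
    show "e' b \<in> I" if "b \<in> B'" for b using F.e_in_I[OF that] assms(3) by blast
    show "matapp B D (\<lambda>m. 0) = (\<lambda>m. - 1 * matapp B' (\<lambda>_ _. 0) (\<lambda>k. D' k b) m)" for b
      by (simp add: matapp_def rowapp_def)
    show "rowapp B e (\<lambda>m. 0) + 1 * rowapp B' e' (\<lambda>k. D' k b) = 0" for b
      by (simp add: F.aug_col)
  qed (use F.fin F.D_in F.D_lev F.D_col in auto)
qed

lemma mult_if_eq: "(a \<noteq> 0 \<Longrightarrow> P) \<Longrightarrow> a * (if P then x else 0) = a * (x :: 'a::mult_zero)"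
  by (cases "a = 0") auto

lemma mult_if_eq_0: "(a \<noteq> 0 \<Longrightarrow> \<not> P) \<Longrightarrow> a * (if P then x else 0) = (0 :: 'a::mult_zero)"
  by (cases "a = 0") auto

text \<open>The conditions on a chain map are linear, and their coefficients are homogeneous and
  shift the level by a fixed amount. So the component of an arbitrary chain map that preserves level
  and degree is again a chain map.\<close>

lemma graded_chain_map_exists:
  assumes "gres V I B lev deg e D" "gres V I' B' lev' deg' e' D'" "I' \<subseteq> I"
  obtains \<Phi> where "chain_map V B e D B' e' D' \<Phi>"
    and "\<And>m b. \<Phi> m b \<noteq> 0 \<Longrightarrow> m \<in> B \<and> lev m = lev' b"
    and "\<And>m b. hom_deg (\<Phi> m b) (deg' b - deg m)"
proof -
  interpret G: gres V I B lev deg e D by fact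
  interpret F: gres V I' B' lev' deg' e' D' by fact
  obtain \<Psi> where \<Psi>: "chain_map V B e D B' e' D' \<Psi>" using chain_map_exists assms by blast
  define \<Phi> where "\<Phi> m b = (if lev m = lev' b then hcomp (deg' b - deg m) (\<Psi> m b) else 0)" for m b
  have \<Psi>_fmod: "(\<lambda>m. \<Psi> m b) \<in> fmod V B" for b
    using \<Psi> by (simp add: chain_map_def)
  have \<Phi>_fmod: "(\<lambda>m. \<Phi> m b) \<in> fmod V B" for b
    using \<Psi>_fmod[of b] by (auto simp: \<Phi>_def fmod_def intro: in_vars_hcomp)
  have "rowapp B e (\<lambda>m. \<Phi> m b) = e' b" if "b \<in> B'" for b
  proof (cases "lev' b = 0")
    case True
    have "rowapp B e (\<lambda>m. \<Phi> m b) = (\<Sum>m\<in>B. hcomp (deg' b) (e m * \<Psi> m b))"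
      unfolding rowapp_def
    proof (rule sum.cong)
      fix m
      have "hcomp (deg' b) (e m * \<Psi> m b) = e m * hcomp (deg' b - deg m) (\<Psi> m b)"
        by (rule hcomp_mult[OF G.e_hom]) simp
      moreover have "lev m = lev' b" if "e m \<noteq> 0" using G.e_lev[OF that] True by simp
      then have "e m * \<Phi> m b = e m * hcomp (deg' b - deg m) (\<Psi> m b)"
        unfolding \<Phi>_def by (rule mult_if_eq)
      ultimately show "e m * \<Phi> m b = hcomp (deg' b) (e m * \<Psi> m b)"
        by (simp only:)
    qed simp
    also have "\<dots> = hcomp (deg' b) (e' b)"
      using \<Psi> that by (simp add: hcomp_sum[symmetric] chain_map_def rowapp_def)
    also have "\<dots> = e' b"
      using hcomp_hom[OF F.e_hom[of b], of "deg' b"] by simp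
    finally show ?thesis .
  next
    case False
    then have "e' b = 0" using F.e_lev[of b] by fastforce
    moreover have "e m * \<Phi> m b = 0" for m
      unfolding \<Phi>_def
    proof (rule mult_if_eq_0)
      show "lev m \<noteq> lev' b" if "e m \<noteq> 0" using G.e_lev[OF that] False by simp
    qed
    ultimately show ?thesis by (simp only: rowapp_def sum.neutral_const)
  qed
  moreover have "matapp B D (\<lambda>m. \<Phi> m b) m = matapp B' \<Phi> (\<lambda>k. D' k b) m" if "b \<in> B'" for b m
  proof (cases "lev' b = Suc (lev m)")
    case True
    let ?t = "deg' b - deg m"
    have "matapp B D (\<lambda>m. \<Phi> m b) m = (\<Sum>k\<in>B. hcomp ?t (D m k * \<Psi> k b))"
      unfolding rowapp_def matapp_def
    proof (rule sum.cong)
      fix k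
      have "hcomp ?t (D m k * \<Psi> k b) = D m k * hcomp (deg' b - deg k) (\<Psi> k b)"
        by (rule hcomp_mult[OF G.D_hom]) simp
      moreover have "lev k = lev' b" if "D m k \<noteq> 0" using G.D_lev[OF that] True by simp
      then have "D m k * \<Phi> k b = D m k * hcomp (deg' b - deg k) (\<Psi> k b)"
        unfolding \<Phi>_def by (rule mult_if_eq)
      ultimately show "D m k * \<Phi> k b = hcomp ?t (D m k * \<Psi> k b)"
        by (simp only:)
    qed simp
    also have "\<dots> = hcomp ?t (matapp B D (\<lambda>m. \<Psi> m b) m)"
      by (simp add: hcomp_sum[symmetric] matapp_def rowapp_def)
    also have "\<dots> = hcomp ?t (matapp B' \<Psi> (\<lambda>k. D' k b) m)"
      using \<Psi> that by (simp add: chain_map_def)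
    also have "\<dots> = (\<Sum>k\<in>B'. hcomp ?t (D' k b * \<Psi> m k))"
      by (simp add: hcomp_sum[symmetric] matapp_def rowapp_def mult.commute)
    also have "\<dots> = matapp B' \<Phi> (\<lambda>k. D' k b) m"
      unfolding rowapp_def matapp_def
    proof (rule sum.cong)
      fix k
      have "hcomp ?t (D' k b * \<Psi> m k) = D' k b * hcomp (deg' k - deg m) (\<Psi> m k)"
        by (rule hcomp_mult[OF F.D_hom]) simp
      moreover have "lev m = lev' k" if "D' k b \<noteq> 0" using F.D_lev[OF that] True by simp
      then have "D' k b * \<Phi> m k = D' k b * hcomp (deg' k - deg m) (\<Psi> m k)"
        unfolding \<Phi>_def by (rule mult_if_eq)
      ultimately show "hcomp ?t (D' k b * \<Psi> m k) = \<Phi> m k * D' k b"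
        by (simp only: mult.commute[of "\<Phi> m k"])
    qed simp
    finally show ?thesis .
  next
    case False
    \<comment> \<open>Outside these levels both sides vanish, because \<open>D\<close> and
      \<open>D'\<close> lower the level by one and \<open>\<Phi>\<close> preserves it.\<close>
    have "D m k * \<Phi> k b = 0" for k
      unfolding \<Phi>_def
    proof (rule mult_if_eq_0)
      show "lev k \<noteq> lev' b" if "D m k \<noteq> 0" using G.D_lev[OF that] False by simp
    qed
    moreover have "D' k b * \<Phi> m k = 0" for k
      unfolding \<Phi>_def
    proof (rule mult_if_eq_0)
      show "lev m \<noteq> lev' k" if "D' k b \<noteq> 0" using F.D_lev[OF that] False by simp
    qed
    then have "\<Phi> m k * D' k b = 0" for k by (metis mult.commute)
    ultimately show ?thesis by (simp only: rowapp_def matapp_def sum.neutral_const)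
  qed
  ultimately have "chain_map V B e D B' e' D' \<Phi>"
    using \<Phi>_fmod by (auto simp: chain_map_def)
  moreover have "m \<in> B \<and> lev m = lev' b" if "\<Phi> m b \<noteq> 0" for m b
    using that fmodD(2)[OF \<Phi>_fmod, of m b] unfolding \<Phi>_def by presburger
  moreover have "hom_deg (\<Phi> m b) (deg' b - deg m)" for m b
    by (auto simp: \<Phi>_def hom_deg_hcomp)
  ultimately show ?thesis using that by blast
qed

section \<open>Minimal resolutions\<close>

text \<open>The identity of a minimal resolution \<open>A\<close> is homotopic to a composite \<open>A \<rightarrow> B \<rightarrow> A\<close>. A basis
  element whose degree does not occur in \<open>B\<close> at the same level is sent by the composite
  into the maximal ideal, and so is everything that comes from the homotopy.\<close>

lemma minimal_degree_bound:
  assumes "gres V I A levA degA eA DA" "gres V I B levB degB eB DB"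
    and minimal: "\<And>m l. coeff (DA m l) 0 = 0"
    and bound: "\<And>b. b \<in> B \<Longrightarrow> degB b \<le> t + int (levB b)"
    and a: "a \<in> A"
  shows "degA a \<le> t + int (levA a)"
proof (rule ccontr)
  assume large: "\<not> ?thesis"
  interpret A: gres V I A levA degA eA DA by fact
  interpret B: gres V I B levB degB eB DB by fact
  obtain \<phi> where \<phi>: "chain_map V B eB DB A eA DA \<phi>"
    "\<And>m b. \<phi> m b \<noteq> 0 \<Longrightarrow> m \<in> B \<and> levB m = levA b" "\<And>m b. hom_deg (\<phi> m b) (degA b - degB m)"
    using graded_chain_map_exists[OF assms(2,1)] by blast
  obtain \<psi> where \<psi>: "chain_map V A eA DA B eB DB \<psi>"
    using chain_map_exists[OF assms(1,2)] by blast
  \<comment> \<open>The difference of the identity and the composite through \<open>B\<close>. It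
    lifts the zero map, which is why it is null-homotopic.\<close>
  define T where "T m b = (if b \<in> A then uvec b m else 0) - matapp B \<psi> (\<lambda>k. \<phi> k b) m" for m b
  have \<phi>_fmod: "(\<lambda>m. \<phi> m b) \<in> fmod V B" for b
    using \<phi>(1) by (simp add: chain_map_def)
  have T_col: "(\<lambda>m. T m b) = (\<lambda>m. uvec b m - matapp B \<psi> (\<lambda>k. \<phi> k b) m)" if "b \<in> A" for b
    using that by (simp add: T_def)
  have T_app: "matapp A T v m = v m - matapp B \<psi> (matapp A \<phi> v) m" if "v \<in> fmod V A" for v m
  proof -
    have "matapp A T v m = (\<Sum>b\<in>A. uvec b m * v b) - matapp B \<psi> (matapp A \<phi> v) m"
      unfolding matapp_matapp unfolding T_def matapp_def rowapp_def
      by (simp add: left_diff_distrib sum_subtractf cong: sum.cong)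
    moreover have "(\<Sum>b\<in>A. uvec b m * v b) = v m"
      using A.fin fmodD(2)[OF that, of m] by (auto simp: uvec_def if_distrib[of "\<lambda>x. x * _"] cong: if_cong)
    ultimately show ?thesis by simp
  qed
  have \<phi>_D: "matapp B DB (\<lambda>k. \<phi> k b) = matapp A \<phi> (\<lambda>k. DA k b)" if "b \<in> A" for b
    using \<phi>(1) that by (simp add: chain_map_def)
  obtain h where h: "\<And>b. b \<in> A \<Longrightarrow>
      matapp A DA (\<lambda>m. h m b) = (\<lambda>m. T m b + (- 1) * matapp A h (\<lambda>k. DA k b) m)"
  proof (rule A.lift[of A DA levA T "\<lambda>_. 0" "- 1"])
    show "(\<lambda>m. T m b) \<in> fmod V A" for b
      unfolding T_def using fmod_uvec[of b A V] chain_map_fmod[OF \<psi> \<phi>_fmod]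
      by (intro fmod_diff) (auto simp: fmod_def)
    show "in_vars V (- 1)" by (intro in_vars_uminus) simp
    show "matapp A DA (\<lambda>m. T m b) = (\<lambda>m. - (- 1) * matapp A T (\<lambda>k. DA k b) m)" if "b \<in> A" for b
      by (simp add: T_col[OF that] T_app[OF A.col_fmod] matapp_diff matapp_uvec A.fin that
          chain_map_D[OF \<psi>] \<phi>_D)
    show "rowapp A eA (\<lambda>m. T m b) + - 1 * rowapp A (\<lambda>_. 0) (\<lambda>k. DA k b) = 0" if "b \<in> A" for b
      using \<phi>(1) that
      by (simp add: T_col[OF that] rowapp_diff rowapp_uvec A.fin chain_map_aug[OF \<psi>] chain_map_def)
        (simp add: rowapp_def)
    show "0 \<in> I" using A.aug_in[OF fmod_0] by simp
  qed (use A.fin A.D_in A.D_lev A.D_col in auto)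
  \<comment> \<open>A unit entry would give \<open>k\<close> the degree of \<open>a\<close> at the
    same level, against the bound on \<open>B\<close>.\<close>
  have "coeff (\<phi> k a) 0 = 0" for k
  proof (rule ccontr)
    assume nz: "coeff (\<phi> k a) 0 \<noteq> 0"
    then have "degA a = degB k" using hom_deg_unit[OF \<phi>(3)] by fastforce
    moreover have "k \<in> B" "levB k = levA a"
      using nz \<phi>(2)[of k a] by fastforce+
    ultimately show False using bound[of k] large by simp
  qed
  then have "coeff (T a a) 0 = 1"
    using a by (simp add: T_def uvec_def matapp_def rowapp_def lookup_minus coeff_sum_0)
  moreover have "coeff (matapp A DA (\<lambda>m. h m a) a) 0 = 0"
    by (simp add: matapp_def rowapp_def coeff_sum_0 minimal)
  moreover have "coeff (matapp A h (\<lambda>k. DA k a) a) 0 = 0"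
    by (simp add: matapp_def rowapp_def coeff_sum_0 minimal)
  ultimately show False
    using h[OF a] by (simp add: lookup_minus fun_eq_iff)
qed

text \<open>Gaussian elimination: a unit entry of \<open>D\<close> splits off a trivial complex.\<close>

lemma (in gres) cancel:
  assumes unit: "coeff (D m0 l0) 0 \<noteq> 0"
  defines "B' \<equiv> B - {m0, l0}"
  defines "u \<equiv> term_of 0 (inverse (coeff (D m0 l0) 0))"
  defines "e' \<equiv> \<lambda>l. if l \<in> {m0, l0} then 0 else e l"
  defines "D' \<equiv> \<lambda>m l. if m \<in> {m0, l0} \<or> l \<in> {m0, l0} then 0 else D m l - u * (D m l0 * D m0 l)"
  shows "gres V I B' lev deg e' D'"
proof -
  have "D m0 l0 \<noteq> 0" using unit by auto
  then have B: "m0 \<in> B" "l0 \<in> B" and lev0: "lev l0 = Suc (lev m0)" using D_lev[of m0 l0] by auto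
  then have ne: "l0 \<noteq> m0" by auto
  have deg0: "deg l0 = deg m0" using hom_deg_unit[OF D_hom unit] by simp
  have u1: "u * D m0 l0 = 1"
  proof -
    have "D m0 l0 = term_of 0 (coeff (D m0 l0) 0)"
      using D_hom[of m0 l0] deg0 by (intro hom_deg_0_const) simp
    then show ?thesis using unit unfolding u_def by (metis add_0 left_inverse mult_single single_one)
  qed
  have u_V: "in_vars V u" and u_hom: "hom_deg u 0"
    by (auto simp: u_def in_vars_def hom_deg_def)
  have cancel_unit: "y = - u * x" if "x + y * D m0 l0 = 0" for x y
  proof -
    have "u * x + y * (u * D m0 l0) = 0" using arg_cong[OF that, of "\<lambda>z. u * z"] by (simp add: algebra_simps)
    then show ?thesis using u1 by (simp add: add_eq_0_iff)
  qed
  have el0: "e l0 = 0" using e_lev[of l0] lev0 by auto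
  have sub: "v \<in> fmod V B" if "v \<in> fmod V B'" for v
    using that by (auto simp: fmod_def B'_def)
  have z: "v m0 = 0" "v l0 = 0" if "v \<in> fmod V B'" for v
    using that by (auto simp: fmod_def B'_def)
  have row: "rowapp B' e' v = rowapp B e v" if "v \<in> fmod V B'" for v
    unfolding rowapp_def using fin z[OF that]
    by (intro sum.mono_neutral_cong_left) (auto simp: B'_def e'_def)
  have mat: "matapp B' D' v m = (if m \<in> {m0, l0} then 0 else matapp B D v m - u * matapp B D v m0 * D m l0)"
    if "v \<in> fmod V B'" for v m
  proof (cases "m \<in> {m0, l0}")
    case False
    have "matapp B' D' v m = (\<Sum>l\<in>B. (D m l - u * (D m l0 * D m0 l)) * v l)"
      unfolding rowapp_def matapp_def using fin z[OF that] False
      by (intro sum.mono_neutral_cong_left) (auto simp: B'_def D'_def)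
    also have "\<dots> = matapp B D v m - u * matapp B D v m0 * D m l0"
      by (simp add: rowapp_def matapp_def algebra_simps sum_subtractf sum_distrib_left)
    finally show ?thesis using False by simp
  qed (auto simp: D'_def matapp_def rowapp_def)
  \<comment> \<open>Embeds the smaller complex into the old one. The coefficient at
    \<open>l0\<close> is chosen such that the \<open>m0\<close>-component of \<open>D\<close>
    applied to \<open>\<iota> v\<close> vanishes.\<close>
  define \<iota> where "\<iota> v = (\<lambda>b. v b + (- u * matapp B D v m0) * uvec l0 b)" for v
  have \<iota>_fmod: "\<iota> v \<in> fmod V B" if "v \<in> fmod V B'" for v
    unfolding \<iota>_def using that B u_V D_fmod[OF sub[OF that]]
    by (intro fmod_add sub fmod_scale fmod_uvec in_vars_mult in_vars_uminus) (auto simp: fmod_def)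
  have row_\<iota>: "rowapp B e (\<iota> v) = rowapp B e v" for v
    by (simp add: \<iota>_def rowapp_diff rowapp_scale rowapp_uvec fin B el0)
  have D\<iota>: "matapp B D (\<iota> v) = (\<lambda>m. matapp B D v m + (- u * matapp B D v m0) * D m l0)" for v
    unfolding \<iota>_def by (simp only: matapp_add matapp_scale matapp_uvec[OF fin B(2)])
  have D\<iota>_m0: "matapp B D (\<iota> v) m0 = 0" for v
    using u1 by (simp add: D\<iota> mult_ac)
  have D\<iota>': "matapp B D (\<iota> v) m = matapp B' D' v m" if "v \<in> fmod V B'" "m \<noteq> l0" for v m
    using that D\<iota>_m0[of v] by (cases "m = m0") (simp_all add: mat D\<iota>)
  have D'_fmod: "matapp B' D' v \<in> fmod V B'" if "v \<in> fmod V B'" for v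
  proof (rule fmodI)
    fix b
    have "in_vars V (matapp B D (\<iota> v) b)" using D_fmod[OF \<iota>_fmod[OF that]] by (rule fmodD)
    then show "in_vars V (matapp B' D' v b)"
      using D\<iota>'[OF that, of b] by (cases "b = l0") (auto simp: mat[OF that])
    assume "b \<notin> B'"
    then show "matapp B' D' v b = 0"
      using fmodD(2)[OF D_fmod[OF \<iota>_fmod[OF that]], of b] D\<iota>'[OF that, of b] mat[OF that, of b]
      by (auto simp: B'_def)
  qed
  \<comment> \<open>Away from \<open>l0\<close> the two sides agree by construction. At
    \<open>l0\<close> the value is forced: applying \<open>D\<close> once more gives zero, and the
    entry \<open>D m0 l0\<close> is invertible.\<close>
  have D_\<iota>: "matapp B D (\<iota> v) = \<iota> (matapp B' D' v)" if v: "v \<in> fmod V B'" for v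
  proof -
    let ?y = "matapp B D (\<iota> v) l0"
    have 1: "matapp B D (\<iota> v) = (\<lambda>m. matapp B' D' v m + ?y * uvec l0 m)"
      using D\<iota>'[OF v] by (auto simp: fun_eq_iff uvec_def mat[OF v])
    have "matapp B D (matapp B D (\<iota> v)) m0 = matapp B D (matapp B' D' v) m0 + ?y * D m0 l0"
      by (subst 1) (simp add: matapp_add matapp_scale matapp_uvec fin B)
    then have "matapp B D (matapp B' D' v) m0 + ?y * D m0 l0 = 0"
      using D_D[OF \<iota>_fmod[OF v]] by simp
    then have "?y = - u * matapp B D (matapp B' D' v) m0" by (rule cancel_unit)
    then show ?thesis using 1 by (simp add: \<iota>_def)
  qed
  \<comment> \<open>A multiple of the boundary \<open>\<lambda>b. D b l0\<close> removes the
    coefficient of \<open>q\<close> at \<open>m0\<close>. If moreover the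
    \<open>m0\<close>-component of \<open>matapp B D q\<close> vanishes, the coefficient at
    \<open>l0\<close> must be the one prescribed by \<open>\<iota>\<close>.\<close>
  have pull: "\<exists>q'\<in>fmod V B'. rowapp B e q' = rowapp B e q \<and> (matapp B D q m0 = 0 \<longrightarrow> matapp B D q = matapp B D (\<iota> q'))"
    if q: "q \<in> fmod V B" for q
  proof -
    define r where "r = (\<lambda>b. q b - (u * q m0) * D b l0)"
    have r_fmod: "r \<in> fmod V B"
      unfolding r_def using q u_V by (intro fmod_diff fmod_scale col_fmod in_vars_mult) (auto simp: fmod_def)
    have "r m0 = q m0 - q m0 * (u * D m0 l0)" by (simp add: r_def algebra_simps)
    then have r0: "r m0 = 0" by (simp add: u1)
    have Dr: "matapp B D r = matapp B D q"
      unfolding r_def by (simp only: matapp_diff matapp_scale D_col mult_zero_right diff_0_right)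
    have er: "rowapp B e r = rowapp B e q"
      unfolding r_def by (simp only: rowapp_diff rowapp_scale aug_col mult_zero_right diff_0_right)
    define q' where "q' = (\<lambda>b. if b \<in> B' then r b else 0)"
    have q'_fmod: "q' \<in> fmod V B'" using r_fmod by (auto simp: q'_def fmod_def)
    have r_eq: "r = (\<lambda>b. q' b + r l0 * uvec l0 b)"
      using r0 fmodD(2)[OF r_fmod] by (auto simp: q'_def fun_eq_iff uvec_def B'_def)
    have "rowapp B e r = rowapp B e q'"
      by (subst r_eq) (simp add: rowapp_add rowapp_scale rowapp_uvec fin B el0)
    moreover have "matapp B D q = matapp B D (\<iota> q')" if "matapp B D q m0 = 0"
    proof -
      have "matapp B D r m0 = matapp B D q' m0 + r l0 * D m0 l0"
        by (subst r_eq) (simp add: matapp_add matapp_scale matapp_uvec fin B)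
      then have "r l0 = - u * matapp B D q' m0" using that Dr by (intro cancel_unit) simp
      then have "r = \<iota> q'" using r_eq by (simp add: \<iota>_def)
      then show ?thesis using Dr by simp
    qed
    ultimately show ?thesis using q'_fmod er by auto
  qed
  show ?thesis
  proof
    show "finite B'" using fin by (simp add: B'_def)
    show "in_vars V (e' l)" for l using e_in by (simp add: e'_def)
    show "hom_deg (e' l) (deg l)" for l using e_hom by (simp add: e'_def)
    show "l \<in> B' \<and> lev l = 0" if "e' l \<noteq> 0" for l
      using that e_lev[of l] by (auto simp: e'_def B'_def split: if_splits)
    show "in_vars V (D' m l)" for m l
      using D_in u_V by (simp add: D'_def in_vars_diff in_vars_mult)
    show "hom_deg (D' m l) (deg l - deg m)" for m l
      using hom_deg_diff[OF D_hom[of m l], of "u * (D m l0 * D m0 l)"]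
        hom_deg_mult[OF u_hom hom_deg_mult[OF D_hom[of m l0] D_hom[of m0 l]]] deg0
      by (simp add: D'_def)
    show "m \<in> B' \<and> l \<in> B' \<and> lev l = Suc (lev m)" if "D' m l \<noteq> 0" for m l
    proof -
      have nm: "m \<notin> {m0, l0}" "l \<notin> {m0, l0}" using that by (auto simp: D'_def)
      then have "D m l \<noteq> 0 \<or> D m l0 \<noteq> 0 \<and> D m0 l \<noteq> 0" using that by (auto simp: D'_def)
      then have "m \<in> B \<and> l \<in> B \<and> lev l = Suc (lev m)"
        using D_lev[of m l] D_lev[of m l0] D_lev[of m0 l] lev0 by auto
      then show ?thesis using nm by (simp add: B'_def)
    qed
    show "rowapp B' e' ` fmod V B' = I"
      unfolding img[symmetric]
    proof (intro equalityI image_subsetI)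
      show "rowapp B' e' v \<in> rowapp B e ` fmod V B" if "v \<in> fmod V B'" for v
        using row[OF that] sub[OF that] by auto
      show "rowapp B e q \<in> rowapp B' e' ` fmod V B'" if "q \<in> fmod V B" for q
        using pull[OF that] row by (metis imageI)
    qed
    show "(rowapp B' e' p = 0 \<and> matapp B' D' p = (\<lambda>_. 0)) = (\<exists>q\<in>fmod V B'. p = matapp B' D' q)"
      if p: "p \<in> fmod V B'" for p
    proof
      assume "rowapp B' e' p = 0 \<and> matapp B' D' p = (\<lambda>_. 0)"
      then have "rowapp B e (\<iota> p) = 0" "matapp B D (\<iota> p) = (\<lambda>_. 0)"
        unfolding row_\<iota> D_\<iota>[OF p] using row[OF p] by (auto simp: \<iota>_def)
      then obtain q where q: "q \<in> fmod V B" "\<iota> p = matapp B D q" using exactE[OF \<iota>_fmod[OF p]] by metis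
      moreover have "\<iota> p m0 = 0" using z[OF p] ne by (simp add: \<iota>_def uvec_def)
      ultimately obtain q' where q': "q' \<in> fmod V B'" "\<iota> p = matapp B D (\<iota> q')" using pull by metis
      have "p m = matapp B' D' q' m" for m
      proof (cases "m = l0")
        case True
        then show ?thesis using z[OF p] by (simp add: mat[OF q'(1)])
      next
        case False
        then have "p m = \<iota> p m" by (simp add: \<iota>_def uvec_def)
        then show ?thesis using False q' D\<iota>' by metis
      qed
      then show "\<exists>q\<in>fmod V B'. p = matapp B' D' q" using q' by blast
    next
      assume "\<exists>q\<in>fmod V B'. p = matapp B' D' q"
      then obtain q where q: "q \<in> fmod V B'" "p = matapp B' D' q" by blast
      then have \<iota>p: "\<iota> p = matapp B D (\<iota> q)" using D_\<iota> by simp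
      have "rowapp B' e' p = 0" using row[OF p] row_\<iota>[of p] aug_D[OF \<iota>_fmod[OF q(1)]] \<iota>p by simp
      moreover have "matapp B' D' p m = 0" for m
      proof (cases "m = l0")
        case True
        then show ?thesis by (simp add: mat[OF p])
      next
        case False
        then show ?thesis using D\<iota>'[OF p, of m] D_D[OF \<iota>_fmod[OF q(1)]] \<iota>p by simp
      qed
      ultimately show "rowapp B' e' p = 0 \<and> matapp B' D' p = (\<lambda>_. 0)" by auto
    qed
  qed
qed

text \<open>Each cancellation removes two basis elements, so the process stops; degrees and levels
  of the remaining ones are untouched.\<close>

lemma minimal_gres_exists:
  assumes "gres V I B lev deg e D"
  shows "\<exists>B' e' D'. B' \<subseteq> B \<and> gres V I B' lev deg e' D' \<and> (\<forall>m l. coeff (D' m l) 0 = 0)"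
  using assms
proof (induction "card B" arbitrary: B e D rule: less_induct)
  case less
  interpret gres V I B lev deg e D by (rule less.prems)
  show ?case
  proof (cases "\<forall>m l. coeff (D m l) 0 = 0")
    case False
    then obtain m0 l0 where unit: "coeff (D m0 l0) 0 \<noteq> 0" by blast
    then have "D m0 l0 \<noteq> 0" by auto
    then have "m0 \<in> B" using D_lev by metis
    then have "card (B - {m0, l0}) < card B" using fin by (intro psubset_card_mono) auto
    from less.hyps[OF this cancel[OF unit]] show ?thesis by blast
  qed (use less.prems in blast)
qed

section \<open>Construction of resolutions\<close>

text \<open>A witness, not necessarily minimal, for regularity at most \<open>t\<close>. The basis
  consists of natural numbers because a definition cannot quantify over the type of the basis;
  \<open>has_resI\<close> moves any finite basis there.\<close>

definition has_res :: "nat set \<Rightarrow> 'k::field mpoly set \<Rightarrow> int \<Rightarrow> bool" where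
  "has_res V I t \<longleftrightarrow> (\<exists>(B :: nat set) lev deg e D. gres V I B lev deg e D \<and> (\<forall>b\<in>B. deg b \<le> t + int (lev b)))"

lemma has_resI:
  fixes B :: "'b set" and I :: "'k::field mpoly set"
  assumes "gres V I B lev deg e D" and bound: "\<And>b. b \<in> B \<Longrightarrow> deg b \<le> t + int (lev b)"
  shows "has_res V I t"
proof -
  interpret gres V I B lev deg e D by fact
  obtain g where g: "bij_betw g {..<card B} B"
    using ex_bij_betw_nat_finite[OF fin] by (auto simp: atLeast0LessThan)
  let ?N = "{..<card B}"
  define f where "f = inv_into ?N g"
  have f: "f b \<in> ?N" "g (f b) = b" if "b \<in> B" for b
    using g that unfolding f_def by (auto simp: bij_betw_def inv_into_into f_inv_into_f simp del: lessThan_iff)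
  have fg: "f (g i) = i" "g i \<in> B" if "i \<in> ?N" for i
    using g that unfolding f_def by (auto simp: bij_betw_def)
  have gi: "g i = g j \<longleftrightarrow> i = j" if "i \<in> ?N" "j \<in> ?N" for i j
    using that fg by metis
  define e' where "e' i = (if i \<in> ?N then e (g i) else 0)" for i
  define D' where "D' i j = (if i \<in> ?N \<and> j \<in> ?N then D (g i) (g j) else 0)" for i j
  define up where "up v b = (if b \<in> B then v (f b) else 0 :: 'k mpoly)" for v b
  define down where "down v i = (if i \<in> ?N then v (g i) else 0 :: 'k mpoly)" for v i
  have up_fmod: "up v \<in> fmod V B" if "v \<in> fmod V ?N" for v
    using that by (auto simp: up_def fmod_def)
  have down_fmod: "down v \<in> fmod V ?N" if "v \<in> fmod V B" for v
    using that by (auto simp: down_def fmod_def)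
  have down_up: "down (up v) = v" if "v \<in> fmod V ?N" for v
    using that fg by (auto simp: up_def down_def fmod_def fun_eq_iff)
  have up_down: "up (down v) = v" if "v \<in> fmod V B" for v
    using that f by (auto simp: up_def down_def fmod_def fun_eq_iff)
  have row: "rowapp ?N e' v = rowapp B e (up v)" if "v \<in> fmod V ?N" for v
  proof -
    have "rowapp B e (up v) = (\<Sum>i\<in>?N. e (g i) * up v (g i))"
      unfolding rowapp_def by (rule sum.reindex_bij_betw[OF g, symmetric])
    then show ?thesis by (simp add: rowapp_def e'_def up_def fg)
  qed
  have mat: "matapp ?N D' v = down (matapp B D (up v))" if "v \<in> fmod V ?N" for v
  proof
    fix i
    have "matapp B D (up v) (g i) = (\<Sum>j\<in>?N. D (g i) (g j) * up v (g j))"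
      unfolding rowapp_def matapp_def by (rule sum.reindex_bij_betw[OF g, symmetric])
    then show "matapp ?N D' v i = down (matapp B D (up v)) i"
      by (simp add: rowapp_def matapp_def D'_def down_def up_def fg)
  qed
  have "gres V I ?N (lev \<circ> g) (deg \<circ> g) e' D'"
  proof
    show "finite ?N" by simp
    show "in_vars V (e' l)" "hom_deg (e' l) ((deg \<circ> g) l)" for l
      using e_in e_hom by (auto simp: e'_def)
    show "in_vars V (D' m l)" "hom_deg (D' m l) ((deg \<circ> g) l - (deg \<circ> g) m)" for m l
      using D_in D_hom by (auto simp: D'_def)
    show "l \<in> ?N \<and> (lev \<circ> g) l = 0" if "e' l \<noteq> 0" for l
      using that e_lev[of "g l"] by (auto simp: e'_def split: if_splits)
    show "m \<in> ?N \<and> l \<in> ?N \<and> (lev \<circ> g) l = Suc ((lev \<circ> g) m)" if "D' m l \<noteq> 0" for m l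
      using that D_lev[of "g m" "g l"] by (auto simp: D'_def split: if_splits)
    have "rowapp ?N e' ` fmod V ?N = rowapp B e ` fmod V B"
    proof (intro equalityI image_subsetI)
      show "rowapp ?N e' v \<in> rowapp B e ` fmod V B" if "v \<in> fmod V ?N" for v
        using row[OF that] up_fmod[OF that] by simp
      show "rowapp B e v \<in> rowapp ?N e' ` fmod V ?N" if "v \<in> fmod V B" for v
        using row[OF down_fmod[OF that]] down_fmod[OF that] up_down[OF that] by (metis imageI)
    qed
    then show "rowapp ?N e' ` fmod V ?N = I" using img by simp
    show "(rowapp ?N e' v = 0 \<and> matapp ?N D' v = (\<lambda>_. 0)) = (\<exists>w\<in>fmod V ?N. v = matapp ?N D' w)"
      if v: "v \<in> fmod V ?N" for v
    proof -
      have "matapp ?N D' v = (\<lambda>_. 0) \<longleftrightarrow> matapp B D (up v) = (\<lambda>_. 0)"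
      proof
        assume "matapp ?N D' v = (\<lambda>_. 0)"
        then have "up (down (matapp B D (up v))) = (\<lambda>_. 0)" using mat[OF v] by (simp add: up_def fun_eq_iff)
        then show "matapp B D (up v) = (\<lambda>_. 0)" using up_down[OF D_fmod[OF up_fmod[OF v]]] by simp
      qed (auto simp: mat[OF v] down_def fun_eq_iff)
      moreover have "(\<exists>w\<in>fmod V ?N. v = matapp ?N D' w) \<longleftrightarrow> (\<exists>w\<in>fmod V B. up v = matapp B D w)"
      proof
        assume "\<exists>w\<in>fmod V ?N. v = matapp ?N D' w"
        then obtain w where w: "w \<in> fmod V ?N" "v = matapp ?N D' w" by blast
        then have "up v = matapp B D (up w)"
          using mat[OF w(1)] up_down[OF D_fmod[OF up_fmod[OF w(1)]]] by simp
        then show "\<exists>w\<in>fmod V B. up v = matapp B D w" using up_fmod[OF w(1)] by blast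
      next
        assume "\<exists>w\<in>fmod V B. up v = matapp B D w"
        then obtain w where w: "w \<in> fmod V B" "up v = matapp B D w" by blast
        then have "v = matapp ?N D' (down w)"
          using mat[OF down_fmod[OF w(1)]] up_down[OF w(1)] down_up[OF v] by simp
        then show "\<exists>w\<in>fmod V ?N. v = matapp ?N D' w" using down_fmod[OF w(1)] by blast
      qed
      ultimately show ?thesis
        using row[OF v] exact[OF up_fmod[OF v]] by simp
    qed
  qed
  moreover have "(deg \<circ> g) i \<le> t + int ((lev \<circ> g) i)" if "i \<in> ?N" for i
    using bound[OF fg(2)[OF that]] by simp
  ultimately show ?thesis unfolding has_res_def by blast
qed

lemma has_res_mono: "has_res V I t \<Longrightarrow> t \<le> t' \<Longrightarrow> has_res V I t'"
  unfolding has_res_def by (meson add_mono_thms_linordered_semiring(3) order_trans)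

lemma has_res_zero: "has_res V {0} t"
proof (rule has_resI)
  show "gres V {0} ({} :: nat set) (\<lambda>_. 0) (\<lambda>_. 0) (\<lambda>_. 0) (\<lambda>_ _. 0)"
  proof
    show "rowapp {} (\<lambda>_. 0) ` fmod V {} = {0}"
      by (auto simp: rowapp_def intro!: image_eqI[of _ _ "\<lambda>_. 0"])
  qed (auto simp: rowapp_def matapp_def fmod_def)
qed simp

lemma has_res_unit: "has_res V {p :: 'k::field mpoly. in_vars V p} 0"
proof (rule has_resI)
  let ?e = "\<lambda>i :: nat. if i = 0 then 1 else 0 :: 'k mpoly"
  show "gres V {p :: 'k mpoly. in_vars V p} {0 :: nat} (\<lambda>_. 0) (\<lambda>_. 0) ?e (\<lambda>_ _. 0)"
  proof
    show "rowapp {0} ?e ` fmod V {0} = {p :: 'k mpoly. in_vars V p}"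
    proof (intro equalityI subsetI)
      fix p :: "'k mpoly" assume "p \<in> {p. in_vars V p}"
      then show "p \<in> rowapp {0} ?e ` fmod V {0}"
        by (intro image_eqI[of _ _ "\<lambda>i. if i = 0 then p else 0"]) (auto simp: rowapp_def fmod_def)
    qed (auto simp: rowapp_def fmod_def)
    show "(rowapp {0} ?e v = 0 \<and> matapp {0} (\<lambda>_ _. 0) v = (\<lambda>_. 0)) =
         (\<exists>w\<in>fmod V {0}. v = matapp {0} (\<lambda>_ _. 0) w)" if "v \<in> fmod V {0}" for v
    proof -
      have "v = (\<lambda>_. 0)" if "v 0 = 0"
        using that \<open>v \<in> fmod V {0}\<close> by (auto simp: fmod_def fun_eq_iff) (metis neq0_conv)
      then show ?thesis by (auto simp: rowapp_def matapp_def intro: bexI[of _ "\<lambda>_. 0"] fmod_0)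
    qed
  qed (auto split: if_splits)
qed simp

lemma coeff_var_mult: "coeff (var x * p) (Poly_Mapping.single x 1 + m) = coeff p m"
  unfolding var_def coeff_times_term by simp

lemma var_mult_eq_0: "var x * p = 0 \<Longrightarrow> p = 0"
proof (rule poly_mapping_eqI)
  fix m assume "var x * p = 0"
  then have "coeff (var x * p) (Poly_Mapping.single x 1 + m) = 0" by (simp only: lookup_zero)
  then show "coeff p m = coeff 0 m" unfolding coeff_var_mult by simp
qed

lemma in_vars_var: "x \<in> V \<Longrightarrow> in_vars V (var x)"
  by (simp add: var_def in_vars_def)

lemma hom_deg_var: "hom_deg (var x) 1"
  by (simp add: var_def hom_deg_def mdeg_def)

text \<open>A variable is not a zero divisor, so multiplying the augmentation by it changes no
  kernel; all degrees go up by one and \<open>D\<close> stays.\<close>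

lemma has_res_var_mult:
  assumes "has_res V I t" "x \<in> V"
  shows "has_res V ((*) (var x) ` I) (t + 1)"
proof -
  obtain B :: "nat set" and lev deg e D
    where g: "gres V I B lev deg e D" and bound: "\<And>b. b \<in> B \<Longrightarrow> deg b \<le> t + int (lev b)"
    using assms by (auto simp: has_res_def)
  interpret gres V I B lev deg e D by (rule g)
  have row: "rowapp B (\<lambda>l. var x * e l) v = var x * rowapp B e v" for v
    by (simp add: rowapp_def sum_distrib_left mult.assoc)
  have "gres V ((*) (var x) ` I) B lev (\<lambda>b. deg b + 1) (\<lambda>l. var x * e l) D"
  proof
    show "in_vars V (var x * e l)" for l
      using assms(2) e_in by (intro in_vars_mult in_vars_var)
    show "hom_deg (var x * e l) (deg l + 1)" for l
      using hom_deg_mult[OF hom_deg_var e_hom] by (simp add: add.commute)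
    show "rowapp B (\<lambda>l. var x * e l) ` fmod V B = (*) (var x) ` I"
      by (auto simp: row img[symmetric])
    show "(rowapp B (\<lambda>l. var x * e l) v = 0 \<and> matapp B D v = (\<lambda>_. 0)) = (\<exists>w\<in>fmod V B. v = matapp B D w)"
      if "v \<in> fmod V B" for v
      using exact[OF that] var_mult_eq_0[of x "rowapp B e v"] by (auto simp: row)
    show "l \<in> B \<and> lev l = 0" if "var x * e l \<noteq> 0" for l
      using that by (intro e_lev) auto
  qed (use fin D_in D_hom D_lev in auto)
  then show ?thesis
  proof (rule has_resI)
    show "deg b + 1 \<le> t + 1 + int (lev b)" if "b \<in> B" for b using bound[OF that] by simp
  qed
qed

text \<open>The mapping cone of \<open>C\<^sub>3 \<rightarrow> C\<^sub>1 \<oplus> C\<^sub>2\<close>, where \<open>C\<^sub>3\<close> resolves the intersection.\<close>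

lemma has_res_sum:
  fixes I1 I2 :: "'k::field mpoly set"
  assumes "has_res V I1 t" "has_res V I2 t" "has_res V (I1 \<inter> I2) (t + 1)"
  shows "has_res V {p + q | p q. p \<in> I1 \<and> q \<in> I2} t"
proof -
  obtain B1 :: "nat set" and lev1 deg1 e1 D1
    where g1: "gres V I1 B1 lev1 deg1 e1 D1" and b1: "\<And>b. b \<in> B1 \<Longrightarrow> deg1 b \<le> t + int (lev1 b)"
    using assms(1) by (auto simp: has_res_def)
  obtain B2 :: "nat set" and lev2 deg2 e2 D2
    where g2: "gres V I2 B2 lev2 deg2 e2 D2" and b2: "\<And>b. b \<in> B2 \<Longrightarrow> deg2 b \<le> t + int (lev2 b)"
    using assms(2) by (auto simp: has_res_def)
  obtain B3 :: "nat set" and lev3 deg3 e3 D3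
    where g3: "gres V (I1 \<inter> I2) B3 lev3 deg3 e3 D3"
      and b3: "\<And>b. b \<in> B3 \<Longrightarrow> deg3 b \<le> t + 1 + int (lev3 b)"
    using assms(3) by (auto simp: has_res_def)
  interpret C1: gres V I1 B1 lev1 deg1 e1 D1 by (rule g1)
  interpret C2: gres V I2 B2 lev2 deg2 e2 D2 by (rule g2)
  interpret C3: gres V "I1 \<inter> I2" B3 lev3 deg3 e3 D3 by (rule g3)
  obtain \<phi> where \<phi>: "chain_map V B1 e1 D1 B3 e3 D3 \<phi>"
    and \<phi>_lev: "\<And>m b. \<phi> m b \<noteq> 0 \<Longrightarrow> m \<in> B1 \<and> lev1 m = lev3 b"
    and \<phi>_hom: "\<And>m b. hom_deg (\<phi> m b) (deg3 b - deg1 m)"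
    using graded_chain_map_exists[OF g1 g3] by blast
  obtain \<psi> where \<psi>: "chain_map V B2 e2 D2 B3 e3 D3 \<psi>"
    and \<psi>_lev: "\<And>m b. \<psi> m b \<noteq> 0 \<Longrightarrow> m \<in> B2 \<and> lev2 m = lev3 b"
    and \<psi>_hom: "\<And>m b. hom_deg (\<psi> m b) (deg3 b - deg2 m)"
    using graded_chain_map_exists[OF g2 g3] by blast
  let ?B = "B1 <+> B2 <+> B3"
  \<comment> \<open>The third resolution moves up one level but keeps its degrees, which turns its
    bound \<open>t + 1\<close> into \<open>t\<close>.\<close>
  let ?lev = "case_sum lev1 (case_sum lev2 (Suc \<circ> lev3))"
  let ?deg = "case_sum deg1 (case_sum deg2 deg3)"
  define e :: "nat + nat + nat \<Rightarrow> 'k mpoly" where "e = case_sum e1 (case_sum e2 (\<lambda>_. 0))"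
  \<comment> \<open>The sign of \<open>\<psi>\<close> makes \<open>e\<close> vanish on boundaries
    coming from the third summand, the sign of \<open>D3\<close> makes \<open>D\<close> square to
    zero.\<close>
  define D :: "nat + nat + nat \<Rightarrow> nat + nat + nat \<Rightarrow> 'k mpoly" where "D m l = (case l of
      Inl a \<Rightarrow> (case m of Inl a' \<Rightarrow> D1 a' a | Inr _ \<Rightarrow> 0)
    | Inr (Inl b) \<Rightarrow> (case m of Inr (Inl b') \<Rightarrow> D2 b' b | _ \<Rightarrow> 0)
    | Inr (Inr c) \<Rightarrow> if c \<in> B3 then (case m of Inl a' \<Rightarrow> \<phi> a' c | Inr (Inl b') \<Rightarrow> - \<psi> b' c | Inr (Inr c') \<Rightarrow> - D3 c' c) else 0)"
    for m l
  have e_simps [simp]: "e (Inl a) = e1 a" "e (Inr (Inl b)) = e2 b" "e (Inr (Inr c)) = 0" for a b c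
    by (simp_all add: e_def)
  have sum_B: "(\<Sum>l\<in>?B. h l) = (\<Sum>a\<in>B1. h (Inl a)) + ((\<Sum>b\<in>B2. h (Inr (Inl b))) + (\<Sum>c\<in>B3. h (Inr (Inr c))))"
    for h :: "_ \<Rightarrow> 'k mpoly"
    using C1.fin C2.fin C3.fin by (simp add: sum.Plus)
  have row: "rowapp ?B e v = rowapp B1 e1 (\<lambda>a. v (Inl a)) + rowapp B2 e2 (\<lambda>b. v (Inr (Inl b)))" for v
    by (simp add: rowapp_def sum_B)
  have mat: "matapp ?B D v (Inl a) = matapp B1 D1 (\<lambda>a. v (Inl a)) a + matapp B3 \<phi> (\<lambda>c. v (Inr (Inr c))) a"
      "matapp ?B D v (Inr (Inl b)) = matapp B2 D2 (\<lambda>b. v (Inr (Inl b))) b - matapp B3 \<psi> (\<lambda>c. v (Inr (Inr c))) b"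
      "matapp ?B D v (Inr (Inr c)) = - matapp B3 D3 (\<lambda>c. v (Inr (Inr c))) c" for v a b c
    by (simp_all add: rowapp_def matapp_def sum_B D_def sum_negf)
  have fmod_iff: "v \<in> fmod V ?B \<longleftrightarrow> (\<lambda>a. v (Inl a)) \<in> fmod V B1 \<and> (\<lambda>b. v (Inr (Inl b))) \<in> fmod V B2
      \<and> (\<lambda>c. v (Inr (Inr c))) \<in> fmod V B3" for v :: "_ \<Rightarrow> 'k mpoly"
    by (fastforce simp: fmod_def split_sum_all)
  have eq_iff: "v = w \<longleftrightarrow> (\<lambda>a. v (Inl a)) = (\<lambda>a. w (Inl a)) \<and> (\<lambda>b. v (Inr (Inl b))) = (\<lambda>b. w (Inr (Inl b)))
      \<and> (\<lambda>c. v (Inr (Inr c))) = (\<lambda>c. w (Inr (Inr c)))" for v w :: "_ + _ + _ \<Rightarrow> 'k mpoly"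
    by (auto simp: fun_eq_iff split_sum_all)
  have "gres V {p + q | p q. p \<in> I1 \<and> q \<in> I2} ?B ?lev ?deg e D"
  proof
    show "finite ?B" using C1.fin C2.fin C3.fin by simp
    show "in_vars V (e l)" for l
      using C1.e_in C2.e_in by (auto simp: e_def split: sum.split)
    show "hom_deg (e l) (?deg l)" for l
      using C1.e_hom C2.e_hom by (auto simp: e_def split: sum.split)
    show "l \<in> ?B \<and> ?lev l = 0" if "e l \<noteq> 0" for l
      using that C1.e_lev C2.e_lev by (auto simp: e_def split: sum.splits)
    show "in_vars V (D m l)" for m l
      using C1.D_in C2.D_in C3.D_in \<phi> \<psi>
      by (auto simp: D_def chain_map_def fmod_def intro: in_vars_uminus split: sum.split)
    show "hom_deg (D m l) (?deg l - ?deg m)" for m l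
      using C1.D_hom C2.D_hom C3.D_hom \<phi>_hom \<psi>_hom
      by (auto simp: D_def intro: hom_deg_uminus split: sum.split)
    show "m \<in> ?B \<and> l \<in> ?B \<and> ?lev l = Suc (?lev m)" if "D m l \<noteq> 0" for m l
      using that C1.D_lev C2.D_lev C3.D_lev \<phi>_lev \<psi>_lev
      by (auto simp: D_def split: sum.splits if_splits)
    show "rowapp ?B e ` fmod V ?B = {p + q | p q. p \<in> I1 \<and> q \<in> I2}"
    proof (intro equalityI subsetI)
      fix x assume "x \<in> rowapp ?B e ` fmod V ?B"
      then show "x \<in> {p + q | p q. p \<in> I1 \<and> q \<in> I2}"
        using C1.aug_in C2.aug_in by (fastforce simp: row fmod_iff)
    next
      fix x assume "x \<in> {p + q | p q. p \<in> I1 \<and> q \<in> I2}"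
      then obtain v w where "v \<in> fmod V B1" "w \<in> fmod V B2" "x = rowapp B1 e1 v + rowapp B2 e2 w"
        using C1.img C2.img by auto
      then show "x \<in> rowapp ?B e ` fmod V ?B"
        by (intro image_eqI[of _ _ "case_sum v (case_sum w (\<lambda>_. 0))"]) (auto simp: row fmod_iff)
    qed
    show "(rowapp ?B e v = 0 \<and> matapp ?B D v = (\<lambda>_. 0)) = (\<exists>w\<in>fmod V ?B. v = matapp ?B D w)"
      if v: "v \<in> fmod V ?B" for v
    proof -
      define v1 where "v1 = (\<lambda>a. v (Inl a))"
      define v2 where "v2 = (\<lambda>a. v (Inr (Inl a)))"
      define v3 where "v3 = (\<lambda>a. v (Inr (Inr a)))"
      have v_fmod: "v1 \<in> fmod V B1" "v2 \<in> fmod V B2" "v3 \<in> fmod V B3"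
        using v by (auto simp: fmod_iff v1_def v2_def v3_def)
      have image_iff: "(\<exists>w\<in>fmod V ?B. v = matapp ?B D w) \<longleftrightarrow>
        (\<exists>w1\<in>fmod V B1. \<exists>w2\<in>fmod V B2. \<exists>w3\<in>fmod V B3.
           v1 = (\<lambda>a. matapp B1 D1 w1 a + matapp B3 \<phi> w3 a) \<and>
           v2 = (\<lambda>a. matapp B2 D2 w2 a - matapp B3 \<psi> w3 a) \<and>
           v3 = (\<lambda>a. - matapp B3 D3 w3 a))" (is "?L \<longleftrightarrow> ?R")
      proof
        assume ?L
        then show ?R by (fastforce simp: fmod_iff v1_def v2_def v3_def mat)
      next
        assume ?R
        then obtain w1 w2 w3 where w: "w1 \<in> fmod V B1" "w2 \<in> fmod V B2" "w3 \<in> fmod V B3"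
          "v1 = (\<lambda>a. matapp B1 D1 w1 a + matapp B3 \<phi> w3 a)"
          "v2 = (\<lambda>a. matapp B2 D2 w2 a - matapp B3 \<psi> w3 a)"
          "v3 = (\<lambda>a. - matapp B3 D3 w3 a)" by blast
        then have "v = matapp ?B D (case_sum w1 (case_sum w2 w3))"
          by (subst eq_iff) (simp add: mat v1_def v2_def v3_def)
        moreover have "case_sum w1 (case_sum w2 w3) \<in> fmod V ?B" using w by (simp add: fmod_iff)
        ultimately show ?L by blast
      qed
      have kernel_iff: "rowapp ?B e v = 0 \<and> matapp ?B D v = (\<lambda>_. 0) \<longleftrightarrow>
          rowapp B1 e1 v1 + rowapp B2 e2 v2 = 0 \<and>
          (\<lambda>a. matapp B1 D1 v1 a + matapp B3 \<phi> v3 a) = (\<lambda>_. 0) \<and>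
          (\<lambda>a. matapp B2 D2 v2 a - matapp B3 \<psi> v3 a) = (\<lambda>_. 0) \<and> matapp B3 D3 v3 = (\<lambda>_. 0)"
        by (subst eq_iff) (simp add: row mat v1_def v2_def v3_def fun_eq_iff)
      show ?thesis
        unfolding image_iff kernel_iff
      proof
        assume k: "rowapp B1 e1 v1 + rowapp B2 e2 v2 = 0 \<and>
          (\<lambda>a. matapp B1 D1 v1 a + matapp B3 \<phi> v3 a) = (\<lambda>_. 0) \<and>
          (\<lambda>a. matapp B2 D2 v2 a - matapp B3 \<psi> v3 a) = (\<lambda>_. 0) \<and> matapp B3 D3 v3 = (\<lambda>_. 0)"
        have D1v1: "matapp B1 D1 v1 = (\<lambda>a. - matapp B3 \<phi> v3 a)"
          using k by (simp add: fun_eq_iff add_eq_0_iff2)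
        have D2v2: "matapp B2 D2 v2 = matapp B3 \<psi> v3"
          using k by (simp add: fun_eq_iff)
        have "rowapp B3 e3 v3 = - rowapp B1 e1 (matapp B1 D1 v1)"
          by (simp add: D1v1 rowapp_uminus chain_map_aug[OF \<phi>])
        also have "\<dots> = 0" using C1.aug_D[OF v_fmod(1)] by simp
        finally obtain w' where w': "w' \<in> fmod V B3" "v3 = matapp B3 D3 w'"
          using C3.exactE[OF v_fmod(3)] k by metis
        \<comment> \<open>The preimage \<open>w'\<close> of \<open>v3\<close> may have the wrong
          augmentation. The error \<open>?q\<close> lies in \<open>I1\<close> and, by the kernel
          condition, in \<open>I2\<close>, so a cycle of the third resolution corrects it.\<close>
        let ?q = "rowapp B1 e1 v1 + rowapp B3 e3 w'"
        have q2: "?q = - (rowapp B2 e2 v2 - rowapp B3 e3 w')" using k by (simp add: add_eq_0_iff2)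
        have "?q = rowapp B1 e1 (\<lambda>b. v1 b + matapp B3 \<phi> w' b)"
          by (simp add: rowapp_add chain_map_aug[OF \<phi>])
        then have "?q \<in> I1" using C1.aug_in[OF fmod_add[OF v_fmod(1) chain_map_fmod[OF \<phi> w'(1)]]] by simp
        moreover have "?q = rowapp B2 e2 (\<lambda>b. - (v2 b - matapp B3 \<psi> w' b))"
          unfolding q2 by (simp only: rowapp_uminus rowapp_diff chain_map_aug[OF \<psi>])
        then have "?q \<in> I2"
          using C2.aug_in[OF fmod_uminus[OF fmod_diff[OF v_fmod(2) chain_map_fmod[OF \<psi> w'(1)]]]] by simp
        ultimately obtain r where r: "r \<in> fmod V B3" "matapp B3 D3 r = (\<lambda>_. 0)" "rowapp B3 e3 r = ?q"
          using C3.img_cycleE by blast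
        define w where "w = (\<lambda>b. w' b - r b)"
        have w_fmod: "w \<in> fmod V B3" unfolding w_def by (intro fmod_diff w' r)
        have D3w: "matapp B3 D3 w = v3" by (simp add: w_def matapp_diff w' r)
        have e3w: "rowapp B3 e3 w = - rowapp B1 e1 v1" by (simp add: w_def rowapp_diff r)
        obtain w1 where w1: "w1 \<in> fmod V B1" "(\<lambda>b. v1 b + matapp B3 \<phi> w b) = matapp B1 D1 w1"
        proof (rule C1.exactE)
          show "(\<lambda>b. v1 b + matapp B3 \<phi> w b) \<in> fmod V B1"
            by (intro fmod_add v_fmod chain_map_fmod[OF \<phi>] w_fmod)
          show "rowapp B1 e1 (\<lambda>b. v1 b + matapp B3 \<phi> w b) = 0"
            by (simp add: rowapp_add chain_map_aug[OF \<phi>] e3w)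
          show "matapp B1 D1 (\<lambda>b. v1 b + matapp B3 \<phi> w b) = (\<lambda>_. 0)"
            by (simp add: matapp_add chain_map_D[OF \<phi>] D3w D1v1)
        qed (rule that)
        obtain w2 where w2: "w2 \<in> fmod V B2" "(\<lambda>b. v2 b - matapp B3 \<psi> w b) = matapp B2 D2 w2"
        proof (rule C2.exactE)
          show "(\<lambda>b. v2 b - matapp B3 \<psi> w b) \<in> fmod V B2"
            by (intro fmod_diff v_fmod chain_map_fmod[OF \<psi>] w_fmod)
          show "rowapp B2 e2 (\<lambda>b. v2 b - matapp B3 \<psi> w b) = 0"
            using k by (simp add: rowapp_diff chain_map_aug[OF \<psi>] e3w add.commute)
          show "matapp B2 D2 (\<lambda>b. v2 b - matapp B3 \<psi> w b) = (\<lambda>_. 0)"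
            by (simp add: matapp_diff chain_map_D[OF \<psi>] D3w D2v2)
        qed (rule that)
        \<comment> \<open>The third component of the preimage is the negative of \<open>w\<close>,
          because \<open>D3\<close> enters the cone with a minus sign.\<close>
        have "v1 = (\<lambda>a. matapp B1 D1 w1 a + matapp B3 \<phi> (\<lambda>b. - w b) a)"
          by (simp add: matapp_uminus flip: w1(2))
        moreover have "v2 = (\<lambda>a. matapp B2 D2 w2 a - matapp B3 \<psi> (\<lambda>b. - w b) a)"
          by (simp add: matapp_uminus flip: w2(2))
        moreover have "v3 = (\<lambda>a. - matapp B3 D3 (\<lambda>b. - w b) a)"
          by (simp add: matapp_uminus D3w)
        ultimately show "\<exists>w1\<in>fmod V B1. \<exists>w2\<in>fmod V B2. \<exists>w3\<in>fmod V B3.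
           v1 = (\<lambda>a. matapp B1 D1 w1 a + matapp B3 \<phi> w3 a) \<and>
           v2 = (\<lambda>a. matapp B2 D2 w2 a - matapp B3 \<psi> w3 a) \<and>
           v3 = (\<lambda>a. - matapp B3 D3 w3 a)"
          using w1(1) w2(1) fmod_uminus[OF w_fmod] by blast
      next
        assume "\<exists>w1\<in>fmod V B1. \<exists>w2\<in>fmod V B2. \<exists>w3\<in>fmod V B3.
           v1 = (\<lambda>a. matapp B1 D1 w1 a + matapp B3 \<phi> w3 a) \<and>
           v2 = (\<lambda>a. matapp B2 D2 w2 a - matapp B3 \<psi> w3 a) \<and>
           v3 = (\<lambda>a. - matapp B3 D3 w3 a)"
        then obtain w1 w2 w3 where w: "w1 \<in> fmod V B1" "w2 \<in> fmod V B2" "w3 \<in> fmod V B3"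
          "v1 = (\<lambda>a. matapp B1 D1 w1 a + matapp B3 \<phi> w3 a)"
          "v2 = (\<lambda>a. matapp B2 D2 w2 a - matapp B3 \<psi> w3 a)"
          "v3 = (\<lambda>a. - matapp B3 D3 w3 a)" by blast
        show "rowapp B1 e1 v1 + rowapp B2 e2 v2 = 0 \<and>
          (\<lambda>a. matapp B1 D1 v1 a + matapp B3 \<phi> v3 a) = (\<lambda>_. 0) \<and>
          (\<lambda>a. matapp B2 D2 v2 a - matapp B3 \<psi> v3 a) = (\<lambda>_. 0) \<and> matapp B3 D3 v3 = (\<lambda>_. 0)"
          by (simp add: w(4-6) rowapp_add rowapp_diff matapp_add matapp_diff matapp_uminus
              C1.aug_D[OF w(1)] C1.D_D[OF w(1)] C2.aug_D[OF w(2)] C2.D_D[OF w(2)] C3.D_D[OF w(3)]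
              chain_map_aug[OF \<phi>] chain_map_aug[OF \<psi>] chain_map_D[OF \<phi>] chain_map_D[OF \<psi>])
      qed
    qed
  qed
  then show ?thesis
  proof (rule has_resI)
    show "?deg b \<le> t + int (?lev b)" if "b \<in> ?B" for b
      using that b1 b2 b3 by (auto simp: algebra_simps)
  qed
qed

section \<open>Squarefree monomial ideals\<close>

text \<open>For an upward closed \<open>F\<close> this is the squarefree monomial ideal whose
  monomials are those with support in \<open>F\<close>. Encoding it by the family reduces sums and
  intersections of ideals to unions and intersections of families.\<close>

definition sq_ideal :: "nat set \<Rightarrow> nat set set \<Rightarrow> 'k::field mpoly set" where
  "sq_ideal V F = {p. in_vars V p \<and> (\<forall>m\<in>supp p. supp m \<in> F)}"

lemma sq_idealI: "in_vars V p \<Longrightarrow> (\<And>m. m \<in> supp p \<Longrightarrow> supp m \<in> F) \<Longrightarrow> p \<in> sq_ideal V F"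
  by (simp add: sq_ideal_def)

lemma sq_ideal_sum: "(\<And>a. a \<in> A \<Longrightarrow> f a \<in> sq_ideal V F) \<Longrightarrow> sum f A \<in> sq_ideal V F"
proof -
  assume *: "\<And>a. a \<in> A \<Longrightarrow> f a \<in> sq_ideal V F"
  have add: "p + q \<in> sq_ideal V F" if "p \<in> sq_ideal V F" "q \<in> sq_ideal V F" for p q
    using that keys_add[of p q] by (auto simp: sq_ideal_def intro: in_vars_add)
  show ?thesis
    using *
  proof (induction A rule: infinite_finite_induct)
    case (insert a A)
    then show ?case by (simp add: add)
  qed (simp_all add: sq_ideal_def)
qed

lemma sq_ideal_Un: "sq_ideal V (F \<union> G) = {p + q | p q. p \<in> sq_ideal V F \<and> q \<in> sq_ideal V G}"
proof (intro equalityI subsetI)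
  fix p assume p: "p \<in> sq_ideal V (F \<union> G)"
  let ?X = "{m. supp m \<in> F}"
  have "p = restr ?X p + restr (- ?X) p" by (simp add: restr_compl)
  moreover have "restr ?X p \<in> sq_ideal V F" "restr (- ?X) p \<in> sq_ideal V G"
    using p by (auto simp: sq_ideal_def in_vars_restr)
  ultimately show "p \<in> {p + q | p q. p \<in> sq_ideal V F \<and> q \<in> sq_ideal V G}" by blast
next
  fix r assume "r \<in> {p + q | p q. p \<in> sq_ideal V F \<and> q \<in> sq_ideal V G}"
  then obtain p q where "r = p + q" "p \<in> sq_ideal V F" "q \<in> sq_ideal V G" by blast
  then show "r \<in> sq_ideal V (F \<union> G)"
    using keys_add[of p q] by (auto simp: sq_ideal_def intro: in_vars_add)
qed

lemma sq_ideal_Int: "sq_ideal V (F \<inter> G) = sq_ideal V F \<inter> sq_ideal V G"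
  by (auto simp: sq_ideal_def)

lemma sq_ideal_empty: "sq_ideal V {} = {0}"
  by (auto simp: sq_ideal_def)

lemma sq_ideal_UNIV: "sq_ideal V UNIV = {p. in_vars V p}"
  by (auto simp: sq_ideal_def)

lemma ind_minus: "finite W \<Longrightarrow> W \<subseteq> supp m \<Longrightarrow> ind W + (m - ind W) = m"
  by (intro poly_mapping_eqI) (auto simp: lookup_add lookup_minus coeff_ind in_keys_iff subset_iff)

lemma supp_minus_ind: "supp (m - ind W) \<subseteq> supp m"
  by (auto simp: in_keys_iff lookup_minus)

lemma single_eq_ind: "Poly_Mapping.single x 1 = ind {x}"
  by (simp add: ind_def)

text \<open>The monomials of the right side contain \<open>x\<close> and can be divided by it once.
  Whether or not \<open>x\<close> survives in the support, the quotient stays in the family, since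
  membership does not depend on \<open>x\<close>.\<close>

lemma sq_ideal_var_mult:
  assumes "x \<in> V" and indep: "\<And>A. insert x A \<in> F \<longleftrightarrow> A \<in> F"
  shows "(*) (var x) ` sq_ideal V F = (sq_ideal V {A \<in> F. x \<in> A} :: 'k::field mpoly set)"
proof (intro equalityI subsetI)
  fix r :: "'k mpoly" assume "r \<in> (*) (var x) ` sq_ideal V F"
  then obtain p where p: "p \<in> sq_ideal V F" "r = var x * p" by blast
  show "r \<in> sq_ideal V {A \<in> F. x \<in> A}"
  proof (rule sq_idealI)
    show "in_vars V r" using p assms(1) by (auto simp: sq_ideal_def intro: in_vars_mult in_vars_var)
    fix m assume "m \<in> supp r"
    then obtain b where "b \<in> supp p" "m = Poly_Mapping.single x 1 + b"
      unfolding p by (elim supp_timesE) (auto simp: var_def)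
    then show "supp m \<in> {A \<in> F. x \<in> A}" using p indep by (auto simp: sq_ideal_def)
  qed
next
  fix p :: "'k mpoly" assume p: "p \<in> sq_ideal V {A \<in> F. x \<in> A}"
  have m: "ind {x} + (m - ind {x}) = m" "supp m \<subseteq> V" "supp (m - ind {x}) \<in> F" if "m \<in> supp p" for m
  proof -
    show 1: "ind {x} + (m - ind {x}) = m"
      using p that by (intro ind_minus) (auto simp: sq_ideal_def)
    have "insert x (supp (m - ind {x})) = supp m" using arg_cong[OF 1, of supp] by simp
    then show "supp (m - ind {x}) \<in> F" using p that indep by (metis (no_types, lifting) mem_Collect_eq sq_ideal_def)
    show "supp m \<subseteq> V" using p that by (auto simp: sq_ideal_def in_vars_def)
  qed
  define q where "q = (\<Sum>m\<in>supp p. term_of (m - ind {x}) (coeff p m))"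
  have "q \<in> sq_ideal V F"
    unfolding q_def
  proof (rule sq_ideal_sum)
    show "term_of (m - ind {x}) (coeff p m) \<in> sq_ideal V F" if "m \<in> supp p" for m
      using m[OF that] supp_minus_ind[of m "{x}"]
      by (intro sq_idealI in_vars_termI) (auto split: if_splits)
  qed
  moreover have "var x * q = (\<Sum>m\<in>supp p. term_of m (coeff p m))"
    unfolding q_def sum_distrib_left var_def single_eq_ind using m
    by (intro sum.cong) (simp_all add: mult_single)
  then have "p = var x * q" by (simp add: sum_terms)
  ultimately show "p \<in> (*) (var x) ` sq_ideal V F" by blast
qed

lemma has_res_Un:
  assumes "has_res V (sq_ideal V F :: 'k::field mpoly set) t" "has_res V (sq_ideal V G :: 'k mpoly set) t"
    "has_res V (sq_ideal V (F \<inter> G) :: 'k mpoly set) (t + 1)"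
  shows "has_res V (sq_ideal V (F \<union> G) :: 'k mpoly set) t"
  using has_res_sum assms unfolding sq_ideal_Un sq_ideal_Int by blast

lemma has_res_insert_var:
  assumes "has_res V (sq_ideal V F :: 'k::field mpoly set) t" "x \<in> V"
    and "\<And>A. insert x A \<in> F \<longleftrightarrow> A \<in> F"
  shows "has_res V (sq_ideal V {A \<in> F. x \<in> A} :: 'k mpoly set) (t + 1)"
  unfolding sq_ideal_var_mult[OF assms(2,3), symmetric] using assms(1,2) by (rule has_res_var_mult)

section \<open>Ideals generated by squarefree monomials\<close>

definition up_family :: "nat set set \<Rightarrow> nat set set" where
  "up_family \<W> = {A. \<exists>W\<in>\<W>. W \<subseteq> A}"

lemma has_res_principal:
  assumes "finite W" "W \<subseteq> V"
  shows "has_res V (sq_ideal V (up_family {W}) :: 'k::field mpoly set) (int (card W))"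
  using assms
proof (induction W rule: finite_induct)
  case empty
  have "up_family {{}} = UNIV" by (simp add: up_family_def)
  then show ?case by (simp add: sq_ideal_UNIV has_res_unit)
next
  case (insert x W)
  have "has_res V (sq_ideal V {A \<in> up_family {W}. x \<in> A} :: 'k mpoly set) (int (card W) + 1)"
    using insert by (intro has_res_insert_var) (auto simp: up_family_def)
  moreover have "{A \<in> up_family {W}. x \<in> A} = up_family {insert x W}"
    by (auto simp: up_family_def)
  ultimately show ?case using insert by (simp add: add.commute)
qed

text \<open>Provides the starting point for a minimal resolution, so any bound will do. After
  splitting off one generator \<open>W\<close>, the intersection is generated by the unions
  \<open>W \<union> U\<close> with the others, which are fewer than the generators at hand.\<close>

lemma has_res_up_family:
  assumes "finite \<W>" "\<And>W. W \<in> \<W> \<Longrightarrow> finite W \<and> W \<subseteq> V"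
  shows "\<exists>t. has_res V (sq_ideal V (up_family \<W>) :: 'k::field mpoly set) t"
  using assms
proof (induction "card \<W>" arbitrary: \<W> rule: less_induct)
  case less
  show ?case
  proof (cases "\<W> = {}")
    case True
    then show ?thesis using has_res_zero by (auto simp: up_family_def sq_ideal_empty)
  next
    case False
    then obtain W where W: "W \<in> \<W>" by blast
    let ?R = "\<W> - {W}"
    have card: "card ?R < card \<W>" using less.prems(1) W by (meson card_Diff1_less)
    then obtain t1 where t1: "has_res V (sq_ideal V (up_family ?R) :: 'k mpoly set) t1"
      using less.hyps[of ?R] less.prems by (meson Diff_subset finite_Diff subsetD)
    have "card ((\<union>) W ` ?R) < card \<W>"
      using card card_image_le[of ?R "(\<union>) W"] less.prems(1) by (meson finite_Diff le_less_trans)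
    moreover have "finite ((\<union>) W ` ?R)" "\<And>U. U \<in> (\<union>) W ` ?R \<Longrightarrow> finite U \<and> U \<subseteq> V"
      using less.prems W by auto
    ultimately obtain t2 where t2: "has_res V (sq_ideal V (up_family ((\<union>) W ` ?R)) :: 'k mpoly set) t2"
      using less.hyps by blast
    have t3: "has_res V (sq_ideal V (up_family {W}) :: 'k mpoly set) (int (card W))"
      using less.prems(2)[OF W] by (intro has_res_principal) auto
    have int: "up_family ?R \<inter> up_family {W} = up_family ((\<union>) W ` ?R)"
      by (auto simp: up_family_def)
    define t where "t = max t1 (max t2 (int (card W)))"
    have "has_res V (sq_ideal V (up_family ?R \<union> up_family {W}) :: 'k mpoly set) t"
      using t1 t2 t3 unfolding t_def
      by (intro has_res_Un) (auto simp: int elim!: has_res_mono)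
    moreover have "up_family ?R \<union> up_family {W} = up_family \<W>"
      using W by (auto simp: up_family_def)
    ultimately show ?thesis by auto
  qed
qed

lemma term_ind: "finite W \<Longrightarrow> term_of (ind W) (1 :: 'k::field) = (\<Prod>i\<in>W. var i)"
proof (induction W rule: finite_induct)
  case (insert x W)
  then have "ind (insert x W) = Poly_Mapping.single x 1 + ind W" by (simp add: ind_def)
  then have "term_of (ind (insert x W)) (1 :: 'k) = var x * term_of (ind W) 1"
    by (simp add: var_def mult_single)
  then show ?case using insert by simp
qed (simp add: ind_def)

lemma ideal_gen_squarefree:
  assumes \<W>: "\<And>W. W \<in> \<W> \<Longrightarrow> finite W \<and> W \<subseteq> V"
  shows "ideal_gen V ((\<lambda>W. term_of (ind W) 1) ` \<W>) = (sq_ideal V (up_family \<W>) :: 'k::field mpoly set)"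
    (is "ideal_gen V ?G = _")
proof (intro equalityI subsetI)
  fix p :: "'k mpoly" assume "p \<in> ideal_gen V ?G"
  then obtain c Gs where p: "p = (\<Sum>g\<in>Gs. c g * g)" "Gs \<subseteq> ?G" "\<forall>g\<in>Gs. in_vars V (c g)"
    by (auto simp: ideal_gen_def)
  show "p \<in> sq_ideal V (up_family \<W>)"
    unfolding p(1)
  proof (rule sq_ideal_sum)
    fix g assume g: "g \<in> Gs"
    then obtain W where W: "W \<in> \<W>" "g = term_of (ind W) 1" using p by blast
    show "c g * g \<in> sq_ideal V (up_family \<W>)"
    proof (rule sq_idealI)
      show "in_vars V (c g * g)"
        using g p(3) W \<W>[OF W(1)] by (intro in_vars_mult) (auto intro!: in_vars_termI)
      fix m assume "m \<in> supp (c g * g)"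
      then obtain a where "m = a + ind W" by (elim supp_timesE) (auto simp: W)
      then show "supp m \<in> up_family \<W>" using W \<W>[OF W(1)] by (auto simp: up_family_def)
    qed
  qed
next
  fix p :: "'k mpoly" assume p: "p \<in> sq_ideal V (up_family \<W>)"
  then have "\<forall>m\<in>supp p. \<exists>W. W \<in> \<W> \<and> W \<subseteq> supp m" by (auto simp: sq_ideal_def up_family_def)
  then obtain W where W: "\<And>m. m \<in> supp p \<Longrightarrow> W m \<in> \<W> \<and> W m \<subseteq> supp m" by metis
  define gen where "gen m = term_of (ind (W m)) (1 :: 'k)" for m
  \<comment> \<open>Each monomial of \<open>p\<close> is charged to one generator dividing it;
    \<open>c g\<close> collects the quotients of the monomials charged to \<open>g\<close>.\<close>
  define c where "c g = (\<Sum>m\<in>{m \<in> supp p. gen m = g}. term_of (m - ind (W m)) (coeff p m))" for g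
  have "p = (\<Sum>m\<in>supp p. term_of m (coeff p m))" by (simp add: sum_terms)
  also have "\<dots> = (\<Sum>m\<in>supp p. term_of (m - ind (W m)) (coeff p m) * gen m)"
  proof (rule sum.cong)
    fix m assume "m \<in> supp p"
    then have "ind (W m) + (m - ind (W m)) = m" using W \<W> by (intro ind_minus) auto
    then show "term_of m (coeff p m) = term_of (m - ind (W m)) (coeff p m) * gen m"
      by (simp add: gen_def mult_single add.commute)
  qed simp
  also have "\<dots> = (\<Sum>g\<in>gen ` supp p. \<Sum>m\<in>{m \<in> supp p. gen m = g}. term_of (m - ind (W m)) (coeff p m) * gen m)"
    by (rule sum.image_gen) simp
  also have "\<dots> = (\<Sum>g\<in>gen ` supp p. c g * g)"
    unfolding c_def sum_distrib_right by (intro sum.cong) auto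
  finally have eq: "p = (\<Sum>g\<in>gen ` supp p. c g * g)" .
  have "in_vars V (c g)" for g
    unfolding c_def
  proof (intro in_vars_sum in_vars_termI)
    fix m assume "m \<in> {m \<in> supp p. gen m = g}"
    then have "supp m \<subseteq> V" using p by (auto simp: sq_ideal_def in_vars_def)
    then show "supp (m - ind (W m)) \<subseteq> V" using supp_minus_ind[of m "W m"] by blast
  qed
  moreover have "gen ` supp p \<subseteq> ?G" using W by (auto simp: gen_def)
  ultimately show "p \<in> ideal_gen V ?G"
    unfolding ideal_gen_def using eq by (intro CollectI exI[of _ c] exI[of _ "gen ` supp p"]) auto
qed

section \<open>Comparison with list-indexed resolutions\<close>

definition index_set :: "(nat \<Rightarrow> int list) \<Rightarrow> (nat \<times> nat) set" where
  "index_set ds = {(i, l). l < length (ds i)}"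

text \<open>\<open>A 0\<close> maps into the polynomial ring, which is not a module of the
  resolution, so it becomes the augmentation and \<open>mat_of\<close> begins with
  \<open>A 1\<close>.\<close>

definition aug_of :: "(nat \<Rightarrow> nat \<Rightarrow> nat \<Rightarrow> 'k::field mpoly) \<Rightarrow> nat \<times> nat \<Rightarrow> 'k mpoly" where
  "aug_of A = (\<lambda>(i, l). if i = 0 then A 0 0 l else 0)"

definition mat_of :: "(nat \<Rightarrow> nat \<Rightarrow> nat \<Rightarrow> 'k::field mpoly) \<Rightarrow> nat \<times> nat \<Rightarrow> nat \<times> nat \<Rightarrow> 'k mpoly" where
  "mat_of A = (\<lambda>(i, m) (j, l). if j = Suc i then A j m l else 0)"

text \<open>Kernel and image conditions decompose by level, so exactness in every homological degree
  amounts to exactness of the collected differential.\<close>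

lemma gres_of_graded_free_res:
  assumes "graded_free_res V I ds A L"
  shows "gres V I (index_set ds) fst (\<lambda>(i, l). ds i ! l) (aug_of A) (mat_of A)"
proof -
  let ?B = "index_set ds"
  have nil: "ds i = []" if "i > L" for i
    using assms that by (simp add: graded_free_res_def)
  have ent: "in_vars V (A i m l)" "hom_deg (A i m l) (ds i ! l - tgt_deg ds i m)" for i m l
    using assms by (cases "m < tgt_rank ds i \<and> l < length (ds i)"; simp add: graded_free_res_def)+
  have out: "m < tgt_rank ds i \<and> l < length (ds i)" if "A i m l \<noteq> 0" for i m l
  proof -
    have "\<forall>i m l. \<not> (m < tgt_rank ds i \<and> l < length (ds i)) \<longrightarrow> A i m l = 0"
      using assms unfolding graded_free_res_def by (elim conjE)
    then show ?thesis using that by metis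
  qed
  have im: "(\<lambda>v. mat_app (length (ds 0)) (A 0) v 0) ` free_mod V (length (ds 0)) = I"
    using assms by (simp add: graded_free_res_def)
  have ex: "{v \<in> free_mod V (length (ds i)). mat_app (length (ds i)) (A i) v = (\<lambda>_. 0)}
          = mat_app (length (ds (Suc i))) (A (Suc i)) ` free_mod V (length (ds (Suc i)))" for i
    using assms by (simp add: graded_free_res_def)
  have fin: "finite ?B"
  proof (rule finite_subset)
    show "?B \<subseteq> (SIGMA i:{..L}. {..<length (ds i)})"
      using nil by (force simp: index_set_def not_le[symmetric])
  qed simp
  have sum_level: "(\<Sum>b\<in>?B. h b) = (\<Sum>l<length (ds j). h (j, l))"
    if "\<And>i l. i \<noteq> j \<Longrightarrow> h (i, l) = 0" for h :: "nat \<times> nat \<Rightarrow> 'a mpoly" and j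
  proof -
    have "(\<Sum>l<length (ds j). h (j, l)) = sum h (Pair j ` {..<length (ds j)})"
      by (subst sum.reindex) (auto intro: inj_onI)
    also have "\<dots> = sum h ?B"
    proof (rule sum.mono_neutral_left[OF fin])
      show "Pair j ` {..<length (ds j)} \<subseteq> ?B" by (auto simp: index_set_def)
      show "\<forall>b\<in>?B - Pair j ` {..<length (ds j)}. h b = 0"
        using that by (force simp: index_set_def)
    qed
    finally show ?thesis by simp
  qed
  have row: "rowapp ?B (aug_of A) v = mat_app (length (ds 0)) (A 0) (\<lambda>l. v (0, l)) 0" for v
    unfolding rowapp_def by (subst sum_level[of 0]) (auto simp: aug_of_def mat_app_def)
  have mat: "matapp ?B (mat_of A) v (i, m) = mat_app (length (ds (Suc i))) (A (Suc i)) (\<lambda>l. v (Suc i, l)) m" for v i m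
    unfolding rowapp_def matapp_def by (subst sum_level[of "Suc i"]) (auto simp: mat_of_def mat_app_def)
  have slice: "(\<lambda>l. v (i, l)) \<in> free_mod V (length (ds i))" if "v \<in> fmod V ?B" for v :: "_ \<Rightarrow> 'a mpoly" and i
    using that by (auto simp: fmod_def free_mod_def index_set_def)
  show ?thesis
  proof
    show "finite ?B" by (rule fin)
    show "in_vars V (aug_of A l)" for l
      using ent by (auto simp: aug_of_def split: prod.split)
    show "hom_deg (aug_of A b) (case b of (i, l) \<Rightarrow> ds i ! l)" for b
      using ent(2)[of 0 0] by (auto simp: aug_of_def tgt_deg_def split: prod.split)
    show "b \<in> ?B \<and> fst b = 0" if "aug_of A b \<noteq> 0" for b
      using that out[of 0 0] by (auto simp: aug_of_def index_set_def split: prod.splits if_splits)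
    show "in_vars V (mat_of A m l)" for m l
      using ent by (auto simp: mat_of_def split: prod.split)
    show "hom_deg (mat_of A m l) ((case l of (i, l) \<Rightarrow> ds i ! l) - (case m of (i, l) \<Rightarrow> ds i ! l))" for m l
    proof -
      obtain i a j b where [simp]: "m = (i, a)" "l = (j, b)" by fastforce
      show ?thesis using ent(2)[of "Suc i" a b] by (auto simp: mat_of_def tgt_deg_def)
    qed
    show "m \<in> ?B \<and> l \<in> ?B \<and> fst l = Suc (fst m)" if "mat_of A m l \<noteq> 0" for m l
    proof -
      obtain i a j b where [simp]: "m = (i, a)" "l = (j, b)" by fastforce
      show ?thesis using that out[of "Suc i" a b]
        by (auto simp: mat_of_def tgt_rank_def index_set_def split: if_splits)
    qed
    show "rowapp ?B (aug_of A) ` fmod V ?B = I"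
      unfolding im[symmetric]
    proof (intro equalityI image_subsetI)
      show "rowapp ?B (aug_of A) v \<in> (\<lambda>v. mat_app (length (ds 0)) (A 0) v 0) ` free_mod V (length (ds 0))"
        if "v \<in> fmod V ?B" for v
        using slice[OF that, of 0] by (auto simp: row)
      show "mat_app (length (ds 0)) (A 0) v 0 \<in> rowapp ?B (aug_of A) ` fmod V ?B"
        if "v \<in> free_mod V (length (ds 0))" for v
        using that by (intro image_eqI[of _ _ "\<lambda>(i, l). if i = 0 then v l else 0"])
          (simp add: row, auto simp: free_mod_def fmod_def index_set_def)
    qed
    show "(rowapp ?B (aug_of A) v = 0 \<and> matapp ?B (mat_of A) v = (\<lambda>_. 0)) \<longleftrightarrow>
        (\<exists>w\<in>fmod V ?B. v = matapp ?B (mat_of A) w)" if v: "v \<in> fmod V ?B" for v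
    proof -
      \<comment> \<open>The list format asks for a whole vector to vanish although the target of
        \<open>A 0\<close> has rank one: the other entries are zero anyway.\<close>
      have row0: "mat_app (length (ds 0)) (A 0) (\<lambda>l. v (0, l)) m = 0" if "m \<noteq> 0" for m
        using out[of 0 m] that unfolding mat_app_def tgt_rank_def by (intro sum.neutral) fastforce
      have "(rowapp ?B (aug_of A) v = 0 \<and> matapp ?B (mat_of A) v = (\<lambda>_. 0)) \<longleftrightarrow>
          (\<forall>i. mat_app (length (ds i)) (A i) (\<lambda>l. v (i, l)) = (\<lambda>_. 0))" (is "?k \<longleftrightarrow> ?l")
      proof
        assume k: ?k
        show ?l
        proof
          fix i show "mat_app (length (ds i)) (A i) (\<lambda>l. v (i, l)) = (\<lambda>_. 0)"
          proof (cases i)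
            case 0
            then show ?thesis using k row0 unfolding row fun_eq_iff by metis
          next
            case (Suc j)
            then show ?thesis using k mat[of v j] by (simp add: fun_eq_iff)
          qed
        qed
      next
        assume l: ?l
        then have "matapp ?B (mat_of A) v (i, m) = 0" for i m by (simp add: mat)
        then show ?k using l by (auto simp: row)
      qed
      also have "\<dots> \<longleftrightarrow> (\<forall>i. \<exists>w\<in>free_mod V (length (ds (Suc i))). (\<lambda>l. v (i, l)) = mat_app (length (ds (Suc i))) (A (Suc i)) w)"
      proof -
        have "mat_app (length (ds i)) (A i) (\<lambda>l. v (i, l)) = (\<lambda>_. 0) \<longleftrightarrow>
            (\<lambda>l. v (i, l)) \<in> mat_app (length (ds (Suc i))) (A (Suc i)) ` free_mod V (length (ds (Suc i)))" for i
          using slice[OF v, of i] ex[of i, symmetric] by simp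
        then show ?thesis by (simp add: image_iff)
      qed
      also have "\<dots> \<longleftrightarrow> (\<exists>w\<in>fmod V ?B. v = matapp ?B (mat_of A) w)" (is "?l \<longleftrightarrow> ?r")
      proof
        assume ?l
        then obtain w where w: "\<And>i. w i \<in> free_mod V (length (ds (Suc i)))"
          "\<And>i. (\<lambda>l. v (i, l)) = mat_app (length (ds (Suc i))) (A (Suc i)) (w i)" by metis
        \<comment> \<open>Each \<open>w i\<close> lives in level \<open>i + 1\<close>; level 0 is
          set to zero, as the differential kills it.\<close>
        define w' where "w' = (\<lambda>(i, l). case i of 0 \<Rightarrow> 0 | Suc j \<Rightarrow> w j l)"
        have "w' \<in> fmod V ?B"
          using w(1) by (auto simp: w'_def fmod_def free_mod_def index_set_def split: nat.split)
        moreover have "v (i, l) = matapp ?B (mat_of A) w' (i, l)" for i l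
          using fun_cong[OF w(2)[of i], of l] by (simp add: mat w'_def)
        then have "v = matapp ?B (mat_of A) w'" by auto
        ultimately show ?r by blast
      next
        assume ?r
        then obtain w where w: "w \<in> fmod V ?B" "v = matapp ?B (mat_of A) w" by blast
        then have "(\<lambda>l. v (i, l)) = mat_app (length (ds (Suc i))) (A (Suc i)) (\<lambda>l. w (Suc i, l))" for i
          by (simp add: mat)
        then show ?l using slice[OF w(1)] by blast
      qed
      finally show ?thesis .
    qed
  qed
qed

lemma graded_free_res_of_gres:
  fixes B :: "'b set"
  assumes "gres V I B lev deg e D" and minimal: "\<And>m l. coeff (D m l) 0 = 0"
  shows "\<exists>ds A L. minimal_graded_free_res V I ds A L"
proof -
  interpret gres V I B lev deg e D by fact
  have "\<exists>xs. distinct xs \<and> set xs = {b \<in> B. lev b = i}" for i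
    using finite_distinct_list[of "{b \<in> B. lev b = i}"] fin by auto
  then have "\<exists>bs. \<forall>i. distinct (bs i) \<and> set (bs i) = {b \<in> B. lev b = i}"
    by (intro choice allI)
  then obtain bs where bs: "\<And>i. distinct (bs i)" "\<And>i. set (bs i) = {b \<in> B. lev b = i}" by blast
  define ds where "ds i = map deg (bs i)" for i
  define A where "A i m l = (if l < length (bs i) then
      (case i of 0 \<Rightarrow> if m = 0 then e (bs 0 ! l) else 0
       | Suc j \<Rightarrow> if m < length (bs j) then D (bs j ! m) (bs i ! l) else 0) else 0)" for i m l
  have len [simp]: "length (ds i) = length (bs i)" for i by (simp add: ds_def)
  have nth: "bs i ! l \<in> B" "lev (bs i ! l) = i" if "l < length (bs i)" for i l
    using nth_mem[OF that] bs(2) by auto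
  \<comment> \<open>Views a vector of level \<open>i\<close> as an element of the collected module.
    Since \<open>bs i\<close> is distinct, at most one position contributes to the sum.\<close>
  define up where "up i v b = (if b \<in> B \<and> lev b = i then \<Sum>l<length (bs i). if bs i ! l = b then v l else 0 else 0)"
    for i b and v :: "nat \<Rightarrow> 'a mpoly"
  have up_nth: "up i v (bs i ! l) = v l" if "l < length (bs i)" for i l v
  proof -
    have "up i v (bs i ! l) = (\<Sum>l'<length (bs i). if l' = l then v l' else 0)"
      using nth[OF that] bs(1)[of i] that unfolding up_def
      by (auto intro!: sum.cong simp: nth_eq_iff_index_eq)
    then show ?thesis using that by simp
  qed
  have up_fmod: "up i v \<in> fmod V B" if "v \<in> free_mod V (length (bs i))" for i v
    using that by (auto simp: up_def fmod_def free_mod_def intro!: in_vars_sum)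
  have sum_level: "(\<Sum>b\<in>B. h b * w b) = (\<Sum>l<length (bs i). h (bs i ! l) * w (bs i ! l))"
    if "\<And>b. b \<in> B \<Longrightarrow> lev b \<noteq> i \<Longrightarrow> h b * w b = 0" for h w :: "'b \<Rightarrow> 'a mpoly" and i
  proof -
    have "(\<Sum>b\<in>B. h b * w b) = (\<Sum>b\<in>set (bs i). h b * w b)"
      using fin that by (intro sum.mono_neutral_right) (auto simp: bs)
    also have "\<dots> = (\<Sum>l<length (bs i). h (bs i ! l) * w (bs i ! l))"
      using sum.reindex_bij_betw[OF bij_betw_nth[OF bs(1) refl refl]] by (rule sym)
    finally show ?thesis .
  qed
  have A0: "mat_app (length (bs 0)) (A 0) v 0 = rowapp B e (up 0 v)" for v
  proof -
    have "rowapp B e (up 0 v) = (\<Sum>l<length (bs 0). e (bs 0 ! l) * up 0 v (bs 0 ! l))"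
      unfolding rowapp_def by (rule sum_level) (simp add: up_def)
    then show ?thesis by (simp add: mat_app_def A_def up_nth)
  qed
  have A0': "mat_app (length (bs 0)) (A 0) v m = 0" if "m \<noteq> 0" for v m
    using that by (simp add: mat_app_def A_def)
  have AS: "mat_app (length (bs (Suc i))) (A (Suc i)) v m = (if m < length (bs i) then matapp B D (up (Suc i) v) (bs i ! m) else 0)"
    for i v m
  proof -
    have "matapp B D (up (Suc i) v) (bs i ! m) = (\<Sum>l<length (bs (Suc i)). D (bs i ! m) (bs (Suc i) ! l) * up (Suc i) v (bs (Suc i) ! l))"
      unfolding rowapp_def matapp_def by (rule sum_level) (simp add: up_def)
    then show ?thesis by (simp add: mat_app_def A_def up_nth)
  qed
  have D_out: "matapp B D (up i v) b = 0" if "\<not> (b \<in> B \<and> Suc (lev b) = i)" for i v b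
    unfolding matapp_def rowapp_def
  proof (rule sum.neutral, rule ballI)
    fix l assume "l \<in> B"
    show "D b l * up i v l = 0"
    proof (cases "D b l = 0")
      case False
      then have "lev l \<noteq> i" using D_lev[OF False] that by metis
      then have "up i v l = 0" by (simp add: up_def)
      then show ?thesis by simp
    qed simp
  qed
  have aug_out: "rowapp B e (up (Suc i) v) = 0" for i v
    unfolding rowapp_def
  proof (rule sum.neutral, rule ballI)
    fix l
    show "e l * up (Suc i) v l = 0"
    proof (cases "e l = 0")
      case False
      then have "up (Suc i) v l = 0" using e_lev[OF False] by (simp add: up_def)
      then show ?thesis by simp
    qed simp
  qed
  \<comment> \<open>In level 0 the condition on \<open>D\<close> holds automatically and in higher
    levels the condition on \<open>e\<close> does, so the single matrix \<open>A i\<close> captures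
    both.\<close>
  have ker_iff: "mat_app (length (bs i)) (A i) v = (\<lambda>_. 0) \<longleftrightarrow>
      rowapp B e (up i v) = 0 \<and> matapp B D (up i v) = (\<lambda>_. 0)" for i v
  proof (cases i)
    case 0
    have "matapp B D (up 0 v) = (\<lambda>_. 0)" using D_out[of _ 0 v] by auto
    moreover have "mat_app (length (bs 0)) (A 0) v = (\<lambda>_. 0) \<longleftrightarrow> mat_app (length (bs 0)) (A 0) v 0 = 0"
    proof
      assume z: "mat_app (length (bs 0)) (A 0) v 0 = 0"
      show "mat_app (length (bs 0)) (A 0) v = (\<lambda>_. 0)"
      proof
        show "mat_app (length (bs 0)) (A 0) v m = 0" for m
          using z A0'[of m v] by (cases "m = 0") simp_all
      qed
    qed simp
    ultimately show ?thesis unfolding 0 A0 by simp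
  next
    case (Suc j)
    have "matapp B D (up (Suc j) v) = (\<lambda>_. 0)" if *: "\<And>m. m < length (bs j) \<Longrightarrow> matapp B D (up (Suc j) v) (bs j ! m) = 0"
    proof
      fix b
      show "matapp B D (up (Suc j) v) b = 0"
      proof (cases "b \<in> B \<and> lev b = j")
        case True
        then have "b \<in> set (bs j)" using bs(2) by simp
        then obtain m where "m < length (bs j)" "b = bs j ! m" by (metis in_set_conv_nth)
        then show ?thesis using * by simp
      qed (simp add: D_out)
    qed
    then have "matapp B D (up (Suc j) v) = (\<lambda>_. 0) \<longleftrightarrow> (\<forall>m<length (bs j). matapp B D (up (Suc j) v) (bs j ! m) = 0)"
      by auto
    moreover have "mat_app (length (bs (Suc j))) (A (Suc j)) v = (\<lambda>_. 0) \<longleftrightarrow>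
        (\<forall>m<length (bs j). matapp B D (up (Suc j) v) (bs j ! m) = 0)"
      unfolding fun_eq_iff AS by simp
    ultimately show ?thesis unfolding Suc by (simp add: aug_out)
  qed
  \<comment> \<open>The inserted 0 keeps \<open>Max\<close> meaningful when the basis is
    empty.\<close>
  have "graded_free_res V I ds A (Max (insert 0 (lev ` B)))"
    unfolding graded_free_res_def len
  proof (intro conjI allI impI)
    show "ds i = []" if "i > Max (insert 0 (lev ` B))" for i
    proof -
      have "lev b \<noteq> i" if "b \<in> B" for b
        using that fin Max_ge[of "insert 0 (lev ` B)" "lev b"] \<open>i > _\<close> by auto
      then have "set (bs i) = {}" unfolding bs(2) by simp
      then show ?thesis by (simp add: ds_def)
    qed
    show "in_vars V (A i m l)" for i m l
      using e_in D_in by (cases i) (simp_all add: A_def)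
    show "hom_deg (A i m l) (ds i ! l - tgt_deg ds i m)" if "m < tgt_rank ds i \<and> l < length (bs i)" for i m l
    proof (cases i)
      case 0
      then show ?thesis using that e_hom[of "bs 0 ! l"]
        by (simp add: A_def ds_def tgt_deg_def tgt_rank_def)
    next
      case (Suc j)
      then show ?thesis using that D_hom[of "bs j ! m" "bs i ! l"]
        by (simp add: A_def ds_def tgt_deg_def tgt_rank_def)
    qed
    show "A i m l = 0" if "\<not> (m < tgt_rank ds i \<and> l < length (bs i))" for i m l
      using that by (cases i; cases "l < length (bs i)"; simp add: A_def tgt_rank_def ds_def)
    show "(\<lambda>v. mat_app (length (bs 0)) (A 0) v 0) ` free_mod V (length (bs 0)) = I"
    proof (intro equalityI subsetI)
      fix x assume "x \<in> (\<lambda>v. mat_app (length (bs 0)) (A 0) v 0) ` free_mod V (length (bs 0))"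
      then show "x \<in> I" using aug_in[OF up_fmod] by (auto simp: A0)
    next
      fix x assume "x \<in> I"
      then obtain w where w: "w \<in> fmod V B" "x = rowapp B e w" using img by blast
      let ?v = "\<lambda>l. if l < length (bs 0) then w (bs 0 ! l) else 0"
      have "rowapp B e w = (\<Sum>l<length (bs 0). e (bs 0 ! l) * w (bs 0 ! l))"
        unfolding rowapp_def
      proof (rule sum_level)
        fix b assume "lev b \<noteq> 0"
        then have "e b = 0" using e_lev[of b] by auto
        then show "e b * w b = 0" by simp
      qed
      also have "\<dots> = mat_app (length (bs 0)) (A 0) ?v 0"
        by (simp add: mat_app_def A_def)
      finally show "x \<in> (\<lambda>v. mat_app (length (bs 0)) (A 0) v 0) ` free_mod V (length (bs 0))"
        using w by (intro image_eqI[of _ _ ?v]) (auto simp: free_mod_def fmod_def)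
    qed
    show "{v \<in> free_mod V (length (bs i)). mat_app (length (bs i)) (A i) v = (\<lambda>_. 0)} =
         mat_app (length (bs (Suc i))) (A (Suc i)) ` free_mod V (length (bs (Suc i)))" for i
    proof (intro equalityI subsetI)
      fix v assume "v \<in> {v \<in> free_mod V (length (bs i)). mat_app (length (bs i)) (A i) v = (\<lambda>_. 0)}"
      then have v: "v \<in> free_mod V (length (bs i))" and "rowapp B e (up i v) = 0 \<and> matapp B D (up i v) = (\<lambda>_. 0)"
        by (auto simp: ker_iff)
      then obtain w where w: "w \<in> fmod V B" "up i v = matapp B D w"
        using exactE[OF up_fmod[OF v]] by blast
      let ?w = "\<lambda>l. if l < length (bs (Suc i)) then w (bs (Suc i) ! l) else 0"
      have "v m = mat_app (length (bs (Suc i))) (A (Suc i)) ?w m" for m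
      proof (cases "m < length (bs i)")
        case True
        have "v m = matapp B D w (bs i ! m)" using up_nth[OF True] w(2) by metis
        also have "\<dots> = (\<Sum>l<length (bs (Suc i)). D (bs i ! m) (bs (Suc i) ! l) * w (bs (Suc i) ! l))"
          unfolding rowapp_def matapp_def
        proof (rule sum_level)
          fix b assume "lev b \<noteq> Suc i"
          then have "D (bs i ! m) b = 0" using D_lev[of "bs i ! m" b] nth[OF True] by auto
          then show "D (bs i ! m) b * w b = 0" by simp
        qed
        also have "\<dots> = mat_app (length (bs (Suc i))) (A (Suc i)) ?w m"
          using True by (simp add: mat_app_def A_def)
        finally show ?thesis .
      next
        case False
        then show ?thesis using v by (simp add: AS free_mod_def)
      qed
      moreover have "?w \<in> free_mod V (length (bs (Suc i)))"
        using w(1) by (auto simp: fmod_def free_mod_def)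
      ultimately show "v \<in> mat_app (length (bs (Suc i))) (A (Suc i)) ` free_mod V (length (bs (Suc i)))"
        by (intro image_eqI[of _ _ ?w]) auto
    next
      fix v assume "v \<in> mat_app (length (bs (Suc i))) (A (Suc i)) ` free_mod V (length (bs (Suc i)))"
      then obtain w where w: "w \<in> free_mod V (length (bs (Suc i)))" "v = mat_app (length (bs (Suc i))) (A (Suc i)) w"
        by blast
      let ?u = "up (Suc i) w"
      have "up i v b = matapp B D ?u b" for b
      proof (cases "b \<in> B \<and> lev b = i")
        case True
        then have "b \<in> set (bs i)" using bs(2) by simp
        then obtain m where "m < length (bs i)" "b = bs i ! m" by (metis in_set_conv_nth)
        then show ?thesis using up_nth[of m i v] by (simp add: w(2) AS)
      next
        case False
        then show ?thesis using D_out[of b "Suc i" w] by (auto simp: up_def)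
      qed
      then have u: "up i v = matapp B D ?u" by (rule ext)
      have "mat_app (length (bs i)) (A i) v = (\<lambda>_. 0)"
        unfolding ker_iff u using aug_D[OF up_fmod[OF w(1)]] D_D[OF up_fmod[OF w(1)]] by simp
      moreover have "v \<in> free_mod V (length (bs i))"
        using D_fmod[OF up_fmod[OF w(1)]] by (auto simp: free_mod_def w(2) AS fmod_def)
      ultimately show "v \<in> {v \<in> free_mod V (length (bs i)). mat_app (length (bs i)) (A i) v = (\<lambda>_. 0)}"
        by simp
    qed
  qed
  moreover have "coeff (A i m l) 0 = 0" if "i \<ge> 1" for i m l
    using that minimal by (cases i) (auto simp: A_def)
  ultimately show ?thesis unfolding minimal_graded_free_res_def by blast
qed

section \<open>An obstruction to linear first syzygies\<close>

text \<open>Project the generators of \<open>I\<close> onto the monomials of type \<open>P\<close>. Below \<open>W\<close> the type is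
  constant on divisibility chains, so the projection \<open>\<Phi>\<close> kills all syzygies of degree less than
  \<open>|W|\<close>; but it does not kill the syzygy between a generator of type \<open>P\<close> and one of the other type
  whose least common multiple is the product of the variables in \<open>W\<close>.\<close>

lemma (in gres) no_type_separation:
  assumes I: "I = sq_ideal V F"
    and up: "\<And>A A'. A \<in> F \<Longrightarrow> A \<subseteq> A' \<Longrightarrow> A' \<in> F"
    and W: "finite W" "W \<subseteq> V"
    and bound: "\<And>b. b \<in> B \<Longrightarrow> lev b = 1 \<Longrightarrow> deg b < int (card W)"
    and P: "\<And>U U'. U \<in> F \<Longrightarrow> U \<subseteq> U' \<Longrightarrow> U' \<subset> W \<Longrightarrow> P U = P U'"
    and U0: "U0 \<in> F" "U0 \<subset> W" "P U0"
    and U1: "U1 \<in> F" "U1 \<subset> W"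
  shows "P U1"
proof (rule ccontr)
  assume notP: "\<not> P U1"
  define X where "X = ind ` {U. U \<subset> W \<and> U \<in> F \<and> P U}"
  define \<Phi> where "\<Phi> s = rowapp B (\<lambda>l. restr X (e l)) s" for s
  have fin_sub: "finite A" if "A \<subseteq> W" for A using W(1) that by (rule finite_subset[rotated])
  have ind_X: "ind U \<in> X \<longleftrightarrow> U \<in> F \<and> P U" if "U \<subset> W" for U
  proof -
    have "ind U \<in> X \<longleftrightarrow> (\<exists>U'. U' \<subset> W \<and> U' \<in> F \<and> P U' \<and> ind U = ind U')"
      by (auto simp: X_def)
    also have "\<dots> \<longleftrightarrow> U \<in> F \<and> P U"
      using that fin_sub ind_inj by (metis psubset_imp_subset)
    finally show ?thesis .
  qed
  have e_F: "coeff (e l) (ind U) = 0" if "U \<subseteq> W" "U \<notin> F" for l U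
  proof (cases "l \<in> B")
    case True
    then have "e l \<in> sq_ideal V F" using e_in_I I by simp
    then have "supp (ind U) \<in> F" if "ind U \<in> supp (e l)" using that by (simp add: sq_ideal_def)
    then show ?thesis using that fin_sub[OF that(1)] by (auto simp: in_keys_iff)
  next
    case False
    then have "e l = 0" using e_lev[of l] by auto
    then show ?thesis by simp
  qed
  \<comment> \<open>A divisor of \<open>ind A\<close> with support in \<open>F\<close> has the same
    type as \<open>A\<close>, and one with support outside \<open>F\<close> does not occur in
    \<open>e\<close>. So below \<open>W\<close> the projection keeps a coefficient entirely or kills
    it.\<close>
  have coeff_\<Phi>: "coeff (\<Phi> s) (ind A) = (if P A then coeff (rowapp B e s) (ind A) else 0)"
    if A: "A \<subset> W" for s A
  proof -
    have finA: "finite A" using fin_sub A by blast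
    have "coeff (restr X (e l) * s l) (ind A) = (if P A then coeff (e l * s l) (ind A) else 0)" for l
    proof -
      have "coeff (restr X (e l)) (ind U) = (if P A then coeff (e l) (ind U) else 0)" if "U \<in> Pow A" for U
      proof (cases "U \<in> F")
        case True
        then have "P U = P A" using P[of U A] that A by auto
        then show ?thesis using True ind_X[of U] that A by (auto simp: coeff_restr)
      next
        case False
        then show ?thesis using e_F[of U l] that A by (auto simp: coeff_restr)
      qed
      then show ?thesis unfolding coeff_times_ind[OF finA] by (auto intro: sum.cong sum.neutral)
    qed
    then show ?thesis by (simp add: \<Phi>_def rowapp_def lookup_sum)
  qed
  \<comment> \<open>Below \<open>W\<close> this holds because \<open>e\<close> vanishes on
    boundaries. At \<open>W\<close> itself a column of level one is too small in degree, and a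
    column of another level is invisible to \<open>e\<close>.\<close>
  have col: "coeff (\<Phi> (\<lambda>k. D k b)) (ind A) = 0" if "b \<in> B" "A \<subseteq> W" for b A
  proof (cases "A = W")
    case False
    then have "A \<subset> W" using that by auto
    then show ?thesis by (simp add: coeff_\<Phi> aug_col)
  next
    case True
    show ?thesis
    proof (cases "lev b = 1")
      case True
      have "hom_deg (restr X (e l) * D l b) (deg b)" for l
        using hom_deg_mult[OF hom_deg_restr[OF e_hom[of l], of X] D_hom[of l b]] by simp
      then have "hom_deg (\<Phi> (\<lambda>k. D k b)) (deg b)"
        unfolding \<Phi>_def rowapp_def by (intro hom_deg_sum)
      then show ?thesis
        using bound[OF that(1) True] W(1) \<open>A = W\<close> by (force simp: hom_deg_def in_keys_iff mdeg_ind)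
    next
      case False
      have "restr X (e l) * D l b = 0" for l
      proof (cases "e l = 0")
        case False
        then have "D l b = 0" using e_lev[OF False] D_lev[of l b] \<open>lev b \<noteq> 1\<close> by fastforce
        then show ?thesis by simp
      qed simp
      then have "\<Phi> (\<lambda>k. D k b) = 0" by (simp only: \<Phi>_def rowapp_def sum.neutral_const)
      then show ?thesis by simp
    qed
  qed
  have mono_I: "term_of (ind U) 1 \<in> I" if "U \<in> F" "U \<subset> W" for U
    using that W fin_sub[of U] by (auto simp: I sq_ideal_def in_vars_def)
  obtain g0 where g0: "g0 \<in> fmod V B" "matapp B D g0 = (\<lambda>_. 0)" "rowapp B e g0 = term_of (ind U0) 1"
    using img_cycleE[OF mono_I[OF U0(1,2)]] by blast
  obtain g1 where g1: "g1 \<in> fmod V B" "matapp B D g1 = (\<lambda>_. 0)" "rowapp B e g1 = term_of (ind U1) 1"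
    using img_cycleE[OF mono_I[OF U1(1,2)]] by blast
  define c0 where "c0 = term_of (ind (W - U0)) (1 :: 'k)"
  define c1 where "c1 = term_of (ind (W - U1)) (1 :: 'k)"
  \<comment> \<open>The syzygy that brings both monomials to the common multiple
    \<open>ind W\<close>. It is a boundary, hence a combination of columns of
    \<open>D\<close>.\<close>
  define s where "s = (\<lambda>b. c0 * g0 b - c1 * g1 b)"
  have W_eq: "ind (W - U) + ind U = ind W" if "U \<subset> W" for U
    using ind_diff[OF W(1), of U] that by (simp add: add.commute)
  have shift: "coeff (term_of (ind (W - U)) 1 * p) (ind W) = coeff p (ind U)"
    if "U \<subset> W" for U and p :: "'k mpoly"
    using coeff_times_term[of "ind (W - U)" 1 p "ind U"] W_eq[OF that] by simp
  have "in_vars V c0" "in_vars V c1"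
    using W by (auto simp: c0_def c1_def intro!: in_vars_termI)
  then have "s \<in> fmod V B" unfolding s_def by (intro fmod_diff fmod_scale g0 g1)
  moreover have "rowapp B e s = 0"
    unfolding s_def c0_def c1_def rowapp_diff rowapp_scale g0 g1 mult_single
    using U0 U1 by (simp add: W_eq)
  moreover have "matapp B D s = (\<lambda>_. 0)"
    unfolding s_def matapp_diff matapp_scale g0 g1 by simp
  ultimately obtain w where w: "s = matapp B D w" using exactE by metis
  have "\<Phi> s = (\<Sum>b\<in>B. \<Phi> (\<lambda>k. D k b) * w b)"
    unfolding w \<Phi>_def rowapp_matapp by (simp add: rowapp_def)
  then have "coeff (\<Phi> s) (ind W) = (\<Sum>b\<in>B. \<Sum>A\<in>Pow W. coeff (\<Phi> (\<lambda>k. D k b)) (ind A) * coeff (w b) (ind (W - A)))"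
    by (simp add: lookup_sum coeff_times_ind[OF W(1)])
  also have "\<dots> = 0" using col by (intro sum.neutral) auto
  finally have "coeff (\<Phi> s) (ind W) = 0" .
  \<comment> \<open>Read off from the two generators instead, the same coefficient is 1 - 0.\<close>
  moreover have "coeff (\<Phi> s) (ind W) = coeff (\<Phi> g0) (ind U0) - coeff (\<Phi> g1) (ind U1)"
    unfolding s_def \<Phi>_def rowapp_diff rowapp_scale lookup_minus c0_def c1_def
    by (simp only: shift[OF U0(2)] shift[OF U1(2)])
  moreover have "coeff (\<Phi> g0) (ind U0) = 1" using U0 by (simp add: coeff_\<Phi> g0)
  moreover have "coeff (\<Phi> g1) (ind U1) = 0" using U1 notP by (simp add: coeff_\<Phi>)
  ultimately show False by simp
qed

section \<open>Matchings in forests\<close>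

text \<open>The family that turns \<open>sq_ideal\<close> into the squarefree power, as
  \<open>sq_power_ideal_eq\<close> shows.\<close>

definition match_family :: "nat set set \<Rightarrow> nat \<Rightarrow> nat set set" where
  "match_family E k = up_family {\<Union>M | M. matching E M \<and> card M = k}"

definition splits :: "nat set set \<Rightarrow> nat \<Rightarrow> bool" where
  "splits E k \<longleftrightarrow> (\<exists>M N. M \<noteq> {} \<and> N \<noteq> {} \<and> M \<inter> N = {} \<and> matching E (M \<union> N) \<and>
     card (M \<union> N) = Suc k \<and> (\<forall>e\<in>M. \<forall>f\<in>N. gap E e f))"

definition del :: "nat set \<Rightarrow> nat set set \<Rightarrow> nat set set" where
  "del X E = {e \<in> E. e \<inter> X = {}}"

lemma match_family_iff: "A \<in> match_family E k \<longleftrightarrow> (\<exists>M. matching E M \<and> card M = k \<and> \<Union>M \<subseteq> A)"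
  by (auto simp: match_family_def up_family_def)

lemma match_family_0: "match_family E 0 = UNIV"
proof -
  have "A \<in> match_family E 0" for A
    unfolding match_family_iff by (rule exI[of _ "{}"]) (simp add: matching_def)
  then show ?thesis by auto
qed

lemma match_family_empty: "k > 0 \<Longrightarrow> match_family {} k = {}"
  by (auto simp: match_family_iff matching_def)

lemma match_family_indep: "x \<notin> \<Union>E \<Longrightarrow> insert x A \<in> match_family E k \<longleftrightarrow> A \<in> match_family E k"
proof
  assume x: "x \<notin> \<Union>E" and "insert x A \<in> match_family E k"
  then obtain M where M: "matching E M" "card M = k" "\<Union>M \<subseteq> insert x A" by (auto simp: match_family_iff)
  then have "x \<notin> \<Union>M" using x by (auto simp: matching_def)
  then show "A \<in> match_family E k" using M unfolding match_family_iff by blast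
next
  assume "A \<in> match_family E k"
  then show "insert x A \<in> match_family E k" by (auto simp: match_family_def up_family_def)
qed

lemma match_family_up: "A \<in> match_family E k \<Longrightarrow> A \<subseteq> A' \<Longrightarrow> A' \<in> match_family E k"
  by (auto simp: match_family_def up_family_def)

lemma matching_subset: "matching E M \<Longrightarrow> N \<subseteq> M \<Longrightarrow> matching E N"
  unfolding matching_def by (meson subsetD subset_trans)

lemma matching_disjoint: "matching E M \<Longrightarrow> e \<in> M \<Longrightarrow> f \<in> M \<Longrightarrow> e \<noteq> f \<Longrightarrow> e \<inter> f = {}"
  by (simp add: matching_def)

lemma matching_del_iff: "matching (del X E) M \<longleftrightarrow> matching E M \<and> \<Union>M \<inter> X = {}"
  by (auto simp: matching_def del_def)

lemma del_del: "del X (del Y E) = del (X \<union> Y) E"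
  by (auto simp: del_def)

lemma del_subset: "del X E \<subseteq> E"
  by (auto simp: del_def)

lemma matching_remove:
  assumes "matching E M" "e \<in> M" 
  shows "matching (del e E) (M - {e})"
  unfolding matching_del_iff
proof
  show "matching E (M - {e})" using assms(1) by (rule matching_subset) auto
  show "\<Union>(M - {e}) \<inter> e = {}" using matching_disjoint[OF assms(1) _ assms(2)] by auto
qed

lemma matching_insert:
  assumes "matching E M" "e \<in> E" "\<Union>M \<inter> e = {}"
  shows "matching E (insert e M)"
proof -
  have "f \<inter> e = {}" if "f \<in> M" for f using that assms(3) by auto
  then show ?thesis using assms(1,2) by (simp add: matching_def Int_commute)
qed

lemma forest_subset: "forest E \<Longrightarrow> E' \<subseteq> E \<Longrightarrow> forest E'"
  unfolding forest_def is_cycle_def by blast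

lemma gap_del: "gap (del X E) e f \<Longrightarrow> e \<inter> X = {} \<Longrightarrow> f \<inter> X = {} \<Longrightarrow> gap E e f"
  unfolding gap_def del_def by blast

lemma splitsE:
  assumes "splits E k"
  obtains M N where "M \<noteq> {}" "N \<noteq> {}" "M \<inter> N = {}" "matching E (M \<union> N)" "card (M \<union> N) = Suc k"
    "\<forall>e\<in>M. \<forall>f\<in>N. gap E e f"
  using assms unfolding splits_def by (elim exE conjE) (rule that)

lemma splitsI:
  assumes "M \<noteq> {}" "N \<noteq> {}" "M \<inter> N = {}" "matching E (M \<union> N)" "card (M \<union> N) = Suc k"
    "\<And>e f. e \<in> M \<Longrightarrow> f \<in> N \<Longrightarrow> gap E e f"
  shows "splits E k"
  unfolding splits_def using assms by (intro exI[of _ M] exI[of _ N]) simp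

text \<open>Edges joining two vertices outside \<open>X\<close> survive the deletion, so gaps
  between edges of \<open>del X E\<close> are gaps in \<open>E\<close>. Non-splitting for fixed k
  thus passes to vertex deletions.\<close>

lemma splits_del:
  assumes "splits (del X E) k"
  shows "splits E k"
proof -
  obtain M N where MN: "M \<noteq> {}" "N \<noteq> {}" "M \<inter> N = {}" "matching (del X E) (M \<union> N)"
    "card (M \<union> N) = Suc k" "\<forall>e\<in>M. \<forall>f\<in>N. gap (del X E) e f"
    using assms by (rule splitsE)
  show ?thesis
  proof (rule splitsI[of M N])
    have "\<Union>(M \<union> N) \<inter> X = {}" using MN(4) unfolding matching_del_iff by (rule conjunct2)
    then have disj: "e \<inter> X = {}" if "e \<in> M \<union> N" for e using that by blast
    show "gap E e f" if "e \<in> M" "f \<in> N" for e f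
    proof (rule gap_del)
      show "gap (del X E) e f" using MN(6) that by simp
      show "e \<inter> X = {}" "f \<inter> X = {}" using that by (simp_all add: disj)
    qed
    show "matching E (M \<union> N)" using MN(4) unfolding matching_del_iff by (rule conjunct1)
  qed (fact MN(1) MN(2) MN(3) MN(5))+
qed

text \<open>The vertices \<open>x\<close>, \<open>y\<close>, \<open>z\<close> are the first three vertices of a longest path.\<close>

lemma forest_leaf:
  assumes "finite E" "E \<noteq> {}" and card2: "\<And>e. e \<in> E \<Longrightarrow> card e = 2" and "forest E"
  obtains x y z where "{x, y} \<in> E" "x \<noteq> z"
    "\<And>u w. {u, y} \<in> E \<Longrightarrow> u \<noteq> z \<Longrightarrow> {u, w} \<in> E \<Longrightarrow> w = y"
proof -
  define path where "path vs \<longleftrightarrow> distinct vs \<and> length vs \<ge> 2 \<and> (\<forall>i. Suc i < length vs \<longrightarrow> {vs ! i, vs ! Suc i} \<in> E)"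
    for vs
  have noloop: "{a, a} \<notin> E" for a using card2[of "{a, a}"] by auto
  have finU: "finite (\<Union>E)"
    using assms(1) card2 by (metis card.infinite finite_Union zero_neq_numeral)
  have path_set: "set vs \<subseteq> \<Union>E" if "path vs" for vs
  proof
    fix v assume "v \<in> set vs"
    then obtain i where i: "i < length vs" "v = vs ! i" by (metis in_set_conv_nth)
    show "v \<in> \<Union>E"
    proof (cases "Suc i < length vs")
      case True
      then have "{vs ! i, vs ! Suc i} \<in> E" using that by (simp add: path_def)
      then show ?thesis using i by blast
    next
      case False
      then have "Suc (i - 1) = i" using i that by (auto simp: path_def)
      then have "{vs ! (i - 1), vs ! i} \<in> E" using that i unfolding path_def by metis
      then show ?thesis using i by blast
    qed
  qed
  have bounded: "length vs \<le> card (\<Union>E)" if "path vs" for vs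
    using path_set[OF that] that finU by (metis card_mono distinct_card path_def)
  obtain e where "e \<in> E" using assms(2) by blast
  then obtain a b where "{a, b} \<in> E" "a \<noteq> b" using card2 by (metis card_2_iff)
  then have "path [a, b]" by (auto simp: path_def less_Suc_eq)
  then obtain vs where vs: "path vs" and max: "\<And>ws. path ws \<Longrightarrow> length ws \<le> length vs"
    using ex_has_greatest_nat[of path "[a, b]" length "Suc (card (\<Union>E))"] bounded
    by (auto simp: less_Suc_eq_le)
  \<comment> \<open>An edge from the first vertex of a path to its third or a later vertex would
    close a cycle.\<close>
  have no_chord: "False"
    if ws: "distinct ws" "\<And>i. Suc i < length ws \<Longrightarrow> {ws ! i, ws ! Suc i} \<in> E"
      and j: "2 \<le> j" "j < length ws" "{ws ! 0, ws ! j} \<in> E" for ws j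
  proof -
    have "is_cycle E (take (Suc j) ws)"
      unfolding is_cycle_def
    proof (intro conjI allI impI)
      show "length (take (Suc j) ws) \<ge> 3" using j by simp
      show "distinct (take (Suc j) ws)" using ws(1) by simp
      fix i assume "i < length (take (Suc j) ws)"
      then have i: "i < Suc j" by simp
      have len: "length (take (Suc j) ws) = Suc j" using j by simp
      show "{take (Suc j) ws ! i, take (Suc j) ws ! ((i + 1) mod length (take (Suc j) ws))} \<in> E"
      proof (cases "i = j")
        case True
        then show ?thesis using j unfolding len by (simp add: insert_commute)
      next
        case False
        then show ?thesis using ws(2)[of i] i j unfolding len by simp
      qed
    qed
    then show False using \<open>forest E\<close> by (auto simp: forest_def)
  qed
  \<comment> \<open>A neighbour of the first vertex outside the path would prolong it, and one on
    the path must be the second vertex. All paths of maximal length are covered, because variants of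
    \<open>vs\<close> will be used as well.\<close>
  have head: "w = ws ! 1" if ws: "path ws" "length ws = length vs" and w: "{ws ! 0, w} \<in> E" for ws w
  proof (cases "w \<in> set ws")
    case True
    then obtain j where j: "j < length ws" "w = ws ! j" by (metis in_set_conv_nth)
    have "\<not> 2 \<le> j" using no_chord[of ws j] ws(1) j w by (auto simp: path_def)
    moreover have "j \<noteq> 0" using w j noloop by metis
    ultimately have "j = 1" by linarith
    then show ?thesis using j by simp
  next
    case False
    have "path (w # ws)"
      unfolding path_def
    proof (intro conjI allI impI)
      show "distinct (w # ws)" "length (w # ws) \<ge> 2" using False ws by (auto simp: path_def)
      fix i assume "Suc i < length (w # ws)"
      then show "{(w # ws) ! i, (w # ws) ! Suc i} \<in> E"
        using w ws(1) by (cases i) (auto simp: path_def insert_commute)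
    qed
    then show ?thesis using max[of "w # ws"] ws(2) by simp
  qed
  obtain x y rest where vs_eq: "vs = x # y # rest"
    using vs by (metis One_nat_def Suc_1 Suc_le_length_iff path_def)
  have xy: "{x, y} \<in> E" using vs unfolding path_def vs_eq by force
  \<comment> \<open>A path of two vertices has no third one. The default \<open>y\<close> is
    harmless: no neighbour of \<open>y\<close> equals \<open>y\<close>, so nothing is
    excluded.\<close>
  define z where "z = (if rest = [] then y else hd rest)"
  have "x \<noteq> z" using vs unfolding path_def vs_eq z_def by (auto simp: neq_Nil_conv)
  moreover have "w = y" if u: "{u, y} \<in> E" "u \<noteq> z" and w: "{u, w} \<in> E" for u w
  proof -
    have "u \<notin> set (y # rest)"
    proof
      assume "u \<in> set (y # rest)"
      then obtain j where j: "j < length (y # rest)" "u = (y # rest) ! j" by (metis in_set_conv_nth)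
      have "j \<noteq> 0" using u j noloop by (metis nth_Cons_0)
      moreover have "j \<noteq> 1" using u(2) j by (auto simp: z_def hd_conv_nth)
      ultimately have "2 \<le> j" by linarith
      moreover have "{(y # rest) ! i, (y # rest) ! Suc i} \<in> E" if "Suc i < length (y # rest)" for i
      proof -
        have "{vs ! Suc i, vs ! Suc (Suc i)} \<in> E" using vs that unfolding path_def vs_eq by auto
        then show ?thesis by (simp add: vs_eq)
      qed
      ultimately show False
        using no_chord[of "y # rest" j] vs j u(1) by (auto simp: path_def vs_eq insert_commute)
    qed
    \<comment> \<open>Replacing the first vertex by \<open>u\<close> gives a path of the same
      length, so \<open>head\<close> applies to \<open>u\<close>.\<close>
    then have "path (u # y # rest)"
      using vs u(1) unfolding path_def vs_eq by (auto simp: nth_Cons split: nat.splits)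
    from head[OF this] w show ?thesis by (simp add: vs_eq)
  qed
  ultimately show ?thesis using that xy by blast
qed

lemma edgeE:
  assumes "card e = 2" "x \<in> e"
  obtains v where "e = {x, v}" "v \<noteq> x"
proof -
  obtain a b where "e = {a, b}" "a \<noteq> b" using assms(1) by (metis card_2_iff)
  then show ?thesis using that[of b] that[of a] assms(2) by (cases "x = a") auto
qed

text \<open>Induction over a leaf \<open>x\<close> with neighbour \<open>y\<close>, all of whose neighbours except \<open>z\<close> are leaves.
  With \<open>H = G - x - y\<close> we have \<open>I\<^sub>k(G) = I\<^sub>k(G - x) + xy I\<^sub>k\<^sub>-\<^sub>1(H)\<close>; if every \<open>(k+1)\<close>-matching
  induces a connected subgraph, the intersection of the two summands is
  \<open>xy \<Sum>\<^sub>w w I\<^sub>k\<^sub>-\<^sub>1(H - w)\<close> with \<open>w\<close> ranging over the neighbours of \<open>y\<close> other than \<open>x\<close>.\<close>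

lemma forest_linear_res:
  assumes "finite V" "\<And>e. e \<in> E \<Longrightarrow> card e = 2 \<and> e \<subseteq> V" "forest E" "\<not> splits E k"
  shows "has_res V (sq_ideal V (match_family E k) :: 'k::field mpoly set) (2 * int k)"
  using assms(2-4)
proof (induction "card E" arbitrary: E k rule: less_induct)
  case less
  note E = less.prems(1)
  have finE: "finite E"
    by (rule finite_subset[of _ "Pow V"]) (use E assms(1) in auto)
  show ?case
  proof (cases k)
    case 0
    then show ?thesis using has_res_unit by (simp add: match_family_0 sq_ideal_UNIV)
  next
    case (Suc k')
    show ?thesis
    proof (cases "E = {}")
      case True
      then show ?thesis using has_res_zero by (simp add: match_family_empty sq_ideal_empty Suc)
    next
      case False
      obtain x y z where xy: "{x, y} \<in> E" and "x \<noteq> z"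
        and leaf: "\<And>u w. {u, y} \<in> E \<Longrightarrow> u \<noteq> z \<Longrightarrow> {u, w} \<in> E \<Longrightarrow> w = y"
        using forest_leaf[OF finE False _ less.prems(2)] E by (metis (no_types, lifting))
      have noloop: "{a, a} \<notin> E" for a using E[of "{a, a}"] by auto
      have leaf_x: "w = y" if "{x, w} \<in> E" for w using leaf[OF xy \<open>x \<noteq> z\<close> that] .
      have x_edge: "e = {x, y}" if e: "e \<in> E" "x \<in> e" for e
      proof -
        obtain v where "e = {x, v}" using E[OF e(1)] e(2) by (blast elim: edgeE)
        then show ?thesis using leaf_x e(1) by simp
      qed
      have xny: "x \<noteq> y" using xy noloop by metis
      have inV: "x \<in> V" "y \<in> V" using E[OF xy] by auto
      define H where "H = del {x, y} E"
      define N where "N = {w. {w, y} \<in> E \<and> w \<noteq> x}"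
      have smaller: "card (del X E) < card E" if "X \<inter> {x, y} \<noteq> {}" for X
      proof (rule psubset_card_mono[OF finE])
        have "{x, y} \<notin> del X E" using that by (auto simp: del_def)
        then show "del X E \<subset> E" using xy del_subset[of X E] by auto
      qed
      have IH: "has_res V (sq_ideal V (match_family (del X E) j) :: 'k mpoly set) (2 * int j)"
        if "X \<inter> {x, y} \<noteq> {}" "\<not> splits (del X E) j" for X j
      proof (rule less.hyps[OF smaller[OF that(1)] _ _ that(2)])
        show "card e = 2 \<and> e \<subseteq> V" if "e \<in> del X E" for e
        proof -
          have "e \<in> E" using that by (simp add: del_def)
          then show ?thesis by (rule E)
        qed
        show "forest (del X E)" using less.prems(2) del_subset by (rule forest_subset)
      qed
      have y_nbr: "\<exists>w\<in>f. {w, y} \<in> E" if h: "e \<subseteq> {x, y}" "\<not> gap E e f" "e \<inter> f = {}" "x \<notin> f" "y \<notin> f" for e f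
      proof -
        obtain a b where ab: "a \<in> e" "b \<in> f" "{a, b} \<in> E" using h(2,3) unfolding gap_def by blast
        have "a \<noteq> x"
        proof
          assume "a = x"
          then have "b = y" using ab(3) leaf_x[of b] by simp
          then show False using ab(2) h(5) by simp
        qed
        then have "a = y" using ab(1) h(1) by blast
        then have "{b, y} \<in> E" using ab(3) by (simp add: insert_commute)
        then show ?thesis using ab(2) by blast
      qed
      \<comment> \<open>A splitting of \<open>H\<close> becomes one of \<open>E\<close> by adding
        \<open>{x, y}\<close> to a suitable part. An edge of \<open>H\<close> without a gap to
        \<open>{x, y}\<close> must contain \<open>z\<close>, since the other neighbours of
        \<open>y\<close> are leaves, and at most one part covers \<open>z\<close>.\<close>
      have splits_H: "\<not> splits H k'"
      proof
        assume "splits H k'"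
        then obtain M1 M2 where M: "M1 \<noteq> {}" "M2 \<noteq> {}" "M1 \<inter> M2 = {}" "matching H (M1 \<union> M2)"
          "card (M1 \<union> M2) = Suc k'" "\<forall>e\<in>M1. \<forall>f\<in>M2. gap H e f" by (rule splitsE)
        have mE: "matching E (M1 \<union> M2)" and dis: "\<Union>(M1 \<union> M2) \<inter> {x, y} = {}"
          using M(4) by (simp_all only: H_def matching_del_iff)
        have disj: "f \<inter> {x, y} = {}" if "f \<in> M1 \<union> M2" for f using dis that by blast
        then have notxy: "x \<notin> f" "y \<notin> f" if "f \<in> M1 \<union> M2" for f using that by auto
        have gapE: "gap E e f" if "e \<in> M1" "f \<in> M2" for e f
        proof (rule gap_del)
          show "gap (del {x, y} E) e f" using M(6) that by (simp add: H_def)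
          show "e \<inter> {x, y} = {}" "f \<inter> {x, y} = {}" using that by (simp_all add: disj)
        qed
        have xy_notin: "{x, y} \<notin> M1 \<union> M2" using notxy by blast
        have mm: "matching E (insert {x, y} (M1 \<union> M2))" using mE xy dis by (rule matching_insert)
        have fin12: "finite (M1 \<union> M2)" using M(5) by (metis card.infinite nat.distinct(1))
        have cc: "card (insert {x, y} (M1 \<union> M2)) = Suc k" using M(5) fin12 xy_notin Suc by simp
        have gap_sym: "gap E e f" if "gap E f e" for e f
          using that unfolding gap_def by (metis Int_commute insert_commute)
        have gap_xy: "gap E {x, y} f" if f: "f \<in> M1 \<union> M2" "z \<notin> f" for f
        proof (rule ccontr)
          assume ng: "\<not> gap E {x, y} f"
          then obtain w where w: "w \<in> f" "{w, y} \<in> E"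
            using y_nbr[of "{x, y}" f] notxy[OF f(1)] by auto
          have fE: "f \<in> E" using mE f(1) by (auto simp: matching_def)
          obtain v where "f = {w, v}" using E[OF fE] w(1) by (blast elim: edgeE)
          then have "v = y" using leaf[OF w(2)] fE w(1) f(2) by blast
          then show False using notxy[OF f(1)] \<open>f = {w, v}\<close> by simp
        qed
        have disz: "z \<notin> \<Union>M1 \<or> z \<notin> \<Union>M2"
        proof (rule ccontr)
          assume "\<not> ?thesis"
          then obtain e f where "e \<in> M1" "f \<in> M2" "z \<in> e" "z \<in> f" by blast
          then show False using gapE unfolding gap_def by blast
        qed
        have "splits E k"
        proof (cases "z \<in> \<Union>M1")
          case True
          then have z2: "z \<notin> f" if "f \<in> M2" for f using disz that by blast
          show ?thesis
          proof (rule splitsI[of "insert {x, y} M1" M2])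
            show "insert {x, y} M1 \<inter> M2 = {}" using M(3) xy_notin by blast
            show "gap E e f" if "e \<in> insert {x, y} M1" "f \<in> M2" for e f
              using that gapE gap_xy z2 by blast
          qed (use M(2) mm cc in auto)
        next
          case False
          show ?thesis
          proof (rule splitsI[of M1 "insert {x, y} M2"])
            show "M1 \<inter> insert {x, y} M2 = {}" using M(3) xy_notin by blast
            show "gap E e f" if "e \<in> M1" "f \<in> insert {x, y} M2" for e f
            proof (cases "f = {x, y}")
              case True
              have "gap E {x, y} e" using gap_xy[of e] that False by blast
              then show ?thesis using True gap_sym by blast
            next
              case False
              then show ?thesis using that gapE by blast
            qed
          qed (use M(1) mm cc in auto)
        qed
        then show False using less.prems(3) by blast
      qed
      have H_notin: "x \<notin> \<Union>H" "y \<notin> \<Union>H" by (auto simp: H_def del_def)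
      have delH: "del X H = del (X \<union> {x, y}) E" for X by (simp add: H_def del_del)
      have res_H: "has_res V (sq_ideal V (match_family H k') :: 'k mpoly set) (2 * int k')"
        unfolding H_def using splits_H by (intro IH) (auto simp: H_def)
      have sub_H: "match_family (del X H) j \<subseteq> match_family H j" for X j
        by (auto simp: match_family_iff matching_del_iff)
      \<comment> \<open>\<open>z\<close> need not be a neighbour of \<open>y\<close>; the conjunct
        \<open>z \<in> N\<close> makes \<open>Jz\<close> empty in that case.\<close>
      define Jz where "Jz = {A \<in> match_family (del {z} H) k'. z \<in> N \<and> z \<in> A}"
      \<comment> \<open>The neighbours in \<open>S\<close> will be leaves, so their summands use
        \<open>H\<close> itself. They are added one at a time.\<close>
      define JS where "JS S = Jz \<union> {A \<in> match_family H k'. \<exists>w\<in>S. w \<in> A}" for S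
      have res_Jz: "has_res V (sq_ideal V Jz :: 'k mpoly set) (2 * int k' + 1)"
      proof (cases "z \<in> N")
        case True
        have "\<not> splits (del {z} H) k'" using splits_H splits_del by blast
        then have "has_res V (sq_ideal V (match_family (del {z} H) k') :: 'k mpoly set) (2 * int k')"
          unfolding delH by (intro IH) auto
        moreover have "z \<in> V" using True E by (auto simp: N_def)
        moreover have "insert z A \<in> match_family (del {z} H) k' \<longleftrightarrow> A \<in> match_family (del {z} H) k'" for A
          by (rule match_family_indep) (auto simp: del_def)
        ultimately show ?thesis using True unfolding Jz_def
          by (simp only: simp_thms) (rule has_res_insert_var)
      next
        case False
        then have "Jz = {}" by (simp add: Jz_def)
        then show ?thesis using has_res_zero by (simp add: sq_ideal_empty)
      qed
      have leaf_H: "w \<notin> \<Union>H" if "w \<in> N" "w \<noteq> z" for w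
      proof
        assume "w \<in> \<Union>H"
        then obtain e where e: "e \<in> H" "w \<in> e" by blast
        then have eE: "e \<in> E" "y \<notin> e" by (auto simp: H_def del_def)
        obtain v where v: "e = {w, v}" using E[OF eE(1)] e(2) by (blast elim: edgeE)
        have "v = y" using leaf[of w v] that v eE(1) by (auto simp: N_def)
        then show False using v eE(2) by simp
      qed
      have res_JS: "has_res V (sq_ideal V (JS S) :: 'k mpoly set) (2 * int k' + 1)"
        if "finite S" "S \<subseteq> N - {z}" for S
        using that
      proof (induction S rule: finite_induct)
        case empty
        then show ?case using res_Jz by (simp add: JS_def)
      next
        case (insert w S)
        have w: "w \<in> N" "w \<noteq> z" "w \<notin> S" using insert by auto
        have wV: "w \<in> V" using w E by (auto simp: N_def)
        have indep_H: "insert w A \<in> match_family H k' \<longleftrightarrow> A \<in> match_family H k'" for A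
          using leaf_H[OF w(1,2)] by (rule match_family_indep)
        have "w \<notin> \<Union>(del {z} H)" using leaf_H[OF w(1,2)] by (auto simp: del_def)
        then have indep_z: "insert w A \<in> match_family (del {z} H) k' \<longleftrightarrow> A \<in> match_family (del {z} H) k'" for A
          by (rule match_family_indep)
        have indep: "insert w A \<in> JS S \<longleftrightarrow> A \<in> JS S" for A
          using w by (auto simp: JS_def Jz_def indep_H indep_z)
        have res_w: "has_res V (sq_ideal V {A \<in> match_family H k'. w \<in> A} :: 'k mpoly set) (2 * int k' + 1)"
          using res_H wV indep_H by (rule has_res_insert_var)
        have IHS: "has_res V (sq_ideal V (JS S) :: 'k mpoly set) (2 * int k' + 1)" using insert by simp
        have "has_res V (sq_ideal V {A \<in> JS S. w \<in> A} :: 'k mpoly set) (2 * int k' + 1 + 1)"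
          using IHS wV indep by (rule has_res_insert_var)
        \<comment> \<open>\<open>JS S\<close> lies within the family of \<open>H\<close>, so meeting
          it with the summand of \<open>w\<close> only adds the condition \<open>w \<in> A\<close>.
          This costs one degree, exactly what the cone allows.\<close>
        moreover have "{A \<in> JS S. w \<in> A} = JS S \<inter> {A \<in> match_family H k'. w \<in> A}"
          using sub_H[of "{z}" k'] by (auto simp: JS_def Jz_def)
        ultimately have "has_res V (sq_ideal V (JS S \<union> {A \<in> match_family H k'. w \<in> A}) :: 'k mpoly set) (2 * int k' + 1)"
          using IHS res_w by (intro has_res_Un) simp_all
        moreover have "JS S \<union> {A \<in> match_family H k'. w \<in> A} = JS (insert w S)"
          by (auto simp: JS_def)
        ultimately show ?case by simp
      qed
      define J where "J = JS (N - {z})"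
      have "finite N" using E assms(1) by (intro finite_subset[of N V]) (auto simp: N_def)
      then have res_J: "has_res V (sq_ideal V J :: 'k mpoly set) (2 * int k' + 1)"
        unfolding J_def by (intro res_JS) auto
      \<comment> \<open>Deleting a leaf \<open>w\<close> from \<open>H\<close> removes no edge, so
        the summands of the leaves and of \<open>z\<close> take the same shape.\<close>
      have J_iff: "A \<in> J \<longleftrightarrow> (\<exists>w\<in>N. w \<in> A \<and> A \<in> match_family (del {w} H) k')" for A
      proof -
        have "del {w} H = H" if "w \<in> N" "w \<noteq> z" for w
          using leaf_H[OF that] by (auto simp: del_def)
        then have "(\<exists>w\<in>N - {z}. w \<in> A \<and> A \<in> match_family H k') \<longleftrightarrow>
            (\<exists>w\<in>N - {z}. w \<in> A \<and> A \<in> match_family (del {w} H) k')" by simp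
        then have "A \<in> J \<longleftrightarrow> (z \<in> N \<and> z \<in> A \<and> A \<in> match_family (del {z} H) k') \<or>
            (\<exists>w\<in>N - {z}. w \<in> A \<and> A \<in> match_family (del {w} H) k')"
          unfolding J_def JS_def Jz_def by blast
        then show ?thesis by blast
      qed
      have xyN: "x \<notin> N" "y \<notin> N" using noloop by (auto simp: N_def)
      have indep_J: "insert v A \<in> J \<longleftrightarrow> A \<in> J" if v: "v \<in> {x, y}" for v A
      proof -
        have "v \<notin> N" using v xyN by blast
        moreover have "insert v A \<in> match_family (del {w} H) k' \<longleftrightarrow> A \<in> match_family (del {w} H) k'" for w
          using v H_notin by (intro match_family_indep) (auto simp: del_def)
        ultimately show ?thesis unfolding J_iff by auto
      qed
      let ?Q = "{A \<in> {A \<in> match_family H k'. x \<in> A}. y \<in> A}"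
      \<comment> \<open>With \<open>k = Suc k'\<close> this bound is 2k, and that of
        \<open>res_int\<close> is 2k + 1, as the final cone requires.\<close>
      have res_Q: "has_res V (sq_ideal V ?Q :: 'k mpoly set) (2 * int k' + 1 + 1)"
        using inV xny H_notin
        by (intro has_res_insert_var res_H) (auto simp: match_family_indep)
      have res_int: "has_res V (sq_ideal V {A \<in> {A \<in> J. x \<in> A}. y \<in> A} :: 'k mpoly set) (2 * int k' + 1 + 1 + 1)"
        using inV xny by (intro has_res_insert_var res_J) (auto simp: indep_J)
      have res_P: "has_res V (sq_ideal V (match_family (del {x} E) k) :: 'k mpoly set) (2 * int k)"
        using less.prems(3) splits_del by (intro IH) auto
      have Q_sub: "A \<in> match_family E k" if A: "A \<in> ?Q" for A
      proof -
        obtain M where M: "matching H M" "card M = k'" "\<Union>M \<subseteq> A" using A by (auto simp: match_family_iff)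
        have dis: "\<Union>M \<inter> {x, y} = {}" and mE: "matching E M" using M(1) by (auto simp: H_def matching_del_iff)
        have "finite M" using finE mE by (auto simp: matching_def intro: finite_subset)
        moreover have "{x, y} \<notin> M" using dis by blast
        ultimately have "card (insert {x, y} M) = k" using M(2) Suc by simp
        moreover have "matching E (insert {x, y} M)" using mE xy dis by (rule matching_insert)
        moreover have "\<Union>(insert {x, y} M) \<subseteq> A" using M(3) A by blast
        ultimately show ?thesis unfolding match_family_iff by blast
      qed
      have fam_eq: "match_family E k = match_family (del {x} E) k \<union> ?Q"
      proof (intro equalityI subsetI)
        fix A assume "A \<in> match_family E k"
        then obtain M where M: "matching E M" "card M = k" "\<Union>M \<subseteq> A" by (auto simp: match_family_iff)
        show "A \<in> match_family (del {x} E) k \<union> ?Q"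
        proof (cases "x \<in> \<Union>M")
          case False
          then have "matching (del {x} E) M" using M(1) by (simp add: matching_del_iff)
          then have "A \<in> match_family (del {x} E) k" using M unfolding match_family_iff by blast
          then show ?thesis by blast
        next
          case True
          then obtain e where "e \<in> M" "x \<in> e" by blast
          moreover have "M \<subseteq> E" using M(1) by (simp add: matching_def)
          ultimately have e: "{x, y} \<in> M" using x_edge by blast
          have "matching H (M - {{x, y}})" unfolding H_def using M(1) e by (rule matching_remove)
          moreover have "card (M - {{x, y}}) = k'" using M(2) e Suc by simp
          moreover have "\<Union>(M - {{x, y}}) \<subseteq> A" using M(3) by blast
          ultimately have "A \<in> match_family H k'" unfolding match_family_iff by blast
          moreover have "x \<in> A" "y \<in> A" using e M(3) by blast+
          ultimately show ?thesis by blast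
        qed
      next
        fix A assume "A \<in> match_family (del {x} E) k \<union> ?Q"
        moreover have "A \<in> match_family E k" if "A \<in> match_family (del {x} E) k"
          using that by (auto simp: match_family_iff matching_del_iff)
        ultimately show "A \<in> match_family E k" using Q_sub by blast
      qed
      have int_eq: "match_family (del {x} E) k \<inter> ?Q = {A \<in> {A \<in> J. x \<in> A}. y \<in> A}"
      proof (intro equalityI subsetI)
        fix A assume A: "A \<in> match_family (del {x} E) k \<inter> ?Q"
        then obtain M where M: "matching (del {x} E) M" "card M = k" "\<Union>M \<subseteq> A" by (auto simp: match_family_iff)
        have mE: "matching E M" and xM: "x \<notin> \<Union>M" using M(1) by (auto simp: matching_del_iff)
        have ME: "M \<subseteq> E" using mE by (simp add: matching_def)
        have finM: "finite M" using finE ME by (rule finite_subset[rotated])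
        \<comment> \<open>One edge of \<open>M\<close> is dropped and one of its vertices serves as
          \<open>w\<close>. If \<open>M\<close> covers \<open>y\<close>, it is the edge at
          \<open>y\<close>, with other end \<open>w\<close>. Otherwise \<open>{x, y}\<close> extends
          \<open>M\<close> to a matching of k + 1 edges; since \<open>E\<close> does not split, some
          edge of \<open>M\<close> has no gap to \<open>{x, y}\<close>, and it has a vertex
          \<open>w\<close> adjacent to \<open>y\<close>.\<close>
        have "A \<in> J"
        proof (cases "y \<in> \<Union>M")
          case True
          then obtain e where e: "e \<in> M" "y \<in> e" by blast
          obtain w where w: "e = {y, w}" using E[of e] e ME by (blast elim: edgeE)
          have wN: "w \<in> N" using w e ME xM by (auto simp: N_def insert_commute)
          have "matching (del e E) (M - {e})" using mE e(1) by (rule matching_remove)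
          then have "matching (del {w} H) (M - {e})"
            using xM unfolding delH w matching_del_iff by blast
          moreover have "card (M - {e}) = k'" using e M(2) Suc by simp
          moreover have "\<Union>(M - {e}) \<subseteq> A" using M(3) by blast
          ultimately have "A \<in> match_family (del {w} H) k'" unfolding match_family_iff by blast
          moreover have "w \<in> A" using w e M(3) by blast
          ultimately show ?thesis using wN unfolding J_iff by blast
        next
          case False
          have dis: "\<Union>M \<inter> {x, y} = {}" using False xM by blast
          have mm: "matching E ({{x, y}} \<union> M)" using matching_insert[OF mE xy dis] by simp
          have notin: "{x, y} \<notin> M" using xM by blast
          have "\<not> (\<forall>e\<in>{{x, y}}. \<forall>f\<in>M. gap E e f)"
          proof
            assume "\<forall>e\<in>{{x, y}}. \<forall>f\<in>M. gap E e f"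
            then have "splits E k"
              using mm notin M(2) finM Suc by (intro splitsI[of "{{x, y}}" M]) auto
            then show False using less.prems(3) by blast
          qed
          then obtain f where f: "f \<in> M" "\<not> gap E {x, y} f" by blast
          have "x \<notin> f" "y \<notin> f" using f(1) dis by blast+
          then obtain w where w: "w \<in> f" "{w, y} \<in> E" using y_nbr[of "{x, y}" f] f(2) by auto
          have wN: "w \<in> N" using w \<open>x \<notin> f\<close> by (auto simp: N_def)
          have "matching (del f E) (M - {f})" using mE f(1) by (rule matching_remove)
          then have "matching (del {w} H) (M - {f})"
            using dis w(1) unfolding delH matching_del_iff by blast
          moreover have "card (M - {f}) = k'" using f M(2) Suc by simp
          moreover have "\<Union>(M - {f}) \<subseteq> A" using M(3) by blast
          ultimately have "A \<in> match_family (del {w} H) k'" unfolding match_family_iff by blast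
          moreover have "w \<in> A" using w f M(3) by blast
          ultimately show ?thesis using wN unfolding J_iff by blast
        qed
        then show "A \<in> {A \<in> {A \<in> J. x \<in> A}. y \<in> A}" using A by blast
      next
        fix A assume A: "A \<in> {A \<in> {A \<in> J. x \<in> A}. y \<in> A}"
        then obtain w where w: "w \<in> N" "w \<in> A" "A \<in> match_family (del {w} H) k'" unfolding J_iff by blast
        then obtain M where M: "matching (del {w} H) M" "card M = k'" "\<Union>M \<subseteq> A" by (auto simp: match_family_iff)
        have mE: "matching E M" and dis: "\<Union>M \<inter> {w, x, y} = {}"
          using M(1) unfolding delH matching_del_iff by auto
        \<comment> \<open>The exchange in the other direction: the edge \<open>{w, y}\<close>
          completes \<open>M\<close> and avoids \<open>x\<close>.\<close>
        have wy: "{w, y} \<in> E" "w \<noteq> x" using w(1) by (auto simp: N_def)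
        have "\<Union>M \<inter> {w, y} = {}" using dis by blast
        then have m1: "matching E (insert {w, y} M)" by (rule matching_insert[OF mE wy(1)])
        have "finite M" using finE mE by (auto simp: matching_def intro: finite_subset)
        moreover have "{w, y} \<notin> M" using dis by blast
        ultimately have c1: "card (insert {w, y} M) = k" using M(2) Suc by simp
        have "\<Union>(insert {w, y} M) \<inter> {x} = {}" using dis wy(2) xny by blast
        then have "matching (del {x} E) (insert {w, y} M)" using m1 by (simp add: matching_del_iff)
        moreover have "\<Union>(insert {w, y} M) \<subseteq> A" using M(3) w(2) A by blast
        ultimately have "A \<in> match_family (del {x} E) k" using c1 unfolding match_family_iff by blast
        moreover have "A \<in> match_family H k'" using sub_H w(3) by blast
        ultimately show "A \<in> match_family (del {x} E) k \<inter> ?Q" using A by blast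
      qed
      show ?thesis
        unfolding fam_eq
      proof (rule has_res_Un)
        show "has_res V (sq_ideal V (match_family (del {x} E) k) :: 'k mpoly set) (2 * int k)" by (rule res_P)
        show "has_res V (sq_ideal V ?Q :: 'k mpoly set) (2 * int k)" using res_Q by (simp add: Suc)
        show "has_res V (sq_ideal V (match_family (del {x} E) k \<inter> ?Q) :: 'k mpoly set) (2 * int k + 1)"
          unfolding int_eq using res_int by (simp add: Suc)
      qed
    qed
  qed
qed

section \<open>Linear first syzygies exclude splittings\<close>

lemma card_Union_matching:
  assumes "matching E M" "\<And>e. e \<in> E \<Longrightarrow> card e = 2"
  shows "card (\<Union>M) = 2 * card M"
proof -
  have c2: "card e = 2" if "e \<in> M" for e using that assms by (auto simp: matching_def)
  have "card (\<Union>M) = sum card M"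
  proof (rule card_Union_disjoint)
    show "pairwise disjnt M" using assms(1) by (auto simp: pairwise_def disjnt_def matching_def)
    show "finite A" if "A \<in> M" for A using c2[OF that] by (metis card.infinite zero_neq_numeral)
  qed
  then show ?thesis using c2 by simp
qed

text \<open>The type of a set is whether it covers \<open>V2\<close>. Removing an edge of
  \<open>M\<close> from \<open>W\<close> gives the one type, removing an edge of \<open>N\<close>
  the other; by \<open>no_type_separation\<close> both cannot occur when the first syzygies are
  linear.\<close>

lemma linear_first_syzygies_imp_not_splits:
  assumes "gres V (sq_ideal V (match_family E k) :: 'k::field mpoly set) B lev deg e D"
    and E: "\<And>e. e \<in> E \<Longrightarrow> card e = 2 \<and> e \<subseteq> V"
    and bound: "\<And>b. b \<in> B \<Longrightarrow> lev b = 1 \<Longrightarrow> deg b \<le> 2 * int k + 1"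
  shows "\<not> splits E k"
proof
  interpret gres V "sq_ideal V (match_family E k) :: 'k mpoly set" B lev deg e D by fact
  assume "splits E k"
  then obtain M N where MN: "M \<noteq> {}" "N \<noteq> {}" "M \<inter> N = {}" "matching E (M \<union> N)"
    "card (M \<union> N) = Suc k" "\<forall>e\<in>M. \<forall>f\<in>N. gap E e f" by (rule splitsE)
  have fin: "finite M" "finite N" using MN(5) by (metis card.infinite finite_Un nat.distinct(1))+
  have mM: "matching E M" and mN: "matching E N" using matching_subset[OF MN(4)] by auto
  have ME: "M \<subseteq> E" and NE: "N \<subseteq> E" using mM mN by (simp_all add: matching_def)
  have card_MN: "card M + card N = Suc k" using MN(3,5) fin by (simp add: card_Un_disjoint)
  define V1 where "V1 = \<Union>M"
  define V2 where "V2 = \<Union>N"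
  have card_V: "card V1 = 2 * card M" "card V2 = 2 * card N"
    unfolding V1_def V2_def using E by (auto intro: card_Union_matching mM mN)
  have "finite e" if "e \<in> E" for e using E[OF that] by (metis card.infinite zero_neq_numeral)
  then have finV: "finite V1" "finite V2" unfolding V1_def V2_def using fin ME NE by auto
  have dis: "V1 \<inter> V2 = {}"
    unfolding V1_def V2_def using MN(6) unfolding gap_def by blast
  define W where "W = V1 \<union> V2"
  have card_W: "card W = 2 * k + 2"
    unfolding W_def using dis finV card_V card_MN by (simp add: card_Un_disjoint)
  \<comment> \<open>By the gaps, every edge of \<open>L\<close> lies in \<open>V1\<close> or in
    \<open>V2\<close>. Since \<open>L\<close> has just one edge fewer than \<open>M\<close> and
    \<open>N\<close> together, it fills one of the two sides completely.\<close>
  have fill: "V1 \<subseteq> U \<or> V2 \<subseteq> U" if U: "U \<in> match_family E k" "U \<subseteq> W" for U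
  proof -
    obtain L where L: "matching E L" "card L = k" "\<Union>L \<subseteq> U" using U(1) by (auto simp: match_family_iff)
    have LE: "L \<subseteq> E" using L(1) by (simp add: matching_def)
    have "L \<subseteq> Pow W" using L(3) U(2) by blast
    then have finL: "finite L" using finV by (metis W_def finite_Pow_iff finite_UnI finite_subset)
    have side: "e \<subseteq> V1 \<or> e \<subseteq> V2" if "e \<in> L" for e
    proof (rule ccontr)
      assume n: "\<not> ?thesis"
      have eE: "e \<in> E" and eW: "e \<subseteq> W" using that LE \<open>L \<subseteq> Pow W\<close> by auto
      obtain a where a: "a \<in> e" "a \<in> V1" using n eW by (auto simp: W_def)
      obtain b where b: "e = {a, b}" using E[OF eE] a(1) by (blast elim: edgeE)
      have "b \<in> V2" using n eW a(2) b by (auto simp: W_def)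
      then obtain e' f' where "e' \<in> M" "a \<in> e'" "f' \<in> N" "b \<in> f'" using a(2) by (auto simp: V1_def V2_def)
      then show False using MN(6) eE b unfolding gap_def by blast
    qed
    define L1 where "L1 = {e \<in> L. e \<subseteq> V1}"
    define L2 where "L2 = L - L1"
    have sub: "\<Union>L1 \<subseteq> V1" "\<Union>L2 \<subseteq> V2" using side by (auto simp: L1_def L2_def)
    have c1: "card (\<Union>L1) = 2 * card L1" and c2: "card (\<Union>L2) = 2 * card L2"
      using L(1) E by (auto simp: L1_def L2_def intro!: card_Union_matching[of E] elim: matching_subset)
    have "card L1 + card L2 = k"
      using finL L(2) unfolding L1_def L2_def
      by (metis (no_types, lifting) add.commute card_Diff_subset card_mono finite_subset le_add_diff_inverse2 mem_Collect_eq subsetI)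
    moreover have "card L1 \<le> card M" using card_mono[OF finV(1) sub(1)] c1 card_V by simp
    moreover have "card L2 \<le> card N" using card_mono[OF finV(2) sub(2)] c2 card_V by simp
    ultimately have "card L1 = card M \<or> card L2 = card N" using card_MN by linarith
    then have "\<Union>L1 = V1 \<or> \<Union>L2 = V2"
      using card_subset_eq[OF finV(1) sub(1)] card_subset_eq[OF finV(2) sub(2)] c1 c2 card_V by auto
    moreover have "\<Union>L1 \<subseteq> U" "\<Union>L2 \<subseteq> U" using L(3) by (auto simp: L1_def L2_def)
    ultimately show ?thesis by blast
  qed
  have punctured: "W - e \<in> match_family E k" "W - e \<subset> W" if e: "e \<in> M \<union> N" for e
  proof -
    have "matching (del e E) (M \<union> N - {e})" using MN(4) e by (rule matching_remove)
    then have m: "matching E (M \<union> N - {e})" and d: "\<Union>(M \<union> N - {e}) \<inter> e = {}" unfolding matching_del_iff by auto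
    have "card (M \<union> N - {e}) = k" using MN(5) e by simp
    moreover have "\<Union>(M \<union> N - {e}) \<subseteq> W - e" using d by (auto simp: W_def V1_def V2_def)
    ultimately show "W - e \<in> match_family E k" using m unfolding match_family_iff by blast
    have "e \<subseteq> W" using e by (auto simp: W_def V1_def V2_def)
    moreover have "e \<noteq> {}" using e E[of e] ME NE by auto
    ultimately show "W - e \<subset> W" by blast
  qed
  obtain e0 where e0: "e0 \<in> M" using MN(1) by blast
  obtain f0 where f0: "f0 \<in> N" using MN(2) by blast
  have "V2 \<subseteq> W - f0"
  proof (rule no_type_separation[of "match_family E k" W "\<lambda>U. V2 \<subseteq> U" "W - e0"])
    show "A' \<in> match_family E k" if "A \<in> match_family E k" "A \<subseteq> A'" for A A'
      using that by (rule match_family_up)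
    show "finite W" using finV by (simp add: W_def)
    show "W \<subseteq> V" using ME NE E by (auto simp: W_def V1_def V2_def)
    show "deg b < int (card W)" if "b \<in> B" "lev b = 1" for b
      using bound[OF that] card_W by simp
    \<comment> \<open>If \<open>U'\<close> covers \<open>V2\<close> and \<open>U\<close> does not,
      then \<open>U\<close> covers \<open>V1\<close>, and \<open>U'\<close> would be all of
      \<open>W\<close>.\<close>
    show "(V2 \<subseteq> U) = (V2 \<subseteq> U')" if "U \<in> match_family E k" "U \<subseteq> U'" "U' \<subset> W" for U U'
      using fill[of U] that by (auto simp: W_def)
    show "W - e0 \<in> match_family E k" "W - e0 \<subset> W" using punctured e0 by auto
    show "W - f0 \<in> match_family E k" "W - f0 \<subset> W" using punctured f0 by auto
    show "V2 \<subseteq> W - e0" using dis e0 by (auto simp: W_def V1_def)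
  qed simp
  moreover have "f0 \<noteq> {}" "f0 \<subseteq> V2" using f0 NE E[of f0] by (auto simp: V2_def)
  ultimately show False by blast
qed

section \<open>Admissible matchings and splittings\<close>

lemma card_matching_le: "finite E \<Longrightarrow> matching E M \<Longrightarrow> card M \<le> card E"
  by (auto simp: matching_def intro: card_mono)

lemma matching_of_card:
  assumes "finite E" "k \<le> mat E"
  obtains M where "matching E M" "card M = k"
proof -
  have "finite {card M | M. matching E M}"
    by (rule finite_subset[of _ "{..card E}"]) (auto intro: card_matching_le[OF assms(1)])
  moreover have "matching E {}" by (simp add: matching_def)
  ultimately have "mat E \<in> {card M | M. matching E M}" unfolding mat_def by (intro Max_in) blast+
  then obtain M where M: "matching E M" "card M = mat E" by auto
  then obtain N where "N \<subseteq> M" "card N = k" using assms(2) by (metis obtain_subset_with_card_n)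
  then show ?thesis using that matching_subset[OF M(1)] by blast
qed

text \<open>For r blocks the admissible total is at most r + k - 1: a single block carries at most k
  edges, two blocks together up to k + 1.\<close>

lemma aim_eq_iff_not_splits:
  assumes "k \<ge> 1" "finite E" "forest E" "k \<le> mat E"
  shows "aim E k = k \<longleftrightarrow> \<not> splits E k"
proof -
  let ?S = "{card M | M. admissible_matching E k M}"
  have forest_induced: "forest (induced E U)" for U
    using assms(3) by (rule forest_subset) (auto simp: induced_def)
  have fin: "finite ?S"
    by (rule finite_subset[of _ "{..card E}"])
      (auto simp: admissible_matching_def intro: card_matching_le[OF assms(2)])
  obtain M0 where M0: "matching E M0" "card M0 = k" using matching_of_card assms(2,4) by blast
  have "M0 \<noteq> {}" using M0(2) assms(1) by auto
  then have "admissible_matching E k M0"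
    unfolding admissible_matching_def admissible_seq_def using M0 assms(1) forest_induced
    by (intro conjI exI[of _ "[M0]"]) auto
  then have k_in: "k \<in> ?S" using M0(2) by auto
  then have aim: "aim E k = Max ?S" unfolding aim_def by auto
  show ?thesis
  proof
    assume k: "aim E k = k"
    show "\<not> splits E k"
    proof
      assume "splits E k"
      then obtain M N where MN: "M \<noteq> {}" "N \<noteq> {}" "M \<inter> N = {}" "matching E (M \<union> N)"
        "card (M \<union> N) = Suc k" "\<forall>e\<in>M. \<forall>f\<in>N. gap E e f" by (rule splitsE)
      have fMN: "finite M" "finite N" using MN(5) by (metis card.infinite finite_Un nat.distinct(1))+
      have card_MN: "card M + card N = Suc k" using MN(3,5) fMN by (simp add: card_Un_disjoint)
      have pos: "card M \<ge> 1" "card N \<ge> 1" using MN(1,2) fMN by (simp_all add: Suc_le_eq card_gt_0_iff)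
      have gap_sym: "gap E f e" if "gap E e f" for e f
        using that unfolding gap_def by (metis Int_commute insert_commute)
      have "admissible_matching E k (M \<union> N)"
        unfolding admissible_matching_def
      proof (intro conjI exI[of _ "[M, N]"] allI impI ballI)
        show "matching E (M \<union> N)" by (rule MN(4))
        show "[M, N] ! i \<noteq> {}" "[M, N] ! i \<subseteq> M \<union> N" if "i < length [M, N]" for i
          using that MN(1,2) by (auto simp: less_Suc_eq)
        show "[M, N] ! i \<inter> [M, N] ! j = {}" if "i < length [M, N]" "j < length [M, N]" "i \<noteq> j" for i j
          using that MN(3) by (auto simp: less_Suc_eq)
        show "gap E e f" if "i < length [M, N]" "j < length [M, N]" "i \<noteq> j" "e \<in> [M, N] ! i" "f \<in> [M, N] ! j"
          for i j e f
          using that MN(6) gap_sym by (auto simp: less_Suc_eq)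
        show "admissible_seq k (map card [M, N])"
          using pos card_MN by (auto simp: admissible_seq_def)
        show "forest (induced E (\<Union> ([M, N] ! i)))" for i by (rule forest_induced)
      qed simp
      then have "Suc k \<in> ?S" using MN(5) by (intro CollectI exI[of _ "M \<union> N"]) simp
      then have "Suc k \<le> aim E k" unfolding aim using fin by (intro Max_ge)
      then show False using k by simp
    qed
  next
    assume ns: "\<not> splits E k"
    have "card M \<le> k" if adm: "admissible_matching E k M" for M
    proof (rule ccontr)
      assume big: "\<not> card M \<le> k"
      have mM: "matching E M" using adm by (simp add: admissible_matching_def)
      have finM: "finite M" using big by (metis card.infinite le0)
      obtain Ms :: "nat set set list" where
        Ms: "\<forall>i<length Ms. Ms ! i \<noteq> {} \<and> Ms ! i \<subseteq> M"
        "\<forall>i<length Ms. \<forall>j<length Ms. i \<noteq> j \<longrightarrow> Ms ! i \<inter> Ms ! j = {}"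
        and un: "\<Union> (set Ms) = M"
        and gp: "\<forall>i<length Ms. \<forall>j<length Ms. i \<noteq> j \<longrightarrow> (\<forall>e\<in>Ms ! i. \<forall>f\<in>Ms ! j. gap E e f)"
        and seq: "admissible_seq k (map card Ms)"
        using adm unfolding admissible_matching_def by (elim conjE exE) (rule that)
      have ne: "Ms ! i \<noteq> {} \<and> Ms ! i \<subseteq> M" if "i < length Ms" for i using Ms(1) that by simp
      have dis: "Ms ! i \<inter> Ms ! j = {}" if "i < length Ms" "j < length Ms" "i \<noteq> j" for i j
        using Ms(2) that by simp
      have len: "length Ms \<ge> 2"
      proof (rule ccontr)
        assume "\<not> length Ms \<ge> 2"
        then consider "Ms = []" | M' where "Ms = [M']" by (cases Ms; cases "tl Ms") auto
        then show False
        proof cases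
          case 1
          then show False using un big by simp
        next
          case 2
          then show False using un big seq by (simp add: admissible_seq_def)
        qed
      qed
      then have i01: "0 < length Ms" "1 < length Ms" by auto
      obtain e where e: "e \<in> Ms ! 0" using ne[OF i01(1)] by blast
      obtain f where f: "f \<in> Ms ! 1" using ne[OF i01(2)] by blast
      have fn: "f \<notin> Ms ! 0" using dis[OF i01] f by auto
      then have "e \<noteq> f" using e by blast
      have "{e, f} \<subseteq> M" using e f ne i01 by blast
      moreover have "card {e, f} \<le> Suc k" using \<open>e \<noteq> f\<close> assms(1) by simp
      \<comment> \<open>Shrinks \<open>M\<close> to k + 1 edges while keeping an edge in each of two
        blocks, so that both sides of the splitting are nonempty.\<close>
      ultimately obtain T where T: "{e, f} \<subseteq> T" "T \<subseteq> M" "card T = Suc k"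
        using exists_subset_between[of "{e, f}" "Suc k" M] big finM by auto
      have split: "(T \<inter> Ms ! 0) \<union> (T - Ms ! 0) = T" by blast
      have "splits E k"
      proof (rule splitsI[of "T \<inter> Ms ! 0" "T - Ms ! 0"], unfold split)
        show "T \<inter> Ms ! 0 \<noteq> {}" using e T(1) by blast
        show "T - Ms ! 0 \<noteq> {}" using f fn T(1) by blast
        show "T \<inter> Ms ! 0 \<inter> (T - Ms ! 0) = {}" by blast
        show "matching E T" using mM T(2) by (rule matching_subset)
        show "card T = Suc k" by (rule T(3))
        fix e' f' assume e': "e' \<in> T \<inter> Ms ! 0" and f': "f' \<in> T - Ms ! 0"
        then have "f' \<in> \<Union> (set Ms)" using T(2) un by blast
        then obtain j where j: "j < length Ms" "f' \<in> Ms ! j" by (metis UnionE in_set_conv_nth)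
        then have "0 \<noteq> j" using f' by (metis DiffD2)
        then show "gap E e' f'" using gp i01(1) j e' by auto
      qed
      then show False using ns by blast
    qed
    then show "aim E k = k" unfolding aim using fin k_in by (intro Max_eqI) auto
  qed
qed

text \<open>The edges of a matching are disjoint, so the product of their monomials is the
  squarefree monomial on the covered vertices.\<close>

lemma sq_power_ideal_eq:
  assumes E: "\<And>e. e \<in> E \<Longrightarrow> card e = 2 \<and> e \<subseteq> {1..n}"
  shows "sq_power_ideal n E k = (sq_ideal {1..n} (match_family E k) :: 'k::field mpoly set)"
proof -
  have "(\<Prod>e\<in>M. edge_mono e) = term_of (ind (\<Union>M)) (1 :: 'k)" if M: "matching E M" for M
  proof -
    have sub: "\<Union>M \<subseteq> {1..n}" using M E by (auto simp: matching_def)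
    have "e \<subseteq> {1..n}" if "e \<in> M" for e using that sub by blast
    then have "finite e" if "e \<in> M" for e using that finite_subset by blast
    then have "(\<Prod>e\<in>M. edge_mono e) = (\<Prod>i\<in>\<Union>M. var i :: 'k mpoly)"
      unfolding edge_mono_def
      by (subst prod.Union_disjoint) (use M in \<open>auto simp: matching_def\<close>)
    then show ?thesis using sub by (simp add: term_ind finite_subset)
  qed
  then have "{\<Prod>e\<in>M. edge_mono e | M. matching E M \<and> card M = k} =
      (\<lambda>W. term_of (ind W) (1 :: 'k)) ` {\<Union>M | M. matching E M \<and> card M = k}"
    by (auto intro!: image_eqI) metis
  moreover have "finite W \<and> W \<subseteq> {1..n}" if "W \<in> {\<Union>M | M. matching E M \<and> card M = k}" for W
  proof -
    have "W \<subseteq> {1..n}" using that E by (auto simp: matching_def)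
    then show ?thesis using finite_subset by blast
  qed
  ultimately show ?thesis
    unfolding sq_power_ideal_def match_family_def by (simp only: ideal_gen_squarefree)
qed

lemma card_supp_le_mdeg: "card (supp m) \<le> mdeg m"
proof -
  have "card (supp m) = (\<Sum>i\<in>supp m. 1)" by simp
  also have "\<dots> \<le> mdeg m" unfolding mdeg_def by (rule sum_mono) (simp add: in_keys_iff Suc_le_eq)
  finally show ?thesis .
qed

theorem theorem5p10:
  fixes k n :: nat and E :: "nat set set"
  assumes "k \<ge> 1"
    and "simple_graph n E"
    and "forest E"
    and "mat E \<ge> k"
  shows "reg {1..n} (sq_power_ideal n E k :: 'k::field mpoly set) = 2 * int k
         \<longleftrightarrow> aim E k = k"
proof -
  let ?V = "{1..n}"
  let ?I = "sq_ideal ?V (match_family E k) :: 'k mpoly set"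
  have E: "card e = 2 \<and> e \<subseteq> ?V" if "e \<in> E" for e
    using assms(2) that by (auto simp: simple_graph_def)
  have finE: "finite E" by (rule finite_subset[of _ "Pow ?V"]) (use E in auto)
  have sub_V: "\<Union>M \<subseteq> ?V" if "matching E M" for M using that E by (auto simp: matching_def)
  have I_eq: "sq_power_ideal n E k = ?I" using E by (rule sq_power_ideal_eq)
  \<comment> \<open>All that \<open>SOME\<close> reveals about \<open>reg\<close> is that it
    satisfies \<open>R\<close>, provided some number does.\<close>
  define R where "R r \<longleftrightarrow> (\<exists>ds A L. minimal_graded_free_res ?V ?I ds A L \<and>
      r = Max {ds i ! l - int i | i l. l < length (ds i)})" for r
  have "\<exists>t. has_res ?V ?I t"
    unfolding match_family_def
  proof (rule has_res_up_family)
    show "finite {\<Union>M | M. matching E M \<and> card M = k}"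
      by (rule finite_subset[of _ "Pow ?V"]) (use sub_V in auto)
    show "finite W \<and> W \<subseteq> ?V" if "W \<in> {\<Union>M | M. matching E M \<and> card M = k}" for W
      using that sub_V by (auto intro: finite_subset)
  qed
  then obtain B0 :: "nat set" and lev0 deg0 e0 D0 where "gres ?V ?I B0 lev0 deg0 e0 D0"
    by (auto simp: has_res_def)
  then obtain B1 e1 D1 where "gres ?V ?I B1 lev0 deg0 e1 D1" "\<forall>m l. coeff (D1 m l) 0 = 0"
    using minimal_gres_exists by metis
  then have "\<exists>ds A L. minimal_graded_free_res ?V ?I ds A L"
    by (intro graded_free_res_of_gres) auto
  then have "\<exists>r. R r" by (auto simp: R_def)
  moreover have "reg ?V ?I = (SOME r. R r)" by (simp add: reg_def R_def)
  ultimately have "R (reg ?V ?I)" by (metis someI_ex)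
  then obtain ds A L where min_res: "minimal_graded_free_res ?V ?I ds A L"
    and reg: "reg ?V ?I = Max {ds i ! l - int i | i l. l < length (ds i)}" by (auto simp: R_def)
  let ?S = "{ds i ! l - int i | i l. l < length (ds i)}"
  let ?B = "index_set ds" and ?deg = "\<lambda>(i, l). ds i ! l"
  have res: "gres ?V ?I ?B fst ?deg (aug_of A) (mat_of A)"
    using min_res by (intro gres_of_graded_free_res[of _ _ ds A L]) (simp add: minimal_graded_free_res_def)
  interpret gres ?V ?I ?B fst ?deg "aug_of A" "mat_of A" by (rule res)
  have S_eq: "?S = (\<lambda>b. ?deg b - int (fst b)) ` ?B"
    by (auto simp: index_set_def image_iff; blast)
  have finS: "finite ?S" unfolding S_eq using fin by simp
  have le_reg: "ds i ! l - int i \<le> reg ?V ?I" if "l < length (ds i)" for i l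
    unfolding reg using finS by (rule Max_ge) (use that in blast)
  \<comment> \<open>A k-matching makes the ideal nonzero, so the resolution has a nonzero
    augmentation entry, whose degree bounds \<open>reg\<close> from below.\<close>
  obtain M0 where M0: "matching E M0" "card M0 = k" using matching_of_card finE assms(4) by blast
  have "term_of (ind (\<Union>M0)) 1 \<in> ?I"
  proof (rule sq_idealI)
    have fM0: "finite (\<Union>M0)" using sub_V[OF M0(1)] by (rule finite_subset) simp
    show "in_vars ?V (term_of (ind (\<Union>M0)) (1 :: 'k))"
      using sub_V[OF M0(1)] fM0 by (intro in_vars_termI) simp
    show "supp m \<in> match_family E k" if "m \<in> supp (term_of (ind (\<Union>M0)) (1 :: 'k))" for m
      using that M0 fM0 by (auto simp: match_family_iff)
  qed
  then obtain v where v: "rowapp ?B (aug_of A) v = term_of (ind (\<Union>M0)) (1 :: 'k)"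
    using img by (metis imageE)
  have "\<exists>b\<in>?B. aug_of A b \<noteq> 0"
  proof (rule ccontr)
    assume "\<not> ?thesis"
    then have "rowapp ?B (aug_of A) v = 0" unfolding rowapp_def by (intro sum.neutral) auto
    then have "coeff (term_of (ind (\<Union>M0)) (1 :: 'k)) (ind (\<Union>M0)) = 0" using v by simp
    then show False by simp
  qed
  then obtain b where b: "b \<in> ?B" "aug_of A b \<noteq> 0" by blast
  then obtain m where m: "m \<in> supp (aug_of A b)" by (metis keys_eq_empty ex_in_conv poly_mapping_eqI in_keys_iff lookup_zero)
  \<comment> \<open>A monomial of this entry involves all vertices of some k-matching, hence has
    degree at least 2k.\<close>
  have "supp m \<in> match_family E k" using e_in_I[OF b(1)] m by (simp add: sq_ideal_def)
  then obtain M where M: "matching E M" "card M = k" "\<Union>M \<subseteq> supp m" by (auto simp: match_family_iff)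
  have "2 * k = card (\<Union>M)" using card_Union_matching[OF M(1)] E M(2) by simp
  also have "\<dots> \<le> card (supp m)" using M(3) by (intro card_mono) auto
  also have "\<dots> \<le> mdeg m" by (rule card_supp_le_mdeg)
  also have "int (mdeg m) = ?deg b" using e_hom[of b] m by (simp add: hom_deg_def)
  finally have "2 * int k \<le> ?deg b" by simp
  moreover have "fst b = 0" using e_lev[OF b(2)] by blast
  ultimately have lower: "2 * int k \<le> reg ?V ?I"
    using le_reg[of "snd b" "fst b"] b(1) by (cases b) (simp add: index_set_def)
  have "reg ?V ?I = 2 * int k \<longleftrightarrow> \<not> splits E k"
  proof
    assume eq: "reg ?V ?I = 2 * int k"
    show "\<not> splits E k"
    proof (rule linear_first_syzygies_imp_not_splits[OF res E])
      show "?deg b \<le> 2 * int k + 1" if "b \<in> ?B" "fst b = 1" for b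
        using le_reg[of "snd b" "fst b"] that eq by (cases b) (simp add: index_set_def)
    qed
  next
    assume "\<not> splits E k"
    then have "has_res ?V ?I (2 * int k)" using E assms(3) by (intro forest_linear_res) auto
    then obtain B :: "nat set" and lev deg e D where G: "gres ?V ?I B lev deg e D"
      and bound: "\<And>b. b \<in> B \<Longrightarrow> deg b \<le> 2 * int k + int (lev b)" by (auto simp: has_res_def)
    \<comment> \<open>Minimality is what transfers the degree bound of the constructed linear
      resolution to the one chosen by \<open>reg\<close>.\<close>
    have "coeff (mat_of A m l) 0 = 0" for m l
      using min_res unfolding minimal_graded_free_res_def mat_of_def by (auto split: prod.split)
    then have "?deg b \<le> 2 * int k + int (fst b)" if "b \<in> ?B" for b
      using minimal_degree_bound[OF res G _ bound that] by blast
    then have "x \<le> 2 * int k" if "x \<in> ?S" for x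
      using that unfolding S_eq by fastforce
    moreover have "?S \<noteq> {}" unfolding S_eq using b(1) by blast
    ultimately have "reg ?V ?I \<le> 2 * int k" unfolding reg using finS by (intro Max.boundedI) auto
    then show "reg ?V ?I = 2 * int k" using lower by simp
  qed
  then show ?thesis
    using aim_eq_iff_not_splits[OF assms(1) finE assms(3,4)] by (simp add: I_eq)
qed

end
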